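(* Let $n>1$ be an integer prime to $\operatorname{char}(\Bbbk)$, and let $\mathbf{t}_1,\mathbf{t}_2\in\mathbb{A}_X$ be two parameter vectors with ramification profiles $\mathfrak{e}_1,\mathfrak{e}_2$. Then the $\mathbb{A}_X$-algebras $\mathbb{A}_X\{\mathbf{t}_1^{1/n}\}$ and $\mathbb{A}_X\{\mathbf{t}_2^{1/n}\}$ are isomorphic if and only if $\mathfrak{e}_1=\mathfrak{e}_2$ and $\mathbf{t}_1=u\cdot\mathbf{t}_2$ for some $u\in\mathbb{I}_X$. In particular, if $\mathbf{t}_1,\mathbf{t}_2\in\mathbb{I}_X$, then $\mathbb{A}_X\{\mathbf{t}_1^{1/n}\}\simeq\mathbb{A}_X\{\mathbf{t}_2^{1/n}\}$ as $\mathbb{A}_X$-algebras if and only if $\mathfrak{e}_1=\mathfrak{e}_2$.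
   Context: $\Bbbk$ is an algebraically closed field and $X$ is a projective, irreducible, non-singular curve over $\Bbbk$ with function field $\Sigma$. "$x\in X$" always means a closed point. For $x \in X$, $\upsilon_x$ is the corresponding discrete valuation of $\Sigma$, $A_x$ is the completion of the local ring of $X$ at $x$, $K_x$ is the fraction field of $A_x$, and $\upsilon_x$ also denotes the extended valuation on $K_x$. The adele ring is $\mathbb{A}_X=\{(\alpha_x)_x\in\prod_{x\in X}K_x : \alpha_x\in A_x \text{ for all but finitely many } x\}$, and $\mathbb{I}_X=\mathbb{A}_X^*$ is the idele group. A parameter vector is an adele $\mathbf{t}=(t_x)_x\in\mathbb{A}_X$ such that $t_x\neq 0$ for all $x\in X$ and the set $\operatorname{Ram}(\mathbf{t})=\{x\in X : \upsilon_x(t_x)\not\equiv 0 \bmod n\}$ is finite. Its ramification index at $x$ is $e_x = n/\gcd(n,\upsilon_x(t_x))$ and its ramification profile is $\mathfrak{e}=(e_x)_{x\in X}$. Put $\mathbb{A}_X\{\mathbf{t}^{1/n}\} = \mathbb{A}_X[T]/(T^n-\mathbf{t})$. *)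

theory Defs
  imports
    "HOL-Algebra.Algebra"
    "HOL-Algebra.Algebraic_Closure_Type"
    "HOL-Library.Poly_Mapping"
begin

section \<open>Commutative algebra\<close>

subsection \<open>Rings of fractions\<close>

text \<open>
  \<open>P\<close> is the set of admissible pairs (numerator, denominator), where \<open>R\<close> is a domain and all
  denominators are nonzero.  It has to contain \<open>(0, 1)\<close> and \<open>(1, 1)\<close> and be closed under the
  sums and products of fractions below; taking all pairs with nonzero denominator gives the
  fraction field.
\<close>

definition frac_rel :: "('a, 'm) ring_scheme \<Rightarrow> ('a \<times> 'a) set \<Rightarrow> (('a \<times> 'a) \<times> ('a \<times> 'a)) set" where
  "frac_rel R P =
    {((a, b), (c, d)). (a, b) \<in> P \<and> (c, d) \<in> P \<and> a \<otimes>\<^bsub>R\<^esub> d = c \<otimes>\<^bsub>R\<^esub> b}"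

definition fractions :: "('a, 'm) ring_scheme \<Rightarrow> ('a \<times> 'a) set \<Rightarrow> ('a \<times> 'a) set ring" where
  "fractions R P =
    \<lparr>carrier = P // frac_rel R P,
     monoid.mult = (\<lambda>A B. \<Union>(a, b)\<in>A. \<Union>(c, d)\<in>B. frac_rel R P `` {(a \<otimes>\<^bsub>R\<^esub> c, b \<otimes>\<^bsub>R\<^esub> d)}),
     one = frac_rel R P `` {(\<one>\<^bsub>R\<^esub>, \<one>\<^bsub>R\<^esub>)},
     ring.zero = frac_rel R P `` {(\<zero>\<^bsub>R\<^esub>, \<one>\<^bsub>R\<^esub>)},
     add = (\<lambda>A B. \<Union>(a, b)\<in>A. \<Union>(c, d)\<in>B.
        frac_rel R P `` {(a \<otimes>\<^bsub>R\<^esub> d \<oplus>\<^bsub>R\<^esub> c \<otimes>\<^bsub>R\<^esub> b, b \<otimes>\<^bsub>R\<^esub> d)})\<rparr>"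

definition all_pairs :: "('a, 'm) ring_scheme \<Rightarrow> ('a \<times> 'a) set" where
  "all_pairs R = carrier R \<times> (carrier R - {\<zero>\<^bsub>R\<^esub>})"

definition frac_field :: "('a, 'm) ring_scheme \<Rightarrow> ('a \<times> 'a) set ring" where
  "frac_field R = fractions R (all_pairs R)"

definition to_frac :: "('a, 'm) ring_scheme \<Rightarrow> 'a \<Rightarrow> ('a \<times> 'a) set" where
  "to_frac R a = frac_rel R (all_pairs R) `` {(a, \<one>\<^bsub>R\<^esub>)}"

subsection \<open>Local rings, completions and valuations\<close>

primrec ideal_pow :: "('a, 'm) ring_scheme \<Rightarrow> 'a set \<Rightarrow> nat \<Rightarrow> 'a set" where
  "ideal_pow R I 0 = carrier R"
| "ideal_pow R I (Suc i) = ideal_prod R I (ideal_pow R I i)"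

text \<open>The inverse limit of the rings \<open>R / I\<^sup>i\<close>; a coset \<open>a (Suc i)\<close> modulo the next power
  maps to the coset \<open>a i\<close> modulo \<open>I\<^sup>i\<close> iff it is contained in it.\<close>

definition adic_completion :: "('a, 'm) ring_scheme \<Rightarrow> 'a set \<Rightarrow> (nat \<Rightarrow> 'a set) ring" where
  "adic_completion R I =
    \<lparr>carrier = {a. \<forall>i. a i \<in> carrier (R Quot ideal_pow R I i) \<and> a (Suc i) \<subseteq> a i},
     monoid.mult = (\<lambda>a b i. a i \<otimes>\<^bsub>R Quot ideal_pow R I i\<^esub> b i),
     one = (\<lambda>i. \<one>\<^bsub>R Quot ideal_pow R I i\<^esub>),
     ring.zero = (\<lambda>i. \<zero>\<^bsub>R Quot ideal_pow R I i\<^esub>),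
     add = (\<lambda>a b i. a i \<oplus>\<^bsub>R Quot ideal_pow R I i\<^esub> b i)\<rparr>"

text \<open>In a local ring the non-units form the unique maximal ideal.\<close>

definition max_ideal :: "('a, 'm) ring_scheme \<Rightarrow> 'a set" where
  "max_ideal R = carrier R - Units R"

definition completion :: "('a, 'm) ring_scheme \<Rightarrow> (nat \<Rightarrow> 'a set) ring" where
  "completion R = adic_completion R (max_ideal R)"

text \<open>The \<open>R/M\<close>-vector space \<open>M/M\<^sup>2\<close> of a local ring \<open>R\<close> with maximal ideal \<open>M\<close> has dimension
  one: it is spanned by the class of some \<open>p\<close>, and this class is nonzero.\<close>

definition cotangent_dim_one :: "('a, 'm) ring_scheme \<Rightarrow> bool" where
  "cotangent_dim_one R \<longleftrightarrow>
    (\<exists>p \<in> max_ideal R. p \<notin> ideal_pow R (max_ideal R) 2 \<and>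
      (\<forall>f \<in> max_ideal R. \<exists>c \<in> carrier R. f \<ominus>\<^bsub>R\<^esub> c \<otimes>\<^bsub>R\<^esub> p \<in> ideal_pow R (max_ideal R) 2))"

text \<open>The normalized discrete valuation of a discrete valuation ring \<open>R\<close>, extended to the nonzero
  elements of its fraction field; the value at zero is irrelevant.\<close>

definition dvr_ord :: "('a, 'm) ring_scheme \<Rightarrow> 'a \<Rightarrow> nat" where
  "dvr_ord R a = (GREATEST i. a \<in> ideal_pow R (max_ideal R) i)"

definition dvr_val :: "('a, 'm) ring_scheme \<Rightarrow> ('a \<times> 'a) set \<Rightarrow> int" where
  "dvr_val R z = (THE m. \<exists>(a, b) \<in> z. m = int (dvr_ord R a) - int (dvr_ord R b))"

subsection \<open>Transcendence degree one\<close>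

definition trdeg_one :: "('a, 'm) ring_scheme \<Rightarrow> 'a set \<Rightarrow> bool" where
  "trdeg_one L K \<longleftrightarrow>
    (\<exists>s \<in> carrier L. ring.transcendental L K s \<and>
      (\<forall>a \<in> carrier L. \<not> ring.transcendental L (generate_field L (insert s K)) a))"

section \<open>Projective curves\<close>

text \<open>Polynomials in the variables indexed by \<open>'v\<close>; projective space over \<open>'k\<close> has dimension
  \<open>CARD('v) - 1\<close>, and a point of it is the set of its homogeneous coordinate vectors.\<close>

type_synonym ('v, 'k) mpol = "('v \<Rightarrow>\<^sub>0 nat) \<Rightarrow>\<^sub>0 'k"

type_synonym ('v, 'k) point = "('v \<Rightarrow> 'k) set"

definition mpol_eval :: "('v::finite, 'k::comm_ring_1) mpol \<Rightarrow> ('v \<Rightarrow> 'k) \<Rightarrow> 'k" where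
  "mpol_eval f w =
    (\<Sum>m \<in> Poly_Mapping.keys f. Poly_Mapping.lookup f m * (\<Prod>i \<in> UNIV. w i ^ Poly_Mapping.lookup m i))"

definition homogeneous :: "nat \<Rightarrow> ('v::finite, 'k::comm_ring_1) mpol \<Rightarrow> bool" where
  "homogeneous d f \<longleftrightarrow> (\<forall>m \<in> Poly_Mapping.keys f. (\<Sum>i \<in> UNIV. Poly_Mapping.lookup m i) = d)"

definition proj_space :: "('v::finite, 'k::field) point set" where
  "proj_space = {{(\<lambda>i. c * w i) | c. c \<noteq> 0} | w. w \<noteq> (\<lambda>_. 0)}"

definition vanishes_at :: "('v::finite, 'k::field) mpol \<Rightarrow> ('v, 'k) point \<Rightarrow> bool" where
  "vanishes_at f x \<longleftrightarrow> (\<forall>w \<in> x. mpol_eval f w = 0)"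

definition proj_closed :: "('v::finite, 'k::field) point set \<Rightarrow> bool" where
  "proj_closed Y \<longleftrightarrow>
    (\<exists>S. (\<forall>f \<in> S. \<exists>d. homogeneous d f) \<and> Y = {x \<in> proj_space. \<forall>f \<in> S. vanishes_at f x})"

definition proj_irreducible :: "('v::finite, 'k::field) point set \<Rightarrow> bool" where
  "proj_irreducible C \<longleftrightarrow> C \<noteq> {} \<and>
    (\<forall>Y Z. proj_closed Y \<and> proj_closed Z \<and> C \<subseteq> Y \<union> Z \<longrightarrow> C \<subseteq> Y \<or> C \<subseteq> Z)"

definition vanishing_ideal :: "('v::finite, 'k::field) point set \<Rightarrow> ('v, 'k) mpol set" where
  "vanishing_ideal C = {f. \<forall>x \<in> C. vanishes_at f x}"

definition coord_ring :: "('v::finite, 'k::field) point set \<Rightarrow> ('v, 'k) mpol set ring" where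
  "coord_ring C = ring_of_type_algebra Quot vanishing_ideal C"

definition coord_class :: "('v::finite, 'k::field) point set \<Rightarrow> ('v, 'k) mpol \<Rightarrow> ('v, 'k) mpol set" where
  "coord_class C f = vanishing_ideal C +>\<^bsub>ring_of_type_algebra\<^esub> f"

definition form_pairs ::
  "('v::finite, 'k::field) point set \<Rightarrow> (('v, 'k) mpol set \<times> ('v, 'k) mpol set) set" where
  "form_pairs C =
    {(coord_class C f, coord_class C g) | f g d.
       homogeneous d f \<and> homogeneous d g \<and> g \<notin> vanishing_ideal C}"

type_synonym ('v, 'k) rat_fun = "(('v, 'k) mpol set \<times> ('v, 'k) mpol set) set"

definition function_field :: "('v::finite, 'k::field) point set \<Rightarrow> ('v, 'k) rat_fun ring" where
  "function_field C = fractions (coord_ring C) (form_pairs C)"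

definition const_fun :: "('v::finite, 'k::field) point set \<Rightarrow> 'k \<Rightarrow> ('v, 'k) rat_fun" where
  "const_fun C c = frac_rel (coord_ring C) (form_pairs C) ``
    {(coord_class C (Poly_Mapping.single 0 c), coord_class C 1)}"

definition local_ring :: "('v::finite, 'k::field) point set \<Rightarrow> ('v, 'k) point \<Rightarrow> ('v, 'k) rat_fun ring" where
  "local_ring C x = (function_field C)
    \<lparr>carrier := {z \<in> carrier (function_field C). \<exists>f g d. homogeneous d f \<and> homogeneous d g \<and>
        \<not> vanishes_at g x \<and> (coord_class C f, coord_class C g) \<in> z}\<rparr>"

text \<open>The dimension of an irreducible variety is the transcendence degree of its function field, and
  a point is non-singular iff the dimension of its cotangent space equals that of the variety.\<close>

definition nonsingular_proj_curve :: "('v::finite, 'k::field) point set \<Rightarrow> bool" where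
  "nonsingular_proj_curve C \<longleftrightarrow>
    proj_closed C \<and> proj_irreducible C \<and>
    trdeg_one (function_field C) (range (const_fun C)) \<and>
    (\<forall>x \<in> C. cotangent_dim_one (local_ring C x))"

section \<open>Adeles and ramified covers\<close>

definition complete_local_ring ::
  "('v::finite, 'k::field) point set \<Rightarrow> ('v, 'k) point \<Rightarrow> (nat \<Rightarrow> ('v, 'k) rat_fun set) ring" where
  "complete_local_ring C x = completion (local_ring C x)"

type_synonym ('v, 'k) local_elem =
  "((nat \<Rightarrow> ('v, 'k) rat_fun set) \<times> (nat \<Rightarrow> ('v, 'k) rat_fun set)) set"

definition local_field ::
  "('v::finite, 'k::field) point set \<Rightarrow> ('v, 'k) point \<Rightarrow> ('v, 'k) local_elem ring" where
  "local_field C x = frac_field (complete_local_ring C x)"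

definition local_integers ::
  "('v::finite, 'k::field) point set \<Rightarrow> ('v, 'k) point \<Rightarrow> ('v, 'k) local_elem set" where
  "local_integers C x = to_frac (complete_local_ring C x) ` carrier (complete_local_ring C x)"

text \<open>The extension to the local field of the valuation of the function field at \<open>x\<close> is the
  valuation of the discrete valuation ring \<open>complete_local_ring C x\<close>.\<close>

definition point_val :: "('v::finite, 'k::field) point set \<Rightarrow> ('v, 'k) point \<Rightarrow> ('v, 'k) local_elem \<Rightarrow> int" where
  "point_val C x = dvr_val (complete_local_ring C x)"

type_synonym ('v, 'k) adele = "('v, 'k) point \<Rightarrow> ('v, 'k) local_elem"

definition adele_ring :: "('v::finite, 'k::field) point set \<Rightarrow> ('v, 'k) adele ring" where
  "adele_ring C =
    \<lparr>carrier = {a \<in> \<Pi>\<^sub>E x\<in>C. carrier (local_field C x). finite {x \<in> C. a x \<notin> local_integers C x}},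
     monoid.mult = (\<lambda>a b. \<lambda>x\<in>C. a x \<otimes>\<^bsub>local_field C x\<^esub> b x),
     one = (\<lambda>x\<in>C. \<one>\<^bsub>local_field C x\<^esub>),
     ring.zero = (\<lambda>x\<in>C. \<zero>\<^bsub>local_field C x\<^esub>),
     add = (\<lambda>a b. \<lambda>x\<in>C. a x \<oplus>\<^bsub>local_field C x\<^esub> b x)\<rparr>"

definition idele_group :: "('v::finite, 'k::field) point set \<Rightarrow> ('v, 'k) adele set" where
  "idele_group C = Units (adele_ring C)"

definition Ram :: "('v::finite, 'k::field) point set \<Rightarrow> nat \<Rightarrow> ('v, 'k) adele \<Rightarrow> ('v, 'k) point set" where
  "Ram C n t = {x \<in> C. point_val C x (t x) mod int n \<noteq> 0}"

definition parameter_vector :: "('v::finite, 'k::field) point set \<Rightarrow> nat \<Rightarrow> ('v, 'k) adele \<Rightarrow> bool" where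
  "parameter_vector C n t \<longleftrightarrow>
    t \<in> carrier (adele_ring C) \<and> (\<forall>x\<in>C. t x \<noteq> \<zero>\<^bsub>local_field C x\<^esub>) \<and> finite (Ram C n t)"

definition ramification_profile ::
  "('v::finite, 'k::field) point set \<Rightarrow> nat \<Rightarrow> ('v, 'k) adele \<Rightarrow> ('v, 'k) point \<Rightarrow> nat" where
  "ramification_profile C n t = (\<lambda>x\<in>C. n div nat (gcd (int n) (point_val C x (t x))))"

definition root_poly :: "('a, 'm) ring_scheme \<Rightarrow> nat \<Rightarrow> 'a \<Rightarrow> nat \<Rightarrow> 'a" where
  "root_poly R n t = up_ring.monom (UP R) \<one>\<^bsub>R\<^esub> n \<ominus>\<^bsub>UP R\<^esub> up_ring.monom (UP R) t 0"

definition root_algebra :: "('a, 'm) ring_scheme \<Rightarrow> nat \<Rightarrow> 'a \<Rightarrow> (nat \<Rightarrow> 'a) set ring" where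
  "root_algebra R n t = UP R Quot (PIdl\<^bsub>UP R\<^esub> (root_poly R n t))"

text \<open>The structure map of \<open>R[T]/(T\<^sup>n - t)\<close> as an \<open>R\<close>-algebra.\<close>

definition root_algebra_map :: "('a, 'm) ring_scheme \<Rightarrow> nat \<Rightarrow> 'a \<Rightarrow> 'a \<Rightarrow> (nat \<Rightarrow> 'a) set" where
  "root_algebra_map R n t a = PIdl\<^bsub>UP R\<^esub> (root_poly R n t) +>\<^bsub>UP R\<^esub> up_ring.monom (UP R) a 0"

text \<open>Isomorphism of the \<open>R\<close>-algebras given by the structure maps \<open>i\<close> from \<open>R\<close> to \<open>B\<close> and \<open>j\<close> from
  \<open>R\<close> to \<open>C\<close>.\<close>

definition algebra_isomorphic ::
  "('a, 'm) ring_scheme \<Rightarrow> ('b, 'p) ring_scheme \<Rightarrow> ('a \<Rightarrow> 'b) \<Rightarrow> ('c, 'q) ring_scheme \<Rightarrow> ('a \<Rightarrow> 'c) \<Rightarrow> bool" where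
  "algebra_isomorphic R B i C j \<longleftrightarrow> (\<exists>h \<in> ring_iso B C. \<forall>a \<in> carrier R. h (i a) = j a)"

definition adelic_root_algebras_iso ::
  "('v::finite, 'k::field) point set \<Rightarrow> nat \<Rightarrow> ('v, 'k) adele \<Rightarrow> ('v, 'k) adele \<Rightarrow> bool" where
  "adelic_root_algebras_iso C n t1 t2 \<longleftrightarrow>
    algebra_isomorphic (adele_ring C)
      (root_algebra (adele_ring C) n t1) (root_algebra_map (adele_ring C) n t1)
      (root_algebra (adele_ring C) n t2) (root_algebra_map (adele_ring C) n t2)"

end

theory Submission
  imports Defs
begin

text \<open>
  The completed local ring at a point is a discrete valuation ring in which every unit has an
  \<open>n\<close>-th root (Newton's method), so up to \<open>n\<close>-th powers an element of \<open>K\<^sub>x\<close> is a power of a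
  uniformizer and only its valuation modulo \<open>n\<close> matters.

  If \<open>gcd(n, \<upsilon>(t\<^sub>1)) = gcd(n, \<upsilon>(t\<^sub>2))\<close> at a point, then \<open>t\<^sub>2 = s\<^sup>n t\<^sub>1\<^sup>k\<close> there for some \<open>k\<close>
  prime to \<open>n\<close>, and \<open>T \<mapsto> s T\<^sup>k\<close> is an isomorphism.  When \<open>t\<^sub>1 = u t\<^sub>2\<close> with an idele \<open>u\<close>, almost all
  components of \<open>u\<close> are \<open>n\<close>-th powers of units, and the remaining finitely many points are changed
  one at a time by means of the idempotent supported at the point.

  Conversely, let \<open>d = gcd(n, \<upsilon>(t\<^sub>2))\<close>, \<open>n = e d\<close> and \<open>t\<^sub>2 = c\<^sup>d\<close>.  The image of \<open>T\<close> under an isomorphism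
  gives a polynomial \<open>P\<close> with \<open>P\<^sup>n = t\<^sub>1\<close> modulo \<open>T\<^sup>e - c\<close>.  Give \<open>a T\<^sup>j\<close> the weight
  \<open>e \<upsilon>(a) + j \<upsilon>(c)\<close>; as \<open>\<upsilon>(c)\<close> is prime to \<open>e\<close>, the monomials of degree below \<open>e\<close> have pairwise
  distinct weights, so \<open>P\<^sup>n\<close> is dominated by the \<open>n\<close>-th power of one monomial and \<open>n\<close> divides
  \<open>e \<upsilon>(t\<^sub>1)\<close>.  At almost all points the isomorphism is moreover integral and \<open>t\<^sub>2\<close> has \<open>n\<close>-th roots
  \<open>\<alpha> \<noteq> \<beta>\<close> in \<open>K\<^sub>x\<close>.  Then \<open>P(\<alpha>) \<noteq> P(\<beta>)\<close> are \<open>n\<close>-th roots of \<open>t\<^sub>1\<close> and \<open>\<alpha> - \<beta>\<close> divides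
  \<open>P(\<alpha>) - P(\<beta>)\<close>; since the difference of two distinct roots has the valuation of a root,
  \<open>\<upsilon>(t\<^sub>2) \<le> \<upsilon>(t\<^sub>1)\<close>.
\<close>

section \<open>Rings of fractions\<close>

locale fraction_pairs = cring R for R (structure) +
  fixes P :: "('a \<times> 'a) set"
  assumes pair_closed: "(a, b) \<in> P \<Longrightarrow> a \<in> carrier R \<and> b \<in> carrier R"
    and zero_pair: "(\<zero>, \<one>) \<in> P"
    and one_pair: "(\<one>, \<one>) \<in> P"
    and add_pair: "\<lbrakk>(a, b) \<in> P; (c, d) \<in> P\<rbrakk> \<Longrightarrow> (a \<otimes> d \<oplus> c \<otimes> b, b \<otimes> d) \<in> P"
    and mult_pair: "\<lbrakk>(a, b) \<in> P; (c, d) \<in> P\<rbrakk> \<Longrightarrow> (a \<otimes> c, b \<otimes> d) \<in> P"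
    and minus_pair: "(a, b) \<in> P \<Longrightarrow> (\<ominus> a, b) \<in> P"
    and cancel_pair: "\<lbrakk>(a, b) \<in> P; (c, d) \<in> P; (e, f) \<in> P; d \<otimes> (a \<otimes> f \<ominus> e \<otimes> b) = \<zero>\<rbrakk>
      \<Longrightarrow> a \<otimes> f = e \<otimes> b"
begin

definition fr :: "'a \<Rightarrow> 'a \<Rightarrow> ('a \<times> 'a) set" where
  "fr a b = frac_rel R P `` {(a, b)}"

lemma numer_closed: "(a, b) \<in> P \<Longrightarrow> a \<in> carrier R"
  and denom_closed: "(a, b) \<in> P \<Longrightarrow> b \<in> carrier R"
  using pair_closed by auto

lemma mem_fr: "(c, d) \<in> fr a b \<longleftrightarrow> (a, b) \<in> P \<and> (c, d) \<in> P \<and> a \<otimes> d = c \<otimes> b"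
  unfolding fr_def frac_rel_def by auto

lemma equiv_frac_rel: "equiv P (frac_rel R P)"
proof (rule equivI)
  show "frac_rel R P \<subseteq> P \<times> P" unfolding frac_rel_def by auto
  show "refl_on P (frac_rel R P)" unfolding frac_rel_def refl_on_def by auto
  show "sym (frac_rel R P)" unfolding frac_rel_def sym_def by auto
  show "trans (frac_rel R P)"
  proof (rule transI)
    fix x y z assume "(x, y) \<in> frac_rel R P" "(y, z) \<in> frac_rel R P"
    then obtain a b c d e f where x: "x = (a, b)" "y = (c, d)" "z = (e, f)"
      and P: "(a, b) \<in> P" "(c, d) \<in> P" "(e, f) \<in> P"
      and e1: "a \<otimes> d = c \<otimes> b" and e2: "c \<otimes> f = e \<otimes> d"
      unfolding frac_rel_def by auto
    note carr [simp] = P[THEN numer_closed] P[THEN denom_closed]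
    have "d \<otimes> (a \<otimes> f \<ominus> e \<otimes> b) = (a \<otimes> d) \<otimes> f \<ominus> (e \<otimes> d) \<otimes> b"
      using carr by algebra
    also have "\<dots> = \<zero>" unfolding e1 e2[symmetric] using carr by algebra
    finally have "a \<otimes> f = e \<otimes> b" by (rule cancel_pair[OF P])
    then show "(x, z) \<in> frac_rel R P" using P x unfolding frac_rel_def by auto
  qed
qed

lemma fr_eq_iff: "\<lbrakk>(a, b) \<in> P; (c, d) \<in> P\<rbrakk> \<Longrightarrow> fr a b = fr c d \<longleftrightarrow> a \<otimes> d = c \<otimes> b"
  unfolding fr_def using eq_equiv_class_iff[OF equiv_frac_rel, of "(a, b)" "(c, d)"]
  by (simp add: frac_rel_def)

lemma fr_eqI: "(c, d) \<in> fr a b \<Longrightarrow> fr a b = fr c d"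
  using mem_fr fr_eq_iff by auto

lemma fr_self: "(a, b) \<in> P \<Longrightarrow> (a, b) \<in> fr a b"
  by (simp add: mem_fr)

lemma carrier_fractions: "carrier (fractions R P) = {fr a b | a b. (a, b) \<in> P}"
  unfolding fractions_def fr_def by (auto simp: quotient_def)

lemma fractionsE:
  assumes "z \<in> carrier (fractions R P)"
  obtains a b where "(a, b) \<in> P" "z = fr a b"
  using assms carrier_fractions by auto

lemma fr_closed: "(a, b) \<in> P \<Longrightarrow> fr a b \<in> carrier (fractions R P)"
  using carrier_fractions by auto

lemma one_fractions: "\<one>\<^bsub>fractions R P\<^esub> = fr \<one> \<one>"
  and zero_fractions: "\<zero>\<^bsub>fractions R P\<^esub> = fr \<zero> \<one>"
  by (simp_all add: fractions_def fr_def)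

lemma mult_fr:
  assumes ab: "(a, b) \<in> P" and cd: "(c, d) \<in> P"
  shows "fr a b \<otimes>\<^bsub>fractions R P\<^esub> fr c d = fr (a \<otimes> c) (b \<otimes> d)"
proof -
  have "fr (a' \<otimes> c') (b' \<otimes> d') = fr (a \<otimes> c) (b \<otimes> d)"
    if "(a', b') \<in> fr a b" "(c', d') \<in> fr c d" for a' b' c' d'
  proof -
    have P: "(a', b') \<in> P" "(c', d') \<in> P" and e1: "a \<otimes> b' = a' \<otimes> b" and e2: "c \<otimes> d' = c' \<otimes> d"
      using that by (auto simp: mem_fr)
    note carr [simp] = P[THEN numer_closed] P[THEN denom_closed]
      ab[THEN numer_closed] ab[THEN denom_closed]
      cd[THEN numer_closed] cd[THEN denom_closed]
    have "(a' \<otimes> c') \<otimes> (b \<otimes> d) = (a' \<otimes> b) \<otimes> (c' \<otimes> d)" using carr by algebra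
    also have "\<dots> = (a \<otimes> b') \<otimes> (c \<otimes> d')" by (simp add: e1 e2)
    also have "\<dots> = (a \<otimes> c) \<otimes> (b' \<otimes> d')" using carr by algebra
    finally show ?thesis using fr_eq_iff mult_pair P ab cd by auto
  qed
  then have "(\<Union>(a', b')\<in>fr a b. \<Union>(c', d')\<in>fr c d. fr (a' \<otimes> c') (b' \<otimes> d')) =
      (\<Union>p\<in>fr a b. \<Union>q\<in>fr c d. fr (a \<otimes> c) (b \<otimes> d))"
    by (intro SUP_cong refl) (simp add: split_beta)
  also have "\<dots> = fr (a \<otimes> c) (b \<otimes> d)"
    using fr_self[OF ab] fr_self[OF cd] by blast
  finally have "(\<Union>(a', b')\<in>fr a b. \<Union>(c', d')\<in>fr c d. fr (a' \<otimes> c') (b' \<otimes> d')) = fr (a \<otimes> c) (b \<otimes> d)" .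
  then show ?thesis by (simp add: fractions_def fr_def)
qed

lemma add_fr:
  assumes ab: "(a, b) \<in> P" and cd: "(c, d) \<in> P"
  shows "fr a b \<oplus>\<^bsub>fractions R P\<^esub> fr c d = fr (a \<otimes> d \<oplus> c \<otimes> b) (b \<otimes> d)"
proof -
  have "fr (a' \<otimes> d' \<oplus> c' \<otimes> b') (b' \<otimes> d') = fr (a \<otimes> d \<oplus> c \<otimes> b) (b \<otimes> d)"
    if "(a', b') \<in> fr a b" "(c', d') \<in> fr c d" for a' b' c' d'
  proof -
    have P: "(a', b') \<in> P" "(c', d') \<in> P" and e1: "a \<otimes> b' = a' \<otimes> b" and e2: "c \<otimes> d' = c' \<otimes> d"
      using that by (auto simp: mem_fr)
    note carr [simp] = P[THEN numer_closed] P[THEN denom_closed]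
      ab[THEN numer_closed] ab[THEN denom_closed]
      cd[THEN numer_closed] cd[THEN denom_closed]
    have "(a' \<otimes> d' \<oplus> c' \<otimes> b') \<otimes> (b \<otimes> d) = (a' \<otimes> b) \<otimes> (d \<otimes> d') \<oplus> (c' \<otimes> d) \<otimes> (b \<otimes> b')" using carr by algebra
    also have "\<dots> = (a \<otimes> b') \<otimes> (d \<otimes> d') \<oplus> (c \<otimes> d') \<otimes> (b \<otimes> b')" by (simp only: e1 e2)
    also have "\<dots> = (a \<otimes> d \<oplus> c \<otimes> b) \<otimes> (b' \<otimes> d')" using carr by algebra
    finally show ?thesis using fr_eq_iff add_pair P ab cd by auto
  qed
  then have "(\<Union>(a', b')\<in>fr a b. \<Union>(c', d')\<in>fr c d. fr (a' \<otimes> d' \<oplus> c' \<otimes> b') (b' \<otimes> d')) =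
      (\<Union>p\<in>fr a b. \<Union>q\<in>fr c d. fr (a \<otimes> d \<oplus> c \<otimes> b) (b \<otimes> d))"
    by (intro SUP_cong refl) (simp add: split_beta)
  also have "\<dots> = fr (a \<otimes> d \<oplus> c \<otimes> b) (b \<otimes> d)"
    using fr_self[OF ab] fr_self[OF cd] by blast
  finally have "(\<Union>(a', b')\<in>fr a b. \<Union>(c', d')\<in>fr c d. fr (a' \<otimes> d' \<oplus> c' \<otimes> b') (b' \<otimes> d')) = fr (a \<otimes> d \<oplus> c \<otimes> b) (b \<otimes> d)" .
  then show ?thesis by (simp add: fractions_def fr_def)
qed

lemma cring_fractions: "cring (fractions R P)"
proof (rule cringI)
  show "abelian_group (fractions R P)"
  proof (rule abelian_groupI)
    fix x y assume "x \<in> carrier (fractions R P)" "y \<in> carrier (fractions R P)"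
    then obtain a b c d where P: "(a, b) \<in> P" "(c, d) \<in> P" and x: "x = fr a b" "y = fr c d"
      by (metis fractionsE)
    note carr [simp] = P[THEN numer_closed] P[THEN denom_closed]
    show "x \<oplus>\<^bsub>fractions R P\<^esub> y \<in> carrier (fractions R P)"
      using P x add_fr fr_closed add_pair by simp
    show "x \<oplus>\<^bsub>fractions R P\<^esub> y = y \<oplus>\<^bsub>fractions R P\<^esub> x"
      using P x by (simp add: add_fr a_comm m_comm)
  next
    fix x y z assume "x \<in> carrier (fractions R P)" "y \<in> carrier (fractions R P)" "z \<in> carrier (fractions R P)"
    then obtain a b c d e f where P: "(a, b) \<in> P" "(c, d) \<in> P" "(e, f) \<in> P"
      and x: "x = fr a b" "y = fr c d" "z = fr e f"
      by (metis fractionsE)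
    note carr [simp] = P[THEN numer_closed] P[THEN denom_closed]
    have "(a \<otimes> d \<oplus> c \<otimes> b) \<otimes> f \<oplus> e \<otimes> (b \<otimes> d) = a \<otimes> (d \<otimes> f) \<oplus> (c \<otimes> f \<oplus> e \<otimes> d) \<otimes> b"
      using carr by algebra
    then show "x \<oplus>\<^bsub>fractions R P\<^esub> y \<oplus>\<^bsub>fractions R P\<^esub> z = x \<oplus>\<^bsub>fractions R P\<^esub> (y \<oplus>\<^bsub>fractions R P\<^esub> z)"
      using P x by (simp add: add_fr add_pair m_assoc)
  next
    show "\<zero>\<^bsub>fractions R P\<^esub> \<in> carrier (fractions R P)"
      by (simp add: zero_fractions fr_closed zero_pair)
  next
    fix x assume "x \<in> carrier (fractions R P)"
    then obtain a b where P: "(a, b) \<in> P" and x: "x = fr a b" by (metis fractionsE)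
    note carr [simp] = P[THEN numer_closed] P[THEN denom_closed]
    show "\<zero>\<^bsub>fractions R P\<^esub> \<oplus>\<^bsub>fractions R P\<^esub> x = x"
      using P x by (simp add: add_fr zero_fractions zero_pair)
    have "fr (\<ominus> a) b \<oplus>\<^bsub>fractions R P\<^esub> x = fr (\<ominus> a \<otimes> b \<oplus> a \<otimes> b) (b \<otimes> b)"
      using P x by (simp add: add_fr minus_pair)
    also have "\<ominus> a \<otimes> b \<oplus> a \<otimes> b = \<zero>" by (simp add: l_minus l_neg)
    also have "fr \<zero> (b \<otimes> b) = fr \<zero> \<one>"
      using fr_eq_iff[of \<zero> "b \<otimes> b" \<zero> \<one>] zero_pair add_pair[OF P minus_pair[OF P]]
      by (simp add: l_minus r_neg)
    finally show "\<exists>y\<in>carrier (fractions R P). y \<oplus>\<^bsub>fractions R P\<^esub> x = \<zero>\<^bsub>fractions R P\<^esub>"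
      using fr_closed[OF minus_pair[OF P]] zero_fractions by auto
  qed
  show "comm_monoid (fractions R P)"
  proof (rule comm_monoidI)
    fix x y assume "x \<in> carrier (fractions R P)" "y \<in> carrier (fractions R P)"
    then obtain a b c d where P: "(a, b) \<in> P" "(c, d) \<in> P" and x: "x = fr a b" "y = fr c d"
      by (metis fractionsE)
    note carr [simp] = P[THEN numer_closed] P[THEN denom_closed]
    show "x \<otimes>\<^bsub>fractions R P\<^esub> y \<in> carrier (fractions R P)"
      using P x mult_fr fr_closed mult_pair by simp
    show "x \<otimes>\<^bsub>fractions R P\<^esub> y = y \<otimes>\<^bsub>fractions R P\<^esub> x"
      using P x by (simp add: mult_fr m_comm)
  next
    fix x y z assume "x \<in> carrier (fractions R P)" "y \<in> carrier (fractions R P)" "z \<in> carrier (fractions R P)"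
    then obtain a b c d e f where P: "(a, b) \<in> P" "(c, d) \<in> P" "(e, f) \<in> P"
      and x: "x = fr a b" "y = fr c d" "z = fr e f"
      by (metis fractionsE)
    note carr [simp] = P[THEN numer_closed] P[THEN denom_closed]
    show "x \<otimes>\<^bsub>fractions R P\<^esub> y \<otimes>\<^bsub>fractions R P\<^esub> z = x \<otimes>\<^bsub>fractions R P\<^esub> (y \<otimes>\<^bsub>fractions R P\<^esub> z)"
      using P x by (simp add: mult_fr mult_pair m_assoc)
  next
    show "\<one>\<^bsub>fractions R P\<^esub> \<in> carrier (fractions R P)"
      by (simp add: one_fractions fr_closed one_pair)
  next
    fix x assume "x \<in> carrier (fractions R P)"
    then obtain a b where P: "(a, b) \<in> P" and x: "x = fr a b" by (metis fractionsE)
    note carr [simp] = P[THEN numer_closed] P[THEN denom_closed]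
    show "\<one>\<^bsub>fractions R P\<^esub> \<otimes>\<^bsub>fractions R P\<^esub> x = x"
      using P x by (simp add: mult_fr one_fractions one_pair)
  qed
next
  fix x y z assume "x \<in> carrier (fractions R P)" "y \<in> carrier (fractions R P)" "z \<in> carrier (fractions R P)"
  then obtain a b c d e f where P: "(a, b) \<in> P" "(c, d) \<in> P" "(e, f) \<in> P"
    and x: "x = fr a b" "y = fr c d" "z = fr e f"
    by (metis fractionsE)
  note carr [simp] = P[THEN numer_closed] P[THEN denom_closed]
  note P' = add_pair[OF mult_pair[OF P(1) P(3)] mult_pair[OF P(2) P(3)]] mult_pair[OF add_pair[OF P(1,2)] P(3)]
  have "((a \<otimes> d \<oplus> c \<otimes> b) \<otimes> e) \<otimes> ((b \<otimes> f) \<otimes> (d \<otimes> f)) =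
      (a \<otimes> e \<otimes> (d \<otimes> f) \<oplus> c \<otimes> e \<otimes> (b \<otimes> f)) \<otimes> (b \<otimes> d \<otimes> f)"
    using carr by algebra
  then show "(x \<oplus>\<^bsub>fractions R P\<^esub> y) \<otimes>\<^bsub>fractions R P\<^esub> z =
      x \<otimes>\<^bsub>fractions R P\<^esub> z \<oplus>\<^bsub>fractions R P\<^esub> y \<otimes>\<^bsub>fractions R P\<^esub> z"
    using P x P' by (simp add: mult_fr add_fr mult_pair add_pair fr_eq_iff)
qed

lemma fr_zero_iff:
  assumes P: "(a, b) \<in> P"
  shows "fr a b = \<zero>\<^bsub>fractions R P\<^esub> \<longleftrightarrow> a = \<zero>"
  using fr_eq_iff[OF P zero_pair] pair_closed[OF P] by (simp add: zero_fractions)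

lemma add_fr_same_denom:
  assumes P: "(a, b) \<in> P" "(c, b) \<in> P" "(a \<oplus> c, b) \<in> P"
  shows "fr a b \<oplus>\<^bsub>fractions R P\<^esub> fr c b = fr (a \<oplus> c) b"
proof -
  note carr [simp] = P[THEN numer_closed] P[THEN denom_closed]
  have "(a \<otimes> b \<oplus> c \<otimes> b) \<otimes> b = (a \<oplus> c) \<otimes> (b \<otimes> b)" using carr by algebra
  then show ?thesis using P by (simp add: add_fr fr_eq_iff add_pair)
qed

end

section \<open>Root algebras\<close>

definition root_gen :: "('a, 'm) ring_scheme \<Rightarrow> nat \<Rightarrow> 'a \<Rightarrow> (nat \<Rightarrow> 'a) set" where
  "root_gen R n t = PIdl\<^bsub>UP R\<^esub> (root_poly R n t) +>\<^bsub>UP R\<^esub> up_ring.monom (UP R) \<one>\<^bsub>R\<^esub> 1"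

locale root_alg = cring R for R (structure) + fixes n :: nat and t :: 'a
  assumes t_closed [simp]: "t \<in> carrier R"
begin

abbreviation "PR \<equiv> UP R"
abbreviation "I \<equiv> PIdl\<^bsub>PR\<^esub> (root_poly R n t)"
abbreviation "B \<equiv> root_algebra R n t"

sublocale U: UP_cring R "UP R" by unfold_locales

lemma root_poly_closed [simp]: "root_poly R n t \<in> carrier PR"
  unfolding root_poly_def by simp

sublocale I: ideal I "UP R" by (rule U.P.cgenideal_ideal) simp

lemma cring_root_algebra: "cring B"
  unfolding root_algebra_def by (rule I.quotient_is_cring) (rule U.UP_cring)

sublocale B: cring "root_algebra R n t" by (rule cring_root_algebra)

lemma coset_hom: "(\<lambda>p. I +>\<^bsub>PR\<^esub> p) \<in> ring_hom PR B"
  unfolding root_algebra_def by (rule I.rcos_ring_hom)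

sublocale Q: ring_hom_cring "UP R" "root_algebra R n t" "\<lambda>p. I +>\<^bsub>PR\<^esub> p"
  using coset_hom by unfold_locales

lemma root_algebraE:
  assumes "z \<in> carrier B"
  obtains p where "p \<in> carrier PR" "z = I +>\<^bsub>PR\<^esub> p"
  using assms unfolding root_algebra_def FactRing_def A_RCOSETS_def' by auto

lemma root_algebra_map_hom: "root_algebra_map R n t \<in> ring_hom R B"
proof -
  have "(\<lambda>a. I +>\<^bsub>PR\<^esub> up_ring.monom PR a 0) \<in> ring_hom R B"
    using ring_hom_trans[OF U.const_ring_hom coset_hom] by (simp add: comp_def)
  then show ?thesis unfolding root_algebra_map_def[abs_def] .
qed

lemma root_gen_closed [simp]: "root_gen R n t \<in> carrier B"
  unfolding root_gen_def by (rule Q.hom_closed) simp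

lemma coset_eq_iff:
  assumes "p \<in> carrier PR" "q \<in> carrier PR"
  shows "I +>\<^bsub>PR\<^esub> p = I +>\<^bsub>PR\<^esub> q \<longleftrightarrow> p \<ominus>\<^bsub>PR\<^esub> q \<in> I"
  using assms by (rule U.P.quotient_eq_iff_same_a_r_cos[OF I.ideal_axioms, symmetric])

lemma root_gen_pow: "root_gen R n t [^]\<^bsub>B\<^esub> n = root_algebra_map R n t t"
proof -
  have "root_gen R n t [^]\<^bsub>B\<^esub> n = I +>\<^bsub>PR\<^esub> (up_ring.monom PR \<one> 1 [^]\<^bsub>PR\<^esub> n)"
    unfolding root_gen_def by (rule Q.hom_pow[symmetric]) simp
  also have "up_ring.monom PR \<one> 1 [^]\<^bsub>PR\<^esub> n = up_ring.monom PR \<one> n"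
    by (subst U.monom_pow) auto
  also have "I +>\<^bsub>PR\<^esub> up_ring.monom PR \<one> n = I +>\<^bsub>PR\<^esub> up_ring.monom PR t 0"
    by (subst coset_eq_iff) (auto simp: root_poly_def[symmetric] U.P.cgenideal_self)
  finally show ?thesis unfolding root_algebra_map_def .
qed

lemma root_algebra_universal:
  assumes S: "cring S" and h: "\<phi> \<in> ring_hom R S" and s: "s \<in> carrier S" "s [^]\<^bsub>S\<^esub> n = \<phi> t"
  obtains \<Phi> where "\<Phi> \<in> ring_hom B S"
    and "\<And>p. p \<in> carrier PR \<Longrightarrow> \<Phi> (I +>\<^bsub>PR\<^esub> p) = UnivPoly.eval R S \<phi> s p"
    and "\<And>a. a \<in> carrier R \<Longrightarrow> \<Phi> (root_algebra_map R n t a) = \<phi> a"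
    and "\<Phi> (root_gen R n t) = s"
proof -
  interpret E: UP_pre_univ_prop R S \<phi> "UP R"
    using S h by (intro UP_pre_univ_prop.intro ring_hom_cringI U.UP_cring_axioms is_cring)
  have E: "UnivPoly.eval R S \<phi> s \<in> ring_hom PR S" by (rule E.eval_ring_hom) fact
  interpret E': ring_hom_cring "UP R" S "UnivPoly.eval R S \<phi> s"
    using E by unfold_locales
  have root0: "UnivPoly.eval R S \<phi> s (root_poly R n t) = \<zero>\<^bsub>S\<^esub>"
    using s by (simp add: root_poly_def U.P.minus_eq E.eval_monom E.eval_const E.S.r_neg E.hom_closed)
  have I0: "UnivPoly.eval R S \<phi> s i = \<zero>\<^bsub>S\<^esub>" if "i \<in> I" for i
    using that root0 unfolding cgenideal_def by auto
  define \<Phi> where "\<Phi> = (\<lambda>Z. the_elem (UnivPoly.eval R S \<phi> s ` Z))"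
  have \<Phi>: "\<Phi> (I +>\<^bsub>PR\<^esub> p) = UnivPoly.eval R S \<phi> s p" if p: "p \<in> carrier PR" for p
  proof -
    have "UnivPoly.eval R S \<phi> s ` (I +>\<^bsub>PR\<^esub> p) = {UnivPoly.eval R S \<phi> s p}"
    proof
      show "UnivPoly.eval R S \<phi> s ` (I +>\<^bsub>PR\<^esub> p) \<subseteq> {UnivPoly.eval R S \<phi> s p}"
        using I0 p I.Icarr by (auto simp: a_r_coset_def' E'.hom_add)
      show "{UnivPoly.eval R S \<phi> s p} \<subseteq> UnivPoly.eval R S \<phi> s ` (I +>\<^bsub>PR\<^esub> p)"
        using I.a_rcos_self[OF p] by auto
    qed
    then show ?thesis unfolding \<Phi>_def by simp
  qed
  have "\<Phi> \<in> ring_hom B S"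
  proof (rule ring_hom_memI)
    fix x assume "x \<in> carrier B"
    then show "\<Phi> x \<in> carrier S" by (elim root_algebraE) (simp add: \<Phi>)
  next
    fix x y assume "x \<in> carrier B" "y \<in> carrier B"
    then obtain p q where [simp]: "p \<in> carrier PR" "q \<in> carrier PR" and x: "x = I +>\<^bsub>PR\<^esub> p" "y = I +>\<^bsub>PR\<^esub> q"
      by (metis root_algebraE)
    show "\<Phi> (x \<otimes>\<^bsub>B\<^esub> y) = \<Phi> x \<otimes>\<^bsub>S\<^esub> \<Phi> y"
      unfolding x Q.hom_mult[symmetric, OF \<open>p \<in> carrier PR\<close> \<open>q \<in> carrier PR\<close>] by (simp add: \<Phi> del: Q.hom_mult)
    show "\<Phi> (x \<oplus>\<^bsub>B\<^esub> y) = \<Phi> x \<oplus>\<^bsub>S\<^esub> \<Phi> y"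
      unfolding x Q.hom_add[symmetric, OF \<open>p \<in> carrier PR\<close> \<open>q \<in> carrier PR\<close>] by (simp add: \<Phi> del: Q.hom_add)
  next
    show "\<Phi> \<one>\<^bsub>B\<^esub> = \<one>\<^bsub>S\<^esub>" unfolding Q.hom_one[symmetric] by (simp add: \<Phi> del: Q.hom_one)
  qed
  then show thesis
    using that \<Phi> s by (simp add: root_algebra_map_def root_gen_def E.eval_const E.eval_monom1[unfolded One_nat_def])
qed

lemma root_algebra_hom_unique:
  assumes S: "cring S" and F: "\<Phi> \<in> ring_hom B S" and G: "\<Psi> \<in> ring_hom B S"
    and map: "\<And>a. a \<in> carrier R \<Longrightarrow> \<Phi> (root_algebra_map R n t a) = \<Psi> (root_algebra_map R n t a)"
    and gen: "\<Phi> (root_gen R n t) = \<Psi> (root_gen R n t)"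
    and z: "z \<in> carrier B"
  shows "\<Phi> z = \<Psi> z"
proof -
  define \<phi> where "\<phi> = (\<lambda>a. \<Phi> (root_algebra_map R n t a))"
  have h: "\<phi> \<in> ring_hom R S"
    using ring_hom_trans[OF root_algebra_map_hom F] by (simp add: comp_def \<phi>_def)
  interpret E: UP_pre_univ_prop R S \<phi> "UP R"
    using S h by (intro UP_pre_univ_prop.intro ring_hom_cringI U.UP_cring_axioms is_cring)
  obtain p where p: "p \<in> carrier PR" "z = I +>\<^bsub>PR\<^esub> p" using z by (rule root_algebraE)
  have "(\<Phi> \<circ> (\<lambda>p. I +>\<^bsub>PR\<^esub> p)) p = (\<Psi> \<circ> (\<lambda>p. I +>\<^bsub>PR\<^esub> p)) p"
  proof (rule E.UP_hom_unique[where s = "\<Phi> (root_gen R n t)"])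
    show "ring_hom_cring PR S (\<Phi> \<circ> (\<lambda>p. I +>\<^bsub>PR\<^esub> p))"
      by (rule E.ring_homD[OF ring_hom_trans[OF coset_hom F]])
    show "ring_hom_cring PR S (\<Psi> \<circ> (\<lambda>p. I +>\<^bsub>PR\<^esub> p))"
      by (rule E.ring_homD[OF ring_hom_trans[OF coset_hom G]])
  qed (use map gen p ring_hom_closed[OF F] ring_hom_closed[OF G] in \<open>auto simp: \<phi>_def root_gen_def[symmetric] root_algebra_map_def[symmetric] simp flip: One_nat_def\<close>)
  then show ?thesis using p by simp
qed

end

lemma algebra_isomorphic_trans:
  assumes "algebra_isomorphic R A i B j" "algebra_isomorphic R B j C k"
  shows "algebra_isomorphic R A i C k"
proof -
  obtain f g where f: "f \<in> ring_iso A B" "\<forall>a\<in>carrier R. f (i a) = j a"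
    and g: "g \<in> ring_iso B C" "\<forall>a\<in>carrier R. g (j a) = k a"
    using assms unfolding algebra_isomorphic_def by auto
  then have "g \<circ> f \<in> ring_iso A C" "\<forall>a\<in>carrier R. (g \<circ> f) (i a) = k a"
    by (auto intro: ring_iso_set_trans)
  then show ?thesis unfolding algebra_isomorphic_def by blast
qed

lemma algebra_isomorphic_refl: "algebra_isomorphic R A i A i"
  unfolding algebra_isomorphic_def using ring_iso_set_refl by (intro bexI[of _ id]) auto

lemma algebra_isomorphic_sym:
  assumes "algebra_isomorphic R A i B j" and A: "ring A" and i: "i \<in> ring_hom R A"
  shows "algebra_isomorphic R B j A i"
proof -
  obtain f where f: "f \<in> ring_iso A B" "\<forall>a\<in>carrier R. f (i a) = j a"
    using assms unfolding algebra_isomorphic_def by auto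
  have "inv_into (carrier A) f \<in> ring_iso B A" using A f by (intro ring_iso_set_sym)
  moreover have "inv_into (carrier A) f (j a) = i a" if "a \<in> carrier R" for a
    using f that ring_hom_closed[OF i that] unfolding ring_iso_def bij_betw_def
    by (metis (mono_tags, lifting) inv_into_f_f mem_Collect_eq)
  ultimately show ?thesis unfolding algebra_isomorphic_def by blast
qed

lemma root_algebras_isomorphicI:
  assumes R: "cring R" and t: "t1 \<in> carrier R" "t2 \<in> carrier R"
    and F: "\<Phi> \<in> ring_hom (root_algebra R n t1) (root_algebra R n t2)"
      "\<And>a. a \<in> carrier R \<Longrightarrow> \<Phi> (root_algebra_map R n t1 a) = root_algebra_map R n t2 a"
    and G: "\<Psi> \<in> ring_hom (root_algebra R n t2) (root_algebra R n t1)"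
      "\<And>a. a \<in> carrier R \<Longrightarrow> \<Psi> (root_algebra_map R n t2 a) = root_algebra_map R n t1 a"
    and inv: "\<Psi> (\<Phi> (root_gen R n t1)) = root_gen R n t1" "\<Phi> (\<Psi> (root_gen R n t2)) = root_gen R n t2"
  shows "algebra_isomorphic R (root_algebra R n t1) (root_algebra_map R n t1)
    (root_algebra R n t2) (root_algebra_map R n t2)"
proof -
  interpret R: cring R by fact
  interpret A1: root_alg R n t1 by unfold_locales fact
  interpret A2: root_alg R n t2 by unfold_locales fact
  have id1: "id \<in> ring_hom (root_algebra R n t1) (root_algebra R n t1)"
    and id2: "id \<in> ring_hom (root_algebra R n t2) (root_algebra R n t2)"
    using ring_iso_set_refl unfolding ring_iso_def by auto
  have 1: "(\<Psi> \<circ> \<Phi>) z = id z" if "z \<in> carrier (root_algebra R n t1)" for z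
    by (rule A1.root_algebra_hom_unique[OF A1.cring_root_algebra ring_hom_trans[OF F(1) G(1)] id1 _ _ that])
      (auto simp: F G inv)
  have 2: "(\<Phi> \<circ> \<Psi>) z = id z" if "z \<in> carrier (root_algebra R n t2)" for z
    by (rule A2.root_algebra_hom_unique[OF A2.cring_root_algebra ring_hom_trans[OF G(1) F(1)] id2 _ _ that])
      (auto simp: F G inv)
  have "bij_betw \<Phi> (carrier (root_algebra R n t1)) (carrier (root_algebra R n t2))"
    using 1 2 ring_hom_closed[OF F(1)] ring_hom_closed[OF G(1)]
    by (intro bij_betwI[where g = \<Psi>]) auto
  then show ?thesis unfolding algebra_isomorphic_def ring_iso_def using F by auto
qed

section \<open>Discrete valuation rings and their fraction fields\<close>

lemma (in cring) ideal_prod_cgenideal: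
  assumes [simp]: "a \<in> carrier R" "b \<in> carrier R"
  shows "ideal_prod R (PIdl a) (PIdl b) = PIdl (a \<otimes> b)"
proof
  show "ideal_prod R (PIdl a) (PIdl b) \<subseteq> PIdl (a \<otimes> b)"
  proof
    fix z assume "z \<in> ideal_prod R (PIdl a) (PIdl b)"
    then show "z \<in> PIdl (a \<otimes> b)"
    proof induction
      case (prod i j)
      then obtain x y where x: "x \<in> carrier R" "y \<in> carrier R" "i = x \<otimes> a" "j = y \<otimes> b"
        unfolding cgenideal_def by auto
      have "i \<otimes> j = (x \<otimes> y) \<otimes> (a \<otimes> b)" using x by (simp add: m_ac)
      then show ?case unfolding cgenideal_def using x by blast
    next
      case (sum i j)
      then show ?case
        using additive_subgroup.a_closed[OF ideal.axioms(1)[OF cgenideal_ideal[of "a \<otimes> b"]]] by simp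
    qed
  qed
  show "PIdl (a \<otimes> b) \<subseteq> ideal_prod R (PIdl a) (PIdl b)"
  proof
    fix z assume "z \<in> PIdl (a \<otimes> b)"
    then obtain x where x: "x \<in> carrier R" "z = x \<otimes> (a \<otimes> b)" unfolding cgenideal_def by auto
    then have "z = (x \<otimes> a) \<otimes> (\<one> \<otimes> b)" by (simp add: m_ac)
    moreover have "x \<otimes> a \<in> PIdl a" "\<one> \<otimes> b \<in> PIdl b" using x unfolding cgenideal_def by blast+
    ultimately show "z \<in> ideal_prod R (PIdl a) (PIdl b)" by (metis ideal_prod.prod)
  qed
qed

lemma (in cring) cgenideal_one: "PIdl \<one> = carrier R"
  unfolding cgenideal_def by force

lemma (in cring) ideal_pow_cgenideal:
  assumes [simp]: "p \<in> carrier R"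
  shows "ideal_pow R (PIdl p) i = PIdl (p [^] i)"
  by (induction i) (simp_all add: cgenideal_one ideal_prod_cgenideal m_comm)

lemma (in cring) mem_cgenideal: "z \<in> PIdl a \<longleftrightarrow> (\<exists>x\<in>carrier R. z = x \<otimes> a)"
  unfolding cgenideal_def by auto

locale dvr = "domain" A for A (structure) +
  fixes \<pi>
  assumes pi_closed [simp]: "\<pi> \<in> carrier A"
    and pi_not_unit: "\<pi> \<notin> Units A"
    and factorization: "a \<in> carrier A \<Longrightarrow> a \<noteq> \<zero> \<Longrightarrow> \<exists>u\<in>Units A. \<exists>i::nat. a = u \<otimes> \<pi> [^] i"
    and pi_nonzero: "\<pi> \<noteq> \<zero>"
begin

lemma Units_nonzero: "u \<in> Units A \<Longrightarrow> u \<noteq> \<zero>"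
  using Units_r_inv_ex by force

lemma pi_pow_nonzero: "\<pi> [^] (i::nat) \<noteq> \<zero>"
  using pi_nonzero by (induction i) (auto simp: integral_iff)

lemma unit_pi_pow_dvd:
  assumes u: "u \<in> Units A" and x: "x \<in> carrier A" and eq: "u \<otimes> \<pi> [^] (i::nat) = x \<otimes> \<pi> [^] (j::nat)"
  shows "j \<le> i"
proof (rule ccontr)
  assume "\<not> j \<le> i"
  then obtain k where k: "j = i + Suc k" using less_natE by (metis add_Suc_right not_le)
  have [simp]: "u \<in> carrier A" using u by auto
  have "\<pi> [^] i \<otimes> u = \<pi> [^] i \<otimes> ((x \<otimes> \<pi> [^] k) \<otimes> \<pi>)"
  proof -
    have "\<pi> [^] j = \<pi> [^] i \<otimes> \<pi> [^] k \<otimes> \<pi>" unfolding k by (simp add: nat_pow_mult[symmetric] m_assoc)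
    then show ?thesis using eq x by (simp add: m_ac)
  qed
  then have "u = (x \<otimes> \<pi> [^] k) \<otimes> \<pi>"
    using x pi_pow_nonzero by (subst (asm) m_lcancel) auto
  then have "\<pi> \<in> Units A" using u x by (metis prod_unit_r pi_closed unit_factor m_comm m_closed nat_pow_closed)
  then show False using pi_not_unit by simp
qed

lemma max_ideal_eq: "max_ideal A = PIdl \<pi>"
proof
  show "max_ideal A \<subseteq> PIdl \<pi>"
  proof
    fix a assume a: "a \<in> max_ideal A"
    then have carr: "a \<in> carrier A" and nu: "a \<notin> Units A" unfolding max_ideal_def by auto
    show "a \<in> PIdl \<pi>"
    proof (cases "a = \<zero>")
      case True then show ?thesis by (auto simp: mem_cgenideal intro!: bexI[of _ \<zero>])
    next
      case False
      then obtain u i where u: "u \<in> Units A" "a = u \<otimes> \<pi> [^] (i::nat)" using factorization[OF carr False] by auto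
      then obtain k where k: "i = Suc k" using nu by (cases i) auto
      have "a = (u \<otimes> \<pi> [^] k) \<otimes> \<pi>" using u k by (simp add: m_assoc Units_closed)
      moreover have "u \<otimes> \<pi> [^] k \<in> carrier A" using u by (simp add: Units_closed)
      ultimately show ?thesis by (auto simp: mem_cgenideal)
    qed
  qed
  show "PIdl \<pi> \<subseteq> max_ideal A"
    unfolding max_ideal_def
    using pi_not_unit by (auto simp: mem_cgenideal) (metis m_comm pi_closed unit_factor)
qed

lemma mem_ideal_pow_iff:
  assumes u: "u \<in> Units A"
  shows "u \<otimes> \<pi> [^] (i::nat) \<in> ideal_pow A (max_ideal A) j \<longleftrightarrow> j \<le> i"
proof
  assume "u \<otimes> \<pi> [^] i \<in> ideal_pow A (max_ideal A) j"
  then show "j \<le> i"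
    using unit_pi_pow_dvd[OF u] by (auto simp: max_ideal_eq ideal_pow_cgenideal mem_cgenideal)
next
  assume "j \<le> i"
  then have "u \<otimes> \<pi> [^] i = (u \<otimes> \<pi> [^] (i - j)) \<otimes> \<pi> [^] j"
    using u by (simp add: m_assoc nat_pow_mult Units_closed)
  moreover have "u \<otimes> \<pi> [^] (i - j) \<in> carrier A" using u by (simp add: Units_closed)
  ultimately show "u \<otimes> \<pi> [^] i \<in> ideal_pow A (max_ideal A) j"
    by (auto simp: max_ideal_eq ideal_pow_cgenideal mem_cgenideal)
qed

lemma dvr_ord_eq:
  assumes u: "u \<in> Units A"
  shows "dvr_ord A (u \<otimes> \<pi> [^] (i::nat)) = i"
  unfolding dvr_ord_def by (rule Greatest_equality) (auto simp: mem_ideal_pow_iff[OF u])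

lemma dvr_ord_unit: "u \<in> Units A \<Longrightarrow> dvr_ord A u = 0"
  using dvr_ord_eq[of u 0] by auto

lemma dvr_ord_mult:
  assumes "a \<in> carrier A" "b \<in> carrier A" "a \<noteq> \<zero>" "b \<noteq> \<zero>"
  shows "dvr_ord A (a \<otimes> b) = dvr_ord A a + dvr_ord A b"
proof -
  obtain u i where u: "u \<in> Units A" "a = u \<otimes> \<pi> [^] (i::nat)" using factorization assms by blast
  obtain w j where w: "w \<in> Units A" "b = w \<otimes> \<pi> [^] (j::nat)" using factorization assms by blast
  have "a \<otimes> b = (u \<otimes> w) \<otimes> (\<pi> [^] i \<otimes> \<pi> [^] j)"
    using u(1) w(1) unfolding u(2) w(2) by (simp add: m_ac Units_closed)
  then have "a \<otimes> b = (u \<otimes> w) \<otimes> \<pi> [^] (i + j)" by (simp add: nat_pow_mult)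
  then show ?thesis using u w by (simp add: dvr_ord_eq)
qed

lemma dvr_ord_ge_iff:
  assumes "a \<in> carrier A" "a \<noteq> \<zero>"
  shows "i \<le> dvr_ord A a \<longleftrightarrow> (\<exists>x\<in>carrier A. a = x \<otimes> \<pi> [^] i)"
proof -
  obtain u j where u: "u \<in> Units A" "a = u \<otimes> \<pi> [^] (j::nat)" using factorization assms by blast
  show ?thesis using mem_ideal_pow_iff[OF u(1), of j i]
    by (simp add: u dvr_ord_eq max_ideal_eq ideal_pow_cgenideal mem_cgenideal)
qed

lemma dvr_ord_add:
  assumes "a \<in> carrier A" "b \<in> carrier A" "a \<noteq> \<zero>" "b \<noteq> \<zero>" "a \<oplus> b \<noteq> \<zero>"
  shows "min (dvr_ord A a) (dvr_ord A b) \<le> dvr_ord A (a \<oplus> b)"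
proof -
  let ?m = "min (dvr_ord A a) (dvr_ord A b)"
  obtain x y where "x \<in> carrier A" "y \<in> carrier A" "a = x \<otimes> \<pi> [^] ?m" "b = y \<otimes> \<pi> [^] ?m"
    using assms dvr_ord_ge_iff[of a ?m] dvr_ord_ge_iff[of b ?m] by auto
  then have "x \<oplus> y \<in> carrier A" "a \<oplus> b = (x \<oplus> y) \<otimes> \<pi> [^] ?m" by (simp_all add: l_distr)
  then show ?thesis using assms dvr_ord_ge_iff[of "a \<oplus> b" ?m] by blast
qed

sublocale F: fraction_pairs A "all_pairs A"
proof
  fix a b c d e f
  assume "(a, b) \<in> all_pairs A" "(c, d) \<in> all_pairs A" "(e, f) \<in> all_pairs A" "d \<otimes> (a \<otimes> f \<ominus> e \<otimes> b) = \<zero>"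
  then show "a \<otimes> f = e \<otimes> b" by (auto simp: all_pairs_def integral_iff)
qed (auto simp: all_pairs_def integral_iff)

abbreviation "K \<equiv> frac_field A"

lemma frac_fieldE:
  assumes "z \<in> carrier K"
  obtains a b where "a \<in> carrier A" "b \<in> carrier A" "b \<noteq> \<zero>" "z = F.fr a b"
  using assms unfolding frac_field_def by (elim F.fractionsE) (auto simp: all_pairs_def)

lemma mem_all_pairs: "(a, b) \<in> all_pairs A \<longleftrightarrow> a \<in> carrier A \<and> b \<in> carrier A \<and> b \<noteq> \<zero>"
  unfolding all_pairs_def by auto

lemma fr_zero_iff: "a \<in> carrier A \<Longrightarrow> b \<in> carrier A \<Longrightarrow> b \<noteq> \<zero> \<Longrightarrow> F.fr a b = \<zero>\<^bsub>K\<^esub> \<longleftrightarrow> a = \<zero>"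
  unfolding frac_field_def using F.fr_zero_iff by (simp add: mem_all_pairs)

lemma cring_K: "cring K"
  unfolding frac_field_def by (rule F.cring_fractions)

lemma field_K: "field K"
proof (rule cring.cring_fieldI2[OF cring_K])
  show "\<zero>\<^bsub>K\<^esub> \<noteq> \<one>\<^bsub>K\<^esub>"
    using fr_zero_iff[of \<one> \<one>] by (simp add: frac_field_def F.one_fractions)
  fix z assume z: "z \<in> carrier K" "z \<noteq> \<zero>\<^bsub>K\<^esub>"
  obtain a b where ab: "a \<in> carrier A" "b \<in> carrier A" "b \<noteq> \<zero>" "z = F.fr a b"
    by (rule frac_fieldE[OF z(1)])
  then have "a \<noteq> \<zero>" using z fr_zero_iff by auto
  then have "F.fr b a \<in> carrier K" "z \<otimes>\<^bsub>K\<^esub> F.fr b a = \<one>\<^bsub>K\<^esub>"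
    using ab by (simp_all add: frac_field_def F.fr_closed mem_all_pairs F.mult_fr F.one_fractions F.fr_eq_iff integral_iff m_comm)
  then show "\<exists>w\<in>carrier K. z \<otimes>\<^bsub>K\<^esub> w = \<one>\<^bsub>K\<^esub>" by blast
qed

sublocale K: field "frac_field A" by (rule field_K)

lemma dvr_val_fr:
  assumes ab: "a \<in> carrier A" "b \<in> carrier A" "a \<noteq> \<zero>" "b \<noteq> \<zero>"
  shows "dvr_val A (F.fr a b) = int (dvr_ord A a) - int (dvr_ord A b)"
  unfolding dvr_val_def
proof (rule the_equality)
  show "\<exists>(a', b')\<in>F.fr a b. int (dvr_ord A a) - int (dvr_ord A b) = int (dvr_ord A a') - int (dvr_ord A b')"
    using F.fr_self[of a b] ab by (intro bexI[of _ "(a, b)"]) (auto simp: mem_all_pairs)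
  fix m assume "\<exists>(a', b')\<in>F.fr a b. m = int (dvr_ord A a') - int (dvr_ord A b')"
  then obtain a' b' where m: "m = int (dvr_ord A a') - int (dvr_ord A b')"
    and a'b': "a' \<in> carrier A" "b' \<in> carrier A" "b' \<noteq> \<zero>" "a \<otimes> b' = a' \<otimes> b"
    by (auto simp: F.mem_fr mem_all_pairs)
  then have "a' \<noteq> \<zero>" using ab integral_iff[of a b'] by auto
  then have "dvr_ord A a + dvr_ord A b' = dvr_ord A a' + dvr_ord A b"
    using a'b' ab dvr_ord_mult[of a b'] dvr_ord_mult[of a' b] by simp
  then show "m = int (dvr_ord A a) - int (dvr_ord A b)" using m by linarith
qed

lemma nonzero_fracE:
  assumes "z \<in> carrier K" "z \<noteq> \<zero>\<^bsub>K\<^esub>"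
  obtains a b where "a \<in> carrier A" "b \<in> carrier A" "a \<noteq> \<zero>" "b \<noteq> \<zero>" "z = F.fr a b"
    "dvr_val A z = int (dvr_ord A a) - int (dvr_ord A b)"
  using assms dvr_val_fr fr_zero_iff by (metis frac_fieldE)

lemma dvr_val_mult:
  assumes "z \<in> carrier K" "z \<noteq> \<zero>\<^bsub>K\<^esub>" "w \<in> carrier K" "w \<noteq> \<zero>\<^bsub>K\<^esub>"
  shows "dvr_val A (z \<otimes>\<^bsub>K\<^esub> w) = dvr_val A z + dvr_val A w"
proof -
  obtain a b where ab: "a \<in> carrier A" "b \<in> carrier A" "a \<noteq> \<zero>" "b \<noteq> \<zero>" "z = F.fr a b"
    using assms nonzero_fracE by metis
  obtain c d where cd: "c \<in> carrier A" "d \<in> carrier A" "c \<noteq> \<zero>" "d \<noteq> \<zero>" "w = F.fr c d"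
    using assms nonzero_fracE by metis
  have "z \<otimes>\<^bsub>K\<^esub> w = F.fr (a \<otimes> c) (b \<otimes> d)"
    using ab cd by (simp add: frac_field_def F.mult_fr mem_all_pairs)
  then show ?thesis using ab cd by (simp add: dvr_val_fr dvr_ord_mult integral_iff)
qed

lemma common_denominator:
  assumes "z \<in> carrier K" "w \<in> carrier K"
  obtains a c b where "a \<in> carrier A" "b \<in> carrier A" "c \<in> carrier A" "b \<noteq> \<zero>" "z = F.fr a b" "w = F.fr c b"
proof -
  obtain a b where ab: "a \<in> carrier A" "b \<in> carrier A" "b \<noteq> \<zero>" "z = F.fr a b"
    using assms frac_fieldE by metis
  obtain c d where cd: "c \<in> carrier A" "d \<in> carrier A" "d \<noteq> \<zero>" "w = F.fr c d"
    using assms frac_fieldE by metis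
  have "z = F.fr (a \<otimes> d) (b \<otimes> d)" "w = F.fr (c \<otimes> b) (b \<otimes> d)"
    using ab cd by (simp_all add: F.fr_eq_iff mem_all_pairs integral_iff m_ac)
  then show thesis using that[of "a \<otimes> d" "b \<otimes> d" "c \<otimes> b"] ab cd by (simp add: integral_iff)
qed

lemma dvr_val_add:
  assumes zw: "z \<in> carrier K" "z \<noteq> \<zero>\<^bsub>K\<^esub>" "w \<in> carrier K" "w \<noteq> \<zero>\<^bsub>K\<^esub>" and sum: "z \<oplus>\<^bsub>K\<^esub> w \<noteq> \<zero>\<^bsub>K\<^esub>"
  shows "min (dvr_val A z) (dvr_val A w) \<le> dvr_val A (z \<oplus>\<^bsub>K\<^esub> w)"
proof -
  obtain a c b where abc: "a \<in> carrier A" "b \<in> carrier A" "c \<in> carrier A" "b \<noteq> \<zero>" "z = F.fr a b" "w = F.fr c b"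
    using zw common_denominator by metis
  have s: "z \<oplus>\<^bsub>K\<^esub> w = F.fr (a \<oplus> c) b"
    using abc F.add_fr_same_denom by (simp add: frac_field_def mem_all_pairs)
  have nz: "a \<noteq> \<zero>" "c \<noteq> \<zero>" "a \<oplus> c \<noteq> \<zero>"
    using zw sum abc fr_zero_iff unfolding s by auto
  show ?thesis using dvr_ord_add[of a c] nz abc dvr_val_fr[of a b] dvr_val_fr[of c b] dvr_val_fr[of "a \<oplus> c" b]
    unfolding s by simp
qed

lemma to_frac_eq: "a \<in> carrier A \<Longrightarrow> to_frac A a = F.fr a \<one>"
  unfolding to_frac_def F.fr_def ..

lemma to_frac_hom: "to_frac A \<in> ring_hom A K"
  by (rule ring_hom_memI)
    (auto simp: to_frac_eq frac_field_def F.fr_closed mem_all_pairs F.mult_fr F.add_fr F.one_fractions)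

lemma to_frac_inj: "a \<in> carrier A \<Longrightarrow> b \<in> carrier A \<Longrightarrow> to_frac A a = to_frac A b \<longleftrightarrow> a = b"
  by (simp add: to_frac_eq F.fr_eq_iff mem_all_pairs)

lemma to_frac_zero_iff: "a \<in> carrier A \<Longrightarrow> to_frac A a = \<zero>\<^bsub>K\<^esub> \<longleftrightarrow> a = \<zero>"
  by (simp add: to_frac_eq fr_zero_iff)

lemma dvr_val_to_frac: "a \<in> carrier A \<Longrightarrow> a \<noteq> \<zero> \<Longrightarrow> dvr_val A (to_frac A a) = int (dvr_ord A a)"
  by (simp add: to_frac_eq dvr_val_fr dvr_ord_unit)

lemma to_frac_image:
  "to_frac A ` carrier A = {z \<in> carrier K. z = \<zero>\<^bsub>K\<^esub> \<or> 0 \<le> dvr_val A z}"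
proof (intro equalityI subsetI)
  fix z assume "z \<in> to_frac A ` carrier A"
  then show "z \<in> {z \<in> carrier K. z = \<zero>\<^bsub>K\<^esub> \<or> 0 \<le> dvr_val A z}"
    using ring_hom_closed[OF to_frac_hom] to_frac_zero_iff dvr_val_to_frac by fastforce
next
  fix z assume "z \<in> {z \<in> carrier K. z = \<zero>\<^bsub>K\<^esub> \<or> 0 \<le> dvr_val A z}"
  then consider "z = \<zero>\<^bsub>K\<^esub>" | "z \<in> carrier K" "z \<noteq> \<zero>\<^bsub>K\<^esub>" "0 \<le> dvr_val A z" by auto
  then show "z \<in> to_frac A ` carrier A"
  proof cases
    case 1 then show ?thesis using to_frac_zero_iff[of \<zero>] by force
  next
    case 2
    then obtain a b where ab: "a \<in> carrier A" "b \<in> carrier A" "a \<noteq> \<zero>" "b \<noteq> \<zero>" "z = F.fr a b"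
      "dvr_val A z = int (dvr_ord A a) - int (dvr_ord A b)"
      using nonzero_fracE by metis
    obtain u i where u: "u \<in> Units A" "b = u \<otimes> \<pi> [^] (i::nat)" using factorization ab by blast
    obtain x where x: "x \<in> carrier A" "a = x \<otimes> \<pi> [^] i"
      using dvr_ord_ge_iff[of a i] ab 2 u by (auto simp: dvr_ord_eq)
    have "z = F.fr (x \<otimes> inv u) \<one>"
    proof -
      have "x \<otimes> \<pi> [^] i = x \<otimes> inv u \<otimes> (u \<otimes> \<pi> [^] i)"
        using u(1) x(1) m_assoc[of "inv u" u "\<pi> [^] i"] by (simp add: m_assoc Units_closed)
      then show ?thesis using ab u x by (simp add: F.fr_eq_iff mem_all_pairs)
    qed
    then show ?thesis using x u to_frac_eq by auto
  qed
qed

end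

section \<open>Valued fields with enough roots\<close>

locale val_field = field K for K (structure) +
  fixes v :: "'a \<Rightarrow> int" and n :: nat
  assumes v_mult: "\<lbrakk>z \<in> carrier K; z \<noteq> \<zero>; w \<in> carrier K; w \<noteq> \<zero>\<rbrakk> \<Longrightarrow> v (z \<otimes> w) = v z + v w"
    and v_add: "\<lbrakk>z \<in> carrier K; z \<noteq> \<zero>; w \<in> carrier K; w \<noteq> \<zero>; z \<oplus> w \<noteq> \<zero>\<rbrakk> \<Longrightarrow> min (v z) (v w) \<le> v (z \<oplus> w)"
    and uniformizer: "\<exists>p\<in>carrier K. p \<noteq> \<zero> \<and> v p = 1"
    and n_pos: "n > 0"
    and root_ex: "\<lbrakk>z \<in> carrier K; z \<noteq> \<zero>; int n dvd v z\<rbrakk> \<Longrightarrow> \<exists>s\<in>carrier K. s [^] n = z"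
    and n_unit: "[n] \<cdot> \<one> \<noteq> \<zero>" "v ([n] \<cdot> \<one>) = 0"
    and zeta_ex: "\<exists>\<zeta>\<in>carrier K. \<zeta> \<noteq> \<one> \<and> \<zeta> [^] n = \<one>"
begin

definition val_ge :: "int \<Rightarrow> 'a set" where
  "val_ge m = {z \<in> carrier K. z = \<zero> \<or> m \<le> v z}"

lemma val_ge_closed: "z \<in> val_ge m \<Longrightarrow> z \<in> carrier K"
  unfolding val_ge_def by auto

lemma zero_val_ge [simp]: "\<zero> \<in> val_ge m"
  unfolding val_ge_def by auto

lemma val_ge_nonzero: "z \<in> carrier K \<Longrightarrow> z \<noteq> \<zero> \<Longrightarrow> z \<in> val_ge m \<longleftrightarrow> m \<le> v z"
  unfolding val_ge_def by auto

lemma val_ge_mono: "z \<in> val_ge m \<Longrightarrow> k \<le> m \<Longrightarrow> z \<in> val_ge k"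
  unfolding val_ge_def by auto

lemma v_one [simp]: "v \<one> = 0"
  using v_mult[of \<one> \<one>] by auto

lemma v_minus_one: "v (\<ominus> \<one>) = 0"
proof -
  have "\<ominus> \<one> \<noteq> \<zero>" by (metis minus_minus minus_zero one_closed zero_not_one)
  moreover have "\<ominus> \<one> \<otimes> \<ominus> \<one> = \<one>" by (simp add: l_minus)
  ultimately have "v \<one> = v (\<ominus> \<one>) + v (\<ominus> \<one>)" by (metis a_inv_closed one_closed v_mult)
  then show ?thesis by simp
qed

lemma v_minus: assumes "z \<in> carrier K" shows "v (\<ominus> z) = v z"
proof (cases "z = \<zero>")
  case False
  have "\<ominus> z = \<ominus> \<one> \<otimes> z" using assms by (simp add: l_minus)
  moreover have "\<ominus> \<one> \<noteq> \<zero>" by (metis minus_minus minus_zero one_closed zero_not_one)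
  ultimately show ?thesis using v_mult[of "\<ominus> \<one>" z] False assms v_minus_one by simp
qed simp

lemma val_ge_add: "z \<in> val_ge m \<Longrightarrow> w \<in> val_ge m \<Longrightarrow> z \<oplus> w \<in> val_ge m"
  using v_add[of z w] unfolding val_ge_def by force

lemma val_ge_minus: "z \<in> val_ge m \<Longrightarrow> \<ominus> z \<in> val_ge m"
  using v_minus[of z] unfolding val_ge_def by auto

lemma val_ge_diff: "z \<in> val_ge m \<Longrightarrow> w \<in> val_ge m \<Longrightarrow> z \<ominus> w \<in> val_ge m"
  unfolding a_minus_def by (intro val_ge_add val_ge_minus)

lemma val_ge_mult:
  assumes "z \<in> val_ge m" "w \<in> val_ge k"
  shows "z \<otimes> w \<in> val_ge (m + k)"
proof -
  have c [simp]: "z \<in> carrier K" "w \<in> carrier K" using assms val_ge_closed by auto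
  show ?thesis
  proof (cases "z = \<zero> \<or> w = \<zero>")
    case True then show ?thesis by auto
  next
    case False
    then have "z \<otimes> w \<noteq> \<zero>" by (simp add: integral_iff)
    then show ?thesis using False assms v_mult[of z w] by (simp add: val_ge_nonzero)
  qed
qed

lemma val_ge_finsum: "finite A \<Longrightarrow> (\<And>i. i \<in> A \<Longrightarrow> f i \<in> val_ge m) \<Longrightarrow> finsum K f A \<in> val_ge m"
proof (induction A rule: finite_induct)
  case (insert x A)
  then show ?case using val_ge_closed by (subst finsum_insert) (auto intro!: val_ge_add)
qed simp

lemma one_val_ge [simp]: "\<one> \<in> val_ge 0"
  by (simp add: val_ge_nonzero)

lemma pow_nonzero: "z \<in> carrier K \<Longrightarrow> z \<noteq> \<zero> \<Longrightarrow> z [^] (k::nat) \<noteq> \<zero>"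
  by (induction k) (auto simp: integral_iff)

lemma v_pow: "z \<in> carrier K \<Longrightarrow> z \<noteq> \<zero> \<Longrightarrow> v (z [^] (k::nat)) = int k * v z"
  by (induction k) (auto simp: v_mult pow_nonzero algebra_simps)

lemma val_ge_pow: "z \<in> val_ge m \<Longrightarrow> z [^] (k::nat) \<in> val_ge (int k * m)"
proof (induction k)
  case (Suc k)
  then show ?case using val_ge_mult[of "z [^] k" "int k * m" z m] by (simp add: algebra_simps)
qed simp

lemma v_inv: assumes "z \<in> carrier K" "z \<noteq> \<zero>" shows "v (inv z) = - v z"
proof -
  have "z \<in> Units K" using assms field_Units by auto
  then have "inv z \<in> carrier K" "inv z \<noteq> \<zero>" "z \<otimes> inv z = \<one>"
    using Units_inv_Units field_Units by auto
  then show ?thesis using v_mult[of z "inv z"] assms by simp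
qed

lemma v_add_dominant:
  assumes z: "z \<in> carrier K" "z \<noteq> \<zero>" and w: "w \<in> val_ge (v z + 1)"
  shows "z \<oplus> w \<noteq> \<zero>" "v (z \<oplus> w) = v z"
proof -
  have wc [simp]: "w \<in> carrier K" using w val_ge_closed by auto
  have "z \<notin> val_ge (v z + 1)" using z by (simp add: val_ge_nonzero)
  have zeq: "z = (z \<oplus> w) \<ominus> w" using z(1) wc by algebra
  have nv: "z \<oplus> w \<notin> val_ge (v z + 1)"
    using val_ge_diff[OF _ w, of "z \<oplus> w"] \<open>z \<notin> val_ge (v z + 1)\<close> zeq by auto
  then show nz: "z \<oplus> w \<noteq> \<zero>" by auto
  have "z \<oplus> w \<in> val_ge (v z)"
    using z val_ge_add[of z "v z" w] val_ge_mono[OF w, of "v z"] by (simp add: val_ge_nonzero)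
  then show "v (z \<oplus> w) = v z" using nv nz z val_ge_nonzero[of "z \<oplus> w"] by auto
qed

lemma v_diff_unity_root:
  assumes w: "w \<in> carrier K" "w [^] n = \<one>" "w \<noteq> \<one>"
  shows "v (w \<ominus> \<one>) = 0"
proof -
  define \<delta> where "\<delta> = w \<ominus> \<one>"
  have \<delta> [simp]: "\<delta> \<in> carrier K" and nz: "\<delta> \<noteq> \<zero>" using w by (auto simp: \<delta>_def)
  have w0: "w \<noteq> \<zero>" using w n_pos nat_pow_zero[of n] by auto
  have "v w = 0" using v_pow[OF w(1) w0, of n] w(2) n_pos by simp
  then have "w \<in> val_ge 0" using w w0 by (simp add: val_ge_nonzero)
  then have ge: "\<delta> \<in> val_ge 0" unfolding \<delta>_def by (rule val_ge_diff) simp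
  have "\<not> \<delta> \<in> val_ge 1"
  proof
    assume d1: "\<delta> \<in> val_ge 1"
    have "\<exists>g\<in>carrier K. w [^] k \<ominus> \<one> = \<delta> \<otimes> g \<and> g \<ominus> [k] \<cdot> \<one> \<in> val_ge 1 \<and> g \<in> val_ge 0" for k :: nat
    proof (induction k)
      case 0
      show ?case by (intro bexI[of _ \<zero>]) (auto simp: a_minus_def r_neg)
    next
      case (Suc k)
      then obtain g where [simp]: "g \<in> carrier K" and g: "w [^] k \<ominus> \<one> = \<delta> \<otimes> g" "g \<ominus> [k] \<cdot> \<one> \<in> val_ge 1" "g \<in> val_ge 0"
        by auto
      have "w [^] Suc k \<ominus> \<one> = w \<otimes> (w [^] k \<ominus> \<one>) \<oplus> (w \<ominus> \<one>)"
        using w(1) nat_pow_closed[OF w(1), of k] unfolding nat_pow_Suc by algebra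
      also have "\<dots> = w \<otimes> (\<delta> \<otimes> g) \<oplus> \<delta>" using g by (simp add: \<delta>_def)
      also have "\<dots> = \<delta> \<otimes> (w \<otimes> g \<oplus> \<one>)" using \<delta> w(1) \<open>g \<in> carrier K\<close> by algebra
      finally have 1: "w [^] Suc k \<ominus> \<one> = \<delta> \<otimes> (w \<otimes> g \<oplus> \<one>)" .
      have wd: "w = \<delta> \<oplus> \<one>" using w(1) unfolding \<delta>_def by algebra
      have kc: "[k] \<cdot> \<one> \<in> carrier K" by simp
      have "w \<otimes> g \<oplus> \<one> \<ominus> ([k] \<cdot> \<one> \<oplus> \<one>) = (g \<ominus> [k] \<cdot> \<one>) \<oplus> \<delta> \<otimes> g"
        unfolding wd using \<delta> \<open>g \<in> carrier K\<close> kc by algebra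
      moreover have "\<delta> \<otimes> g \<in> val_ge 1" using val_ge_mult[OF d1 g(3)] by simp
      ultimately have 2: "w \<otimes> g \<oplus> \<one> \<ominus> [Suc k] \<cdot> \<one> \<in> val_ge 1"
        using g(2) by (simp add: add.nat_pow_Suc val_ge_add)
      have "w \<otimes> g \<oplus> \<one> \<in> val_ge 0"
        using val_ge_mult[OF \<open>w \<in> val_ge 0\<close> g(3)] by (auto intro: val_ge_add)
      then show ?case using 1 2 w by (intro bexI[of _ "w \<otimes> g \<oplus> \<one>"]) auto
    qed
    from this[of n] obtain g where [simp]: "g \<in> carrier K" and g: "w [^] n \<ominus> \<one> = \<delta> \<otimes> g" "g \<ominus> [n] \<cdot> \<one> \<in> val_ge 1" by auto
    have "\<delta> \<otimes> g = \<zero>" using g(1) w by (simp add: a_minus_def r_neg)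
    then have "g = \<zero>" using nz by (simp add: integral_iff)
    then have "\<ominus> ([n] \<cdot> \<one>) \<in> val_ge 1" using g(2) by (simp add: a_minus_def)
    then have "[n] \<cdot> \<one> \<in> val_ge 1" using val_ge_minus by fastforce
    then show False using n_unit by (simp add: val_ge_nonzero)
  qed
  then show ?thesis using ge nz val_ge_nonzero[OF \<delta> nz] unfolding \<delta>_def[symmetric] by auto
qed

lemma v_diff_roots:
  assumes a: "a \<in> carrier K" "a \<noteq> \<zero>" and b: "b \<in> carrier K" and eq: "a [^] n = b [^] n" and ne: "a \<noteq> b"
  shows "v (a \<ominus> b) = v a"
proof -
  have b0: "b \<noteq> \<zero>" using pow_nonzero[OF a, of n] nat_pow_zero[of n] eq n_pos by auto
  have U: "a \<in> Units K" using a field_Units by auto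
  define w where "w = b \<otimes> inv a"
  have inv: "inv a \<in> carrier K" "inv a \<otimes> a = \<one>" "a \<otimes> inv a = \<one>" using U by auto
  have w: "w \<in> carrier K" "w \<otimes> a = b" using inv b a unfolding w_def by (simp_all add: m_assoc)
  have "w [^] n \<otimes> a [^] n = \<one> \<otimes> a [^] n"
    using nat_pow_distrib[OF w(1) a(1), of n] w a b eq by simp
  then have wn: "w [^] n = \<one>" using w a pow_nonzero[OF a, of n] by (subst (asm) m_rcancel) auto
  have w1: "w \<noteq> \<one>" using w ne a by auto
  have nz: "w \<ominus> \<one> \<noteq> \<zero>" using w w1 by simp
  have "a \<ominus> b = \<ominus> ((w \<ominus> \<one>) \<otimes> a)"
    unfolding w(2)[symmetric] using a(1) w(1) by algebra
  then have "v (a \<ominus> b) = v ((w \<ominus> \<one>) \<otimes> a)" using w a by (simp add: v_minus)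
  also have "\<dots> = v a" using v_diff_unity_root[OF w(1) wn w1] nz w a by (simp add: v_mult)
  finally show ?thesis .
qed

lemma v_le_of_root_map:
  assumes t1: "t1 \<in> carrier K" "t1 \<noteq> \<zero>" and t2: "t2 \<in> carrier K" "t2 \<noteq> \<zero>" "int n dvd v t2"
    and f: "\<And>a. \<lbrakk>a \<in> carrier K; a [^] n = t2\<rbrakk> \<Longrightarrow> f a \<in> carrier K \<and> f a [^] n = t1"
    and inj: "inj_on f {a \<in> carrier K. a [^] n = t2}"
    and dvd: "\<And>a b. \<lbrakk>a \<in> carrier K; a [^] n = t2; b \<in> carrier K; b [^] n = t2\<rbrakk> \<Longrightarrow> f a \<ominus> f b \<in> val_ge (v (a \<ominus> b))"
  shows "v t2 \<le> v t1"
proof -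
  obtain a where a: "a \<in> carrier K" "a [^] n = t2" using root_ex t2 by blast
  have a0: "a \<noteq> \<zero>" using a t2 n_pos nat_pow_zero[of n] by auto
  obtain z where z: "z \<in> carrier K" "z \<noteq> \<one>" "z [^] n = \<one>" using zeta_ex by blast
  define b where "b = z \<otimes> a"
  have b: "b \<in> carrier K" "b [^] n = t2" using a z by (simp_all add: b_def nat_pow_distrib t2)
  have "b \<noteq> a" using z a a0 m_rcancel[of a z \<one>] by (auto simp: b_def)
  then have ne: "f a \<noteq> f b" using inj_onD[OF inj, of a b] a b \<open>b \<noteq> a\<close> by blast
  have fa: "f a \<in> carrier K" "f a [^] n = t1" and fb: "f b \<in> carrier K" "f b [^] n = t1" using f[OF a] f[OF b] by simp_all
  have fa0: "f a \<noteq> \<zero>" using fa t1 n_pos nat_pow_zero[of n] by auto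
  have "v (a \<ominus> b) \<le> v (f a \<ominus> f b)"
    using dvd[OF a b] ne fa fb val_ge_nonzero[of "f a \<ominus> f b"] by auto
  then have "v a \<le> v (f a)"
    using v_diff_roots[OF a(1) a0 b(1)] v_diff_roots[OF fa(1) fa0 fb(1)] \<open>b \<noteq> a\<close> ne a b fa fb by auto
  then show ?thesis using v_pow[OF a(1) a0, of n] v_pow[OF fa(1) fa0, of n] a fa
    by (simp add: mult_left_mono)
qed

end

section \<open>Weights modulo a binomial\<close>

context root_alg
begin

text \<open>Up to degree \<open>N * n\<close>, the constant coefficient of the remainder of \<open>f\<close> modulo \<open>T\<^sup>n - t\<close>.\<close>

definition const_part :: "nat \<Rightarrow> (nat \<Rightarrow> 'a) \<Rightarrow> 'a" where
  "const_part N f = (\<Oplus>q\<in>{..N}. up_ring.coeff PR f (q * n) \<otimes> t [^] q)"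

lemma const_part_add:
  assumes "f \<in> carrier PR" "g \<in> carrier PR"
  shows "const_part N (f \<oplus>\<^bsub>PR\<^esub> g) = const_part N f \<oplus> const_part N g"
  unfolding const_part_def using assms
  by (subst finsum_addf[symmetric]) (auto intro!: finsum_cong' simp: l_distr)

lemma const_part_monom:
  assumes a: "a \<in> carrier R" and n: "n > 0" and q: "q \<le> N"
  shows "const_part N (up_ring.monom PR a (q * n)) = a \<otimes> t [^] q"
proof -
  have "const_part N (up_ring.monom PR a (q * n)) = (\<Oplus>i\<in>{..N}. if q = i then a \<otimes> t [^] i else \<zero>)"
    unfolding const_part_def using a n by (intro finsum_cong') auto
  also have "\<dots> = a \<otimes> t [^] q"
    using a q by (intro finsum_singleton[where f = "\<lambda>i. a \<otimes> t [^] i"]) auto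
  finally show ?thesis .
qed

lemma coeff_root_poly_mult:
  assumes H: "H \<in> carrier PR" and n: "n > 0"
  shows "up_ring.coeff PR (root_poly R n t \<otimes>\<^bsub>PR\<^esub> H) 0 = \<ominus> (t \<otimes> up_ring.coeff PR H 0)"
    and "up_ring.coeff PR (root_poly R n t \<otimes>\<^bsub>PR\<^esub> H) (k + n) = up_ring.coeff PR H k \<ominus> t \<otimes> up_ring.coeff PR H (k + n)"
proof -
  have eq: "root_poly R n t \<otimes>\<^bsub>PR\<^esub> H = up_ring.monom PR \<one> n \<otimes>\<^bsub>PR\<^esub> H \<ominus>\<^bsub>PR\<^esub> up_ring.monom PR t 0 \<otimes>\<^bsub>PR\<^esub> H"
    using H unfolding root_poly_def by (simp add: U.P.minus_eq U.P.l_distr U.P.l_minus)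
  have c: "up_ring.monom PR \<one> n \<otimes>\<^bsub>PR\<^esub> H \<in> carrier PR" "up_ring.monom PR t 0 \<otimes>\<^bsub>PR\<^esub> H \<in> carrier PR"
    using H by simp_all
  have m: "up_ring.coeff PR (up_ring.monom PR t 0 \<otimes>\<^bsub>PR\<^esub> H) k = t \<otimes> up_ring.coeff PR H k" for k
    using U.coeff_monom_mult[OF t_closed H, of 0 k] by simp
  have "up_ring.coeff PR (up_ring.monom PR \<one> n \<otimes>\<^bsub>PR\<^esub> H) 0 = \<zero>"
    using H n by simp
  then show "up_ring.coeff PR (root_poly R n t \<otimes>\<^bsub>PR\<^esub> H) 0 = \<ominus> (t \<otimes> up_ring.coeff PR H 0)"
    unfolding eq U.coeff_minus[OF c] m using H by (simp add: minus_eq)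
  have "up_ring.coeff PR (up_ring.monom PR \<one> n \<otimes>\<^bsub>PR\<^esub> H) (k + n) = up_ring.coeff PR H k"
    using U.coeff_monom_mult[OF one_closed H, of n k] H by simp
  then show "up_ring.coeff PR (root_poly R n t \<otimes>\<^bsub>PR\<^esub> H) (k + n) = up_ring.coeff PR H k \<ominus> t \<otimes> up_ring.coeff PR H (k + n)"
    unfolding eq U.coeff_minus[OF c] m by simp
qed

lemma const_part_root_poly_mult:
  assumes H: "H \<in> carrier PR" and n: "n > 0"
  shows "const_part N (root_poly R n t \<otimes>\<^bsub>PR\<^esub> H) = \<ominus> (up_ring.coeff PR H (N * n) \<otimes> t [^] Suc N)"
proof (induction N)
  case 0
  show ?case using H n coeff_root_poly_mult(1)[OF H n] unfolding const_part_def by (simp add: m_comm del: U.coeff_mult)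
next
  case (Suc N)
  let ?G = "root_poly R n t \<otimes>\<^bsub>PR\<^esub> H"
  have G: "?G \<in> carrier PR" using H by simp
  have "const_part (Suc N) ?G = up_ring.coeff PR ?G (Suc N * n) \<otimes> t [^] Suc N \<oplus> const_part N ?G"
    unfolding const_part_def using G by (subst finsum_Suc) (auto simp del: U.coeff_mult)
  also have "up_ring.coeff PR ?G (Suc N * n) = up_ring.coeff PR H (N * n) \<ominus> t \<otimes> up_ring.coeff PR H (Suc N * n)"
    using coeff_root_poly_mult(2)[OF H n, of "N * n"] by (simp only: mult_Suc add.commute[of n])
  also have "(up_ring.coeff PR H (N * n) \<ominus> t \<otimes> up_ring.coeff PR H (Suc N * n)) \<otimes> t [^] Suc N \<oplus> const_part N ?G
     = \<ominus> (up_ring.coeff PR H (Suc N * n) \<otimes> (t [^] Suc N \<otimes> t))"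
  proof -
    have "a \<in> carrier R \<Longrightarrow> b \<in> carrier R \<Longrightarrow> s \<in> carrier R \<Longrightarrow>
      (a \<ominus> t \<otimes> b) \<otimes> s \<oplus> \<ominus> (a \<otimes> s) = \<ominus> (b \<otimes> (s \<otimes> t))" for a b s
      using t_closed by algebra
    then show ?thesis unfolding Suc.IH using H by (simp del: U.coeff_mult nat_pow_Suc)
  qed
  also have "t [^] Suc N \<otimes> t = t [^] Suc (Suc N)" by simp
  finally show ?case .
qed

lemma root_poly_deg:
  assumes "\<one> \<noteq> \<zero>" "n > 0"
  shows "deg R (root_poly R n t) = n"
  by (rule le_antisym, rule U.deg_aboveI, use assms in \<open>auto intro!: U.deg_belowI simp: root_poly_def minus_eq\<close>)

lemma reduced_representative:
  assumes z: "z \<in> carrier B" and R: "\<one> \<noteq> \<zero>" and n: "n > 0"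
  obtains p where "p \<in> carrier PR" "z = I +>\<^bsub>PR\<^esub> p" "\<And>j. n \<le> j \<Longrightarrow> up_ring.coeff PR p j = \<zero>"
proof -
  obtain f where f: "f \<in> carrier PR" "z = I +>\<^bsub>PR\<^esub> f" using z by (rule root_algebraE)
  have lc: "up_ring.coeff PR (root_poly R n t) n = \<one>" using n by (simp add: root_poly_def minus_eq)
  then have "root_poly R n t \<noteq> \<zero>\<^bsub>PR\<^esub>" using R by auto
  from U.long_div_theorem[OF root_poly_closed f(1) this] obtain q r k where
    q: "q \<in> carrier PR" and r: "r \<in> carrier PR"
    and eq: "up_ring.coeff PR (root_poly R n t) (deg R (root_poly R n t)) [^] (k::nat) \<odot>\<^bsub>PR\<^esub> f = root_poly R n t \<otimes>\<^bsub>PR\<^esub> q \<oplus>\<^bsub>PR\<^esub> r"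
    and d: "r = \<zero>\<^bsub>PR\<^esub> \<or> deg R r < deg R (root_poly R n t)" by blast
  have "f = root_poly R n t \<otimes>\<^bsub>PR\<^esub> q \<oplus>\<^bsub>PR\<^esub> r"
    using eq f by (simp add: root_poly_deg[OF R n] lc)
  then have "f \<ominus>\<^bsub>PR\<^esub> r = q \<otimes>\<^bsub>PR\<^esub> root_poly R n t"
    using q r by (simp add: U.P.minus_eq U.P.a_assoc U.P.r_neg U.P.m_comm)
  then have "f \<ominus>\<^bsub>PR\<^esub> r \<in> I" using q unfolding cgenideal_def by auto
  then have "z = I +>\<^bsub>PR\<^esub> r" using f r by (simp add: coset_eq_iff)
  moreover have "up_ring.coeff PR r j = \<zero>" if "n \<le> j" for j
    using d r that U.deg_aboveD[of r j] root_poly_deg[OF R n] by auto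
  ultimately show thesis using that r by blast
qed

end

context val_field
begin

lemma weight_argument:
  fixes e d :: nat
  assumes n: "n = e * d" and c: "c \<in> carrier K" "c \<noteq> \<zero>" and cop: "coprime (v c) (int e)"
    and x: "x \<in> carrier (root_algebra K e c)"
    and t: "t \<in> carrier K" "t \<noteq> \<zero>"
    and pow: "x [^]\<^bsub>root_algebra K e c\<^esub> n = root_algebra_map K e c t"
  shows "int n dvd int e * v t"
proof -
  have e: "e > 0" and d: "d > 0" using n n_pos by auto
  interpret RA: root_alg K e c by unfold_locales fact
  let ?P = "UP K"
  let ?co = "up_ring.coeff (UP K)"
  let ?mo = "up_ring.monom (UP K)"
  obtain p where p: "p \<in> carrier ?P" "x = RA.I +>\<^bsub>?P\<^esub> p" and low: "\<And>j. e \<le> j \<Longrightarrow> ?co p j = \<zero>"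
    by (rule RA.reduced_representative[OF x _ e]) auto
  have "RA.I +>\<^bsub>?P\<^esub> (p [^]\<^bsub>?P\<^esub> n) = RA.I +>\<^bsub>?P\<^esub> ?mo t 0"
    using pow p unfolding root_algebra_map_def by simp
  then have "p [^]\<^bsub>?P\<^esub> n \<ominus>\<^bsub>?P\<^esub> ?mo t 0 \<in> RA.I"
    using p t by (subst (asm) RA.coset_eq_iff) auto
  then obtain H where H: "H \<in> carrier ?P" and pn: "p [^]\<^bsub>?P\<^esub> n \<ominus>\<^bsub>?P\<^esub> ?mo t 0 = root_poly K e c \<otimes>\<^bsub>?P\<^esub> H"
    unfolding cgenideal_def using RA.U.P.m_comm RA.root_poly_closed by auto
  have pn_eq: "p [^]\<^bsub>?P\<^esub> n = root_poly K e c \<otimes>\<^bsub>?P\<^esub> H \<oplus>\<^bsub>?P\<^esub> ?mo t 0"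
    unfolding pn[symmetric] using p t by (simp add: RA.U.P.minus_eq RA.U.P.a_assoc RA.U.P.l_neg)
  define wt where "wt j = int e * v (?co p j) + int j * v c" for j
  define J where "J = {j. j < e \<and> ?co p j \<noteq> \<zero>}"
  have const_t: "RA.const_part N (?mo t 0) = t" for N
    using RA.const_part_monom[OF t(1) e, of 0 N] t by simp
  have pn_const: "RA.const_part N (p [^]\<^bsub>?P\<^esub> n) = t" if "deg K H < N" for N
  proof -
    have "N \<le> N * e" using e by simp
    then have "deg K H < N * e" using that by linarith
    then have "?co H (N * e) = \<zero>" using H by (rule RA.U.deg_aboveD)
    then show ?thesis
      unfolding pn_eq using H t c by (subst RA.const_part_add) (auto simp: RA.const_part_root_poly_mult[OF H e] const_t)
  qed
  have "J \<noteq> {}"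
  proof
    assume "J = {}"
    then have "?co p j = \<zero>" for j unfolding J_def using low[of j] by (cases "j < e") auto
    then have "p = \<zero>\<^bsub>?P\<^esub>" using p by (intro RA.U.up_eqI) auto
    then have "p [^]\<^bsub>?P\<^esub> n = \<zero>\<^bsub>?P\<^esub>" using n_pos by (simp add: RA.U.P.nat_pow_zero)
    then have "RA.const_part (Suc (deg K H)) \<zero>\<^bsub>?P\<^esub> = t" using pn_const[of "Suc (deg K H)"] by simp
    moreover have "RA.const_part (Suc (deg K H)) \<zero>\<^bsub>?P\<^esub> = \<zero>"
      unfolding RA.const_part_def using c by simp
    ultimately show False using t by simp
  qed
  moreover have "finite J" unfolding J_def by auto
  ultimately obtain j0 where j0: "j0 \<in> J" and min: "\<And>j. j \<in> J \<Longrightarrow> wt j0 \<le> wt j"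
    using ex_min_if_finite[of "wt ` J"] by (metis (no_types, lifting) finite_imageI image_iff image_is_empty linorder_not_less)
  define a where "a = ?co p j0"
  have a: "a \<in> carrier K" "a \<noteq> \<zero>" using j0 p by (auto simp: a_def J_def)
  define w where "w = wt j0"
  have distinct: "w < wt j" if "j \<in> J" "j \<noteq> j0" for j
  proof -
    have "wt j \<noteq> wt j0"
    proof
      assume "wt j = wt j0"
      then have "(int j - int j0) * v c = int e * (v (?co p j0) - v (?co p j))"
        unfolding wt_def by (simp add: algebra_simps)
      then have "int e dvd (int j - int j0) * v c" by simp
      then have "int e dvd int j - int j0" using cop by (simp add: coprime_commute coprime_dvd_mult_left_iff)
      moreover have "\<bar>int j - int j0\<bar> < \<bar>int e\<bar>" using that j0 unfolding J_def by auto
      ultimately have "int j - int j0 = 0" by (metis dvd_imp_le_int linorder_not_le)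
      then show False using that by simp
    qed
    then show ?thesis using min[OF that(1)] unfolding w_def by simp
  qed
  define S where "S m = {z \<in> carrier K. z = \<zero> \<or> m \<le> int e * v z}" for m
  have S_iff: "S m = val_ge (- ((- m) div int e))" for m
  proof -
    have "m \<le> int e * V \<longleftrightarrow> - ((- m) div int e) \<le> V" for V
    proof -
      have "- V \<le> (- m) div int e \<longleftrightarrow> int e * (- V) \<le> - m"
      proof
        assume "- V \<le> (- m) div int e"
        then have "int e * (- V) \<le> int e * ((- m) div int e)" by (intro mult_left_mono) auto
        also have "\<dots> \<le> - m" using e mult_div_mod_eq[of "int e" "- m"] pos_mod_sign[of "int e" "- m"] by linarith
        finally show "int e * (- V) \<le> - m" by auto
      next
        assume "int e * (- V) \<le> - m"
        also have "- m < int e * ((- m) div int e + 1)"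
          using e mult_div_mod_eq[of "int e" "- m"] pos_mod_bound[of "int e" "- m"] unfolding distrib_left by linarith
        finally have "- V < (- m) div int e + 1" using e by (simp only: mult_less_cancel_left_pos of_nat_0_less_iff)
        then show "- V \<le> (- m) div int e" by simp
      qed
      then show ?thesis by auto
    qed
    then show ?thesis unfolding S_def val_ge_def by auto
  qed
  have S_mult: "z \<otimes> z' \<in> S (m + m')" if "z \<in> S m" "z' \<in> S m'" for z z' m m'
  proof (cases "z = \<zero> \<or> z' = \<zero>")
    case True then show ?thesis using that unfolding S_def by auto
  next
    case False
    then show ?thesis using that v_mult[of z z'] unfolding S_def by (auto simp: algebra_simps)
  qed
  have S_pow: "z [^] (q::nat) \<in> S (int q * m)" if "z \<in> S m" for z q m
  proof (induction q)
    case 0 show ?case unfolding S_def by simp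
  next
    case (Suc q) then show ?case using S_mult[OF Suc that] by (simp add: algebra_simps)
  qed
  define F where "F m = {f \<in> carrier ?P. \<forall>j. ?co f j \<in> S (m - int j * v c)}" for m
  have F_closed: "f \<in> carrier ?P" if "f \<in> F m" for f m using that unfolding F_def by auto
  have F_add: "f \<oplus>\<^bsub>?P\<^esub> g \<in> F m" if "f \<in> F m" "g \<in> F m" for f g m
    using that unfolding F_def S_iff by (auto intro: val_ge_add)
  have F_mult: "f \<otimes>\<^bsub>?P\<^esub> g \<in> F (m + m')" if f: "f \<in> F m" and g: "g \<in> F m'" for f g m m'
  proof -
    have "?co f i \<otimes> ?co g (j - i) \<in> S (m + m' - int j * v c)" if "i \<le> j" for i j
    proof -
      have "?co f i \<otimes> ?co g (j - i) \<in> S ((m - int i * v c) + (m' - int (j - i) * v c))"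
        by (rule S_mult) (use f g in \<open>auto simp: F_def\<close>)
      then show ?thesis using that by (simp add: algebra_simps of_nat_diff)
    qed
    then have "(\<Oplus>i\<in>{..j}. ?co f i \<otimes> ?co g (j - i)) \<in> S (m + m' - int j * v c)" for j
      unfolding S_iff by (intro val_ge_finsum) auto
    then show ?thesis using F_closed[OF f] F_closed[OF g] unfolding F_def by simp
  qed
  define \<mu> where "\<mu> = ?mo a j0"
  have \<mu>_closed [simp]: "\<mu> \<in> carrier ?P" using a by (simp add: \<mu>_def)
  have \<mu>_F: "\<mu> \<in> F w" using a unfolding F_def \<mu>_def S_def by (auto simp: w_def wt_def a_def[symmetric])
  have diff_F: "p \<ominus>\<^bsub>?P\<^esub> \<mu> \<in> F (w + 1)"
  proof -
    have "?co (p \<ominus>\<^bsub>?P\<^esub> \<mu>) j \<in> S (w + 1 - int j * v c)" for j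
    proof (cases "j \<in> J \<and> j \<noteq> j0")
      case True
      then show ?thesis using distinct[of j] p a unfolding S_def \<mu>_def wt_def by (auto simp: minus_eq)
    next
      case False
      then have "?co (p \<ominus>\<^bsub>?P\<^esub> \<mu>) j = \<zero>"
        using p a low[of j] j0 unfolding \<mu>_def J_def a_def by (cases "j = j0") (auto simp: minus_eq r_neg)
      then show ?thesis unfolding S_def by simp
    qed
    then show ?thesis using p unfolding F_def by simp
  qed
  have "p = p \<ominus>\<^bsub>?P\<^esub> \<mu> \<oplus>\<^bsub>?P\<^esub> \<mu>" using p by (simp add: RA.U.P.minus_eq RA.U.P.a_assoc RA.U.P.l_neg)
  moreover have "p \<ominus>\<^bsub>?P\<^esub> \<mu> \<in> F w" using diff_F unfolding F_def S_def by fastforce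
  ultimately have p_F: "p \<in> F w" using F_add \<mu>_F by metis
  have pow_F: "p [^]\<^bsub>?P\<^esub> k \<in> F (int k * w) \<and> p [^]\<^bsub>?P\<^esub> k \<ominus>\<^bsub>?P\<^esub> \<mu> [^]\<^bsub>?P\<^esub> k \<in> F (int k * w + 1)" for k :: nat
  proof (induction k)
    case 0
    show ?case unfolding F_def S_def by (auto simp: RA.U.P.minus_eq minus_eq r_neg)
  next
    case (Suc k)
    let ?p = "p [^]\<^bsub>?P\<^esub> k" and ?m = "\<mu> [^]\<^bsub>?P\<^esub> k"
    have c: "?p \<in> carrier ?P" "?m \<in> carrier ?P" using p by auto
    have "p [^]\<^bsub>?P\<^esub> Suc k \<ominus>\<^bsub>?P\<^esub> \<mu> [^]\<^bsub>?P\<^esub> Suc k = ?p \<otimes>\<^bsub>?P\<^esub> (p \<ominus>\<^bsub>?P\<^esub> \<mu>) \<oplus>\<^bsub>?P\<^esub> (?p \<ominus>\<^bsub>?P\<^esub> ?m) \<otimes>\<^bsub>?P\<^esub> \<mu>"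
      using c p(1) \<mu>_closed unfolding RA.U.P.nat_pow_Suc by algebra
    moreover have "?p \<otimes>\<^bsub>?P\<^esub> (p \<ominus>\<^bsub>?P\<^esub> \<mu>) \<in> F (int k * w + (w + 1))"
      using F_mult Suc diff_F by blast
    moreover have "(?p \<ominus>\<^bsub>?P\<^esub> ?m) \<otimes>\<^bsub>?P\<^esub> \<mu> \<in> F ((int k * w + 1) + w)"
      using F_mult Suc \<mu>_F by blast
    moreover have "?p \<otimes>\<^bsub>?P\<^esub> p \<in> F (int k * w + w)" using F_mult Suc p_F by blast
    ultimately show ?case using F_add by (simp add: algebra_simps)
  qed
  define N where "N = deg K H + j0 * d + 1"
  define D where "D = p [^]\<^bsub>?P\<^esub> n \<ominus>\<^bsub>?P\<^esub> \<mu> [^]\<^bsub>?P\<^esub> n"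
  define y where "y = a [^] n \<otimes> c [^] (j0 * d)"
  have y: "y \<in> carrier K" "y \<noteq> \<zero>" using a c pow_nonzero by (auto simp: y_def integral_iff)
  have vy: "int e * v y = int n * w"
  proof -
    have "v y = int n * v a + int (j0 * d) * v c" using a c pow_nonzero by (simp add: y_def v_mult v_pow)
    then show ?thesis using n by (simp add: w_def wt_def a_def[symmetric] algebra_simps)
  qed
  have "\<mu> [^]\<^bsub>?P\<^esub> n = ?mo (a [^] n) ((j0 * d) * e)"
    using a n by (simp add: \<mu>_def RA.U.monom_pow ac_simps)
  then have \<mu>n: "RA.const_part N (\<mu> [^]\<^bsub>?P\<^esub> n) = y"
    using RA.const_part_monom[of "a [^] n" "j0 * d" N] a e by (simp add: N_def y_def)
  have D_F: "D \<in> F (int n * w + 1)" using pow_F[of n] unfolding D_def by simp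
  have "RA.const_part N D \<in> S (int n * w + 1)"
  proof -
    have "?co D (q * e) \<otimes> c [^] q \<in> S (int n * w + 1)" for q
    proof -
      have "c \<in> S (int e * v c)" using c unfolding S_def by simp
      then have "c [^] q \<in> S (int q * (int e * v c))" by (rule S_pow)
      moreover have "?co D (q * e) \<in> S (int n * w + 1 - int (q * e) * v c)" using D_F unfolding F_def by blast
      ultimately have "?co D (q * e) \<otimes> c [^] q \<in> S ((int n * w + 1 - int (q * e) * v c) + int q * (int e * v c))"
        by (intro S_mult)
      then show ?thesis by (simp add: algebra_simps)
    qed
    then show ?thesis unfolding RA.const_part_def S_iff by (intro val_ge_finsum) auto
  qed
  moreover have "t = y \<oplus> RA.const_part N D"
  proof -
    have "p [^]\<^bsub>?P\<^esub> n = \<mu> [^]\<^bsub>?P\<^esub> n \<oplus>\<^bsub>?P\<^esub> D"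
      using RA.U.P.nat_pow_closed[OF p(1), of n] RA.U.P.nat_pow_closed[OF \<mu>_closed, of n]
      unfolding D_def by algebra
    then show ?thesis
      using pn_const[of N] RA.const_part_add[of "\<mu> [^]\<^bsub>?P\<^esub> n" D N] \<mu>n F_closed[OF D_F]
      by (simp add: N_def)
  qed
  moreover have "S (int n * w + 1) \<subseteq> val_ge (v y + 1)"
  proof
    fix z assume "z \<in> S (int n * w + 1)"
    then show "z \<in> val_ge (v y + 1)"
      unfolding S_def val_ge_def vy[symmetric] using e
      by auto (metis add1_zle_eq mult_less_cancel_left_pos of_nat_0_less_iff)
  qed
  ultimately have "v t = v y" using v_add_dominant[OF y] by auto
  then show ?thesis using vy by simp
qed

end

section \<open>Invariants of an isomorphism\<close>

context val_field
begin

lemma val_surj: "\<exists>p\<in>carrier K. p \<noteq> \<zero> \<and> v p = m"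
proof -
  obtain p where p: "p \<in> carrier K" "p \<noteq> \<zero>" "v p = 1" using uniformizer by auto
  obtain k where k: "m = int k \<or> m = - int k" using int_cases2[of m] by metis
  have q: "p [^] k \<in> carrier K" "p [^] k \<noteq> \<zero>" using p pow_nonzero by auto
  then have "p [^] k \<in> Units K" using field_Units by auto
  then have inv: "inv (p [^] k) \<in> carrier K" "inv (p [^] k) \<noteq> \<zero>"
    using Units_inv_Units field_Units by auto
  show ?thesis using k q inv p v_inv[OF q] v_pow[OF p(1,2), of k] by auto
qed

lemma gcd_val_dvd:
  assumes t1: "t1 \<in> carrier K" "t1 \<noteq> \<zero>" and t2: "t2 \<in> carrier K" "t2 \<noteq> \<zero>"
    and lift: "\<And>e c x. \<lbrakk>c \<in> carrier K; x \<in> carrier (root_algebra K e c);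
        x [^]\<^bsub>root_algebra K e c\<^esub> n = root_algebra_map K e c t2\<rbrakk>
      \<Longrightarrow> \<exists>y\<in>carrier (root_algebra K e c). y [^]\<^bsub>root_algebra K e c\<^esub> n = root_algebra_map K e c t1"
  shows "gcd (int n) (v t2) dvd v t1"
proof -
  define d where "d = nat (gcd (int n) (v t2))"
  have d: "int d = gcd (int n) (v t2)" "d > 0" using n_pos by (auto simp: d_def)
  then obtain e where n: "n = e * d" by (metis dvd_def gcd_dvd1 int_dvd_int_iff mult.commute)
  obtain g where g: "v t2 = int d * g" using d by (metis dvdE gcd_dvd2)
  have cop: "coprime g (int e)"
  proof -
    have "int d = int d * gcd (int e) g"
      using d(1) unfolding n g by (simp add: mult.commute[of "int e"] gcd_mult_distrib_int[of "int d" "int e" g, symmetric])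
    then show ?thesis using d(2) by (simp add: coprime_iff_gcd_eq_1 gcd.commute)
  qed
  obtain q where q: "q \<in> carrier K" "q \<noteq> \<zero>" "v q = g" using val_surj by auto
  have qd: "q [^] d \<in> carrier K" "q [^] d \<noteq> \<zero>" using q pow_nonzero by auto
  then have U: "q [^] d \<in> Units K" using field_Units by auto
  then have inv: "inv (q [^] d) \<in> carrier K" "inv (q [^] d) \<noteq> \<zero>" "inv (q [^] d) \<otimes> q [^] d = \<one>"
    using Units_inv_Units field_Units by auto
  have "v (t2 \<otimes> inv (q [^] d)) = 0"
    using v_mult[OF t2 inv(1,2)] v_inv[OF qd] v_pow[OF q(1,2), of d] q(3) g by simp
  then obtain s where s: "s \<in> carrier K" "s [^] n = t2 \<otimes> inv (q [^] d)"
    using root_ex[of "t2 \<otimes> inv (q [^] d)"] inv t2 by (auto simp: integral_iff)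
  define c where "c = s [^] e \<otimes> q"
  have c: "c \<in> carrier K" using s q by (simp add: c_def)
  have "c [^] d = s [^] n \<otimes> q [^] d"
    using s(1) q by (simp add: c_def nat_pow_distrib nat_pow_pow n)
  also have "\<dots> = t2" using inv t2 qd by (simp add: s(2) m_assoc)
  finally have cd: "c [^] d = t2" .
  then have c0: "c \<noteq> \<zero>" using d(2) t2 nat_pow_zero[of d] by auto
  have "v c = g" using v_pow[OF c c0, of d] cd g d(2) by simp
  then have cop': "coprime (v c) (int e)" using cop by simp
  interpret RA: root_alg K e c by unfold_locales fact
  interpret M: ring_hom_cring K "root_algebra K e c" "root_algebra_map K e c"
    using RA.root_algebra_map_hom by unfold_locales
  have "root_gen K e c [^]\<^bsub>root_algebra K e c\<^esub> n = root_algebra_map K e c t2"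
    using RA.root_gen_pow RA.B.nat_pow_pow[OF RA.root_gen_closed, of e d] c by (simp add: n flip: cd)
  then obtain y where "y \<in> carrier (root_algebra K e c)" "y [^]\<^bsub>root_algebra K e c\<^esub> n = root_algebra_map K e c t1"
    using lift[OF c RA.root_gen_closed] by auto
  then have "int n dvd int e * v t1"
    using weight_argument[OF n c c0 cop' _ t1] by blast
  moreover have "int n = int e * int d" using n by simp
  moreover have "e > 0" using n n_pos by simp
  ultimately show ?thesis unfolding d(1)[symmetric] by simp
qed

lemma diff_pow_val_ge:
  assumes a: "a \<in> val_ge 0" and b: "b \<in> val_ge 0" and m: "a \<ominus> b \<in> val_ge m"
  shows "a [^] (i::nat) \<ominus> b [^] i \<in> val_ge m"
proof (induction i)
  case 0
  then show ?case by (simp add: minus_eq r_neg)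
next
  case (Suc i)
  have [simp]: "a \<in> carrier K" "b \<in> carrier K" using a b val_ge_closed by auto
  have "a [^] Suc i \<ominus> b [^] Suc i = (a [^] i \<ominus> b [^] i) \<otimes> a \<oplus> b [^] i \<otimes> (a \<ominus> b)"
    using \<open>a \<in> carrier K\<close> \<open>b \<in> carrier K\<close> nat_pow_closed[of a i] nat_pow_closed[of b i]
    unfolding nat_pow_Suc by algebra
  moreover have "(a [^] i \<ominus> b [^] i) \<otimes> a \<in> val_ge m" using val_ge_mult[OF Suc a] by simp
  moreover have "b [^] i \<otimes> (a \<ominus> b) \<in> val_ge m" using val_ge_mult[OF val_ge_pow[OF b, of i] m] by simp
  ultimately show ?case using val_ge_add by simp
qed

lemma gcd_val_dvd_of_hom:
  assumes R: "cring R" and \<phi>: "\<phi> \<in> ring_hom R K"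
    and t1: "t1 \<in> carrier R" "\<phi> t1 \<noteq> \<zero>" and t2: "t2 \<in> carrier R" "\<phi> t2 \<noteq> \<zero>"
    and h: "h \<in> ring_hom (root_algebra R n t1) (root_algebra R n t2)"
      "\<And>a. a \<in> carrier R \<Longrightarrow> h (root_algebra_map R n t1 a) = root_algebra_map R n t2 a"
  shows "gcd (int n) (v (\<phi> t2)) dvd v (\<phi> t1)"
proof (rule gcd_val_dvd)
  interpret R: cring R by fact
  interpret A1: root_alg R n t1 by unfold_locales fact
  interpret A2: root_alg R n t2 by unfold_locales fact
  show "\<phi> t1 \<in> carrier K" "\<phi> t2 \<in> carrier K" "\<phi> t1 \<noteq> \<zero>" "\<phi> t2 \<noteq> \<zero>"
    using t1 t2 ring_hom_closed[OF \<phi>] by auto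
  fix e c x assume c: "c \<in> carrier K" and x: "x \<in> carrier (root_algebra K e c)"
    and pow: "x [^]\<^bsub>root_algebra K e c\<^esub> n = root_algebra_map K e c (\<phi> t2)"
  interpret L: root_alg K e c by unfold_locales fact
  have \<psi>: "root_algebra_map K e c \<circ> \<phi> \<in> ring_hom R (root_algebra K e c)"
    using \<phi> L.root_algebra_map_hom by (rule ring_hom_trans)
  obtain \<Phi> where \<Phi>: "\<Phi> \<in> ring_hom (root_algebra R n t2) (root_algebra K e c)"
    "\<And>a. a \<in> carrier R \<Longrightarrow> \<Phi> (root_algebra_map R n t2 a) = (root_algebra_map K e c \<circ> \<phi>) a"
    using A2.root_algebra_universal[OF L.cring_root_algebra \<psi> x] pow unfolding comp_apply by metis
  have G: "\<Phi> \<circ> h \<in> ring_hom (root_algebra R n t1) (root_algebra K e c)"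
    using h(1) \<Phi>(1) by (rule ring_hom_trans)
  interpret G: ring_hom_cring "root_algebra R n t1" "root_algebra K e c" "\<Phi> \<circ> h"
    using G by unfold_locales
  show "\<exists>y\<in>carrier (root_algebra K e c). y [^]\<^bsub>root_algebra K e c\<^esub> n = root_algebra_map K e c (\<phi> t1)"
    using G.hom_closed[OF A1.root_gen_closed] G.hom_pow[OF A1.root_gen_closed, of n] t1 h(2) \<Phi>(2)
    by (intro bexI[of _ "(\<Phi> \<circ> h) (root_gen R n t1)"]) (auto simp: A1.root_gen_pow)
qed

lemma v_le_of_iso:
  assumes R: "cring R" and \<phi>: "\<phi> \<in> ring_hom R K"
    and t1: "t1 \<in> carrier R" "\<phi> t1 \<noteq> \<zero>"
    and t2: "t2 \<in> carrier R" "\<phi> t2 \<noteq> \<zero>" "int n dvd v (\<phi> t2)" "0 \<le> v (\<phi> t2)"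
    and h: "h \<in> ring_iso (root_algebra R n t1) (root_algebra R n t2)"
      "\<And>a. a \<in> carrier R \<Longrightarrow> h (root_algebra_map R n t1 a) = root_algebra_map R n t2 a"
    and p: "p \<in> carrier (UP R)" "h (root_gen R n t1) = PIdl\<^bsub>UP R\<^esub> (root_poly R n t2) +>\<^bsub>UP R\<^esub> p"
    and int: "\<And>i. \<phi> (up_ring.coeff (UP R) p i) \<in> val_ge 0"
  shows "v (\<phi> t2) \<le> v (\<phi> t1)"
proof -
  interpret R: cring R by fact
  interpret A1: root_alg R n t1 by unfold_locales fact
  interpret A2: root_alg R n t2 by unfold_locales fact
  have h_hom: "h \<in> ring_hom (root_algebra R n t1) (root_algebra R n t2)"
    and h_bij: "bij_betw h (carrier (root_algebra R n t1)) (carrier (root_algebra R n t2))"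
    using h(1) unfolding ring_iso_def by auto
  let ?f = "\<lambda>a. UnivPoly.eval R K \<phi> a p"
  have ex: "\<exists>\<Phi>. \<Phi> \<in> ring_hom (root_algebra R n t2) K
      \<and> (\<forall>r\<in>carrier R. \<Phi> (root_algebra_map R n t2 r) = \<phi> r) \<and> \<Phi> (root_gen R n t2) = a
      \<and> \<Phi> (h (root_gen R n t1)) = ?f a" if "a \<in> carrier K" "a [^] n = \<phi> t2" for a
    using A2.root_algebra_universal[OF is_cring \<phi> that] p by metis
  have f: "?f a \<in> carrier K" "?f a [^] n = \<phi> t1" if a: "a \<in> carrier K" "a [^] n = \<phi> t2" for a
  proof -
    obtain \<Phi> where \<Phi>: "\<Phi> \<in> ring_hom (root_algebra R n t2) K"
      "\<forall>r\<in>carrier R. \<Phi> (root_algebra_map R n t2 r) = \<phi> r" "\<Phi> (h (root_gen R n t1)) = ?f a"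
      using ex[OF a] by auto
    interpret G: ring_hom_cring "root_algebra R n t1" K "\<Phi> \<circ> h"
      using ring_hom_trans[OF h_hom \<Phi>(1)] by unfold_locales
    show "?f a \<in> carrier K" "?f a [^] n = \<phi> t1"
      using G.hom_closed[OF A1.root_gen_closed] G.hom_pow[OF A1.root_gen_closed, of n] t1 h(2) \<Phi>
      by (auto simp: A1.root_gen_pow)
  qed
  have inj: "inj_on ?f {a \<in> carrier K. a [^] n = \<phi> t2}"
  proof (rule inj_onI)
    fix a b assume "a \<in> {a \<in> carrier K. a [^] n = \<phi> t2}" "b \<in> {a \<in> carrier K. a [^] n = \<phi> t2}" and eq: "?f a = ?f b"
    then have a: "a \<in> carrier K" "a [^] n = \<phi> t2" and b: "b \<in> carrier K" "b [^] n = \<phi> t2" by auto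
    obtain \<Phi> where \<Phi>: "\<Phi> \<in> ring_hom (root_algebra R n t2) K"
      "\<forall>r\<in>carrier R. \<Phi> (root_algebra_map R n t2 r) = \<phi> r" "\<Phi> (root_gen R n t2) = a" "\<Phi> (h (root_gen R n t1)) = ?f a"
      using ex[OF a] by auto
    obtain \<Psi> where \<Psi>: "\<Psi> \<in> ring_hom (root_algebra R n t2) K"
      "\<forall>r\<in>carrier R. \<Psi> (root_algebra_map R n t2 r) = \<phi> r" "\<Psi> (root_gen R n t2) = b" "\<Psi> (h (root_gen R n t1)) = ?f b"
      using ex[OF b] by auto
    have "(\<Phi> \<circ> h) z = (\<Psi> \<circ> h) z" if "z \<in> carrier (root_algebra R n t1)" for z
      by (rule A1.root_algebra_hom_unique[OF is_cring ring_hom_trans[OF h_hom \<Phi>(1)] ring_hom_trans[OF h_hom \<Psi>(1)] _ _ that])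
        (use \<Phi> \<Psi> h eq in auto)
    moreover obtain z where "z \<in> carrier (root_algebra R n t1)" "h z = root_gen R n t2"
      using h_bij A2.root_gen_closed unfolding bij_betw_def by (metis imageE)
    ultimately show "a = b" using \<Phi> \<Psi> by fastforce
  qed
  have root_int: "a \<in> val_ge 0" if a: "a \<in> carrier K" "a [^] n = \<phi> t2" for a
  proof -
    have "a \<noteq> \<zero>" using a t2(2) n_pos nat_pow_zero[of n] by auto
    then show ?thesis using v_pow[OF a(1), of n] a t2(4) n_pos by (simp add: val_ge_nonzero zero_le_mult_iff)
  qed
  have dvd: "?f a \<ominus> ?f b \<in> val_ge (v (a \<ominus> b))"
    if a: "a \<in> carrier K" "a [^] n = \<phi> t2" and b: "b \<in> carrier K" "b [^] n = \<phi> t2" for a b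
  proof -
    let ?c = "\<lambda>i. \<phi> (up_ring.coeff (UP R) p i)"
    have c: "?c i \<in> carrier K" for i using int val_ge_closed by blast
    have ab: "a \<ominus> b \<in> val_ge (v (a \<ominus> b))" using a b unfolding val_ge_def by auto
    have "?f a \<ominus> ?f b = (\<Oplus>i\<in>{..deg R p}. ?c i \<otimes> a [^] i) \<ominus> (\<Oplus>i\<in>{..deg R p}. ?c i \<otimes> b [^] i)"
      using p unfolding UnivPoly.eval_def by simp
    also have "\<dots> = (\<Oplus>i\<in>{..deg R p}. ?c i \<otimes> a [^] i) \<oplus> (\<Oplus>i\<in>{..deg R p}. \<ominus> \<one> \<otimes> (?c i \<otimes> b [^] i))"
      using a b c by (subst finsum_rdistr[symmetric]) (auto simp: minus_eq l_minus)
    also have "\<dots> = (\<Oplus>i\<in>{..deg R p}. ?c i \<otimes> a [^] i \<oplus> \<ominus> \<one> \<otimes> (?c i \<otimes> b [^] i))"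
      using a b c by (subst finsum_addf[symmetric]) auto
    also have "\<dots> = (\<Oplus>i\<in>{..deg R p}. ?c i \<otimes> (a [^] i \<ominus> b [^] i))"
      using a b c by (intro finsum_cong') (auto simp: minus_eq r_distr r_minus l_minus)
    also have "\<dots> \<in> val_ge (v (a \<ominus> b))"
      using val_ge_mult[OF int diff_pow_val_ge[OF root_int[OF a] root_int[OF b] ab]]
      by (intro val_ge_finsum) auto
    finally show ?thesis .
  qed
  show ?thesis
    by (rule v_le_of_root_map[of "\<phi> t1" "\<phi> t2" ?f])
      (use f inj dvd t1 t2 ring_hom_closed[OF \<phi>] in auto)
qed

end

section \<open>Twisting by an idempotent\<close>

context cring
begin

lemma idem_cong_mult:
  assumes "e \<in> carrier R" "a \<in> carrier R" "b \<in> carrier R" "c \<in> carrier R" "d \<in> carrier R"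
    and "e \<otimes> a = e \<otimes> b" "e \<otimes> c = e \<otimes> d"
  shows "e \<otimes> (a \<otimes> c) = e \<otimes> (b \<otimes> d)"
proof -
  have "e \<otimes> (a \<otimes> c) = (e \<otimes> a) \<otimes> c" by (rule m_assoc[symmetric]) fact+
  also have "\<dots> = b \<otimes> (e \<otimes> c)" unfolding assms(6) using assms by (simp add: m_ac)
  also have "\<dots> = e \<otimes> (b \<otimes> d)" unfolding assms(7) using assms by (simp add: m_ac)
  finally show ?thesis .
qed

lemma idem_cong_pow:
  assumes "e \<in> carrier R" "a \<in> carrier R" "b \<in> carrier R" "e \<otimes> a = e \<otimes> b"
  shows "e \<otimes> a [^] (i::nat) = e \<otimes> b [^] i"
  using assms by (induction i) (auto intro!: idem_cong_mult)

lemma eq_by_idempotents: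
  assumes "e \<in> carrier R" "f \<in> carrier R" "e \<oplus> f = \<one>" "x \<in> carrier R" "y \<in> carrier R"
    and "e \<otimes> x = e \<otimes> y" "f \<otimes> x = f \<otimes> y"
  shows "x = y"
  using assms by (metis l_distr l_one)

lemma idempotent_combination:
  assumes "e \<in> carrier R" "f \<in> carrier R" "e \<otimes> e = e" "f \<otimes> f = f" "e \<otimes> f = \<zero>"
    and "a \<in> carrier R" "b \<in> carrier R"
  shows "e \<otimes> (e \<otimes> a \<oplus> f \<otimes> b) = e \<otimes> a" "f \<otimes> (e \<otimes> a \<oplus> f \<otimes> b) = f \<otimes> b"
proof -
  have "e \<otimes> (e \<otimes> a \<oplus> f \<otimes> b) = (e \<otimes> e) \<otimes> a \<oplus> (e \<otimes> f) \<otimes> b"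
    using assms(1,2,6,7) by algebra
  then show "e \<otimes> (e \<otimes> a \<oplus> f \<otimes> b) = e \<otimes> a" using assms by simp
  have "f \<otimes> (e \<otimes> a \<oplus> f \<otimes> b) = (e \<otimes> f) \<otimes> a \<oplus> (f \<otimes> f) \<otimes> b"
    using assms(1,2,6,7) by algebra
  then show "f \<otimes> (e \<otimes> a \<oplus> f \<otimes> b) = f \<otimes> b" using assms by simp
qed

lemma twisted_root_pow:
  fixes n k :: nat
  assumes ef: "e \<in> carrier R" "f \<in> carrier R" "e \<otimes> e = e" "f \<otimes> f = f" "e \<otimes> f = \<zero>" "e \<oplus> f = \<one>"
    and c: "a \<in> carrier R" "\<tau> \<in> carrier R" "T' \<in> carrier R"
    and eT: "e \<otimes> (a [^] n \<otimes> (\<tau> [^] n) [^] k) = e \<otimes> T'" and fT: "f \<otimes> \<tau> [^] n = f \<otimes> T'"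
  shows "(e \<otimes> (a \<otimes> \<tau> [^] k) \<oplus> f \<otimes> \<tau>) [^] n = T'"
proof (rule eq_by_idempotents[OF ef(1,2,6)])
  let ?x = "e \<otimes> (a \<otimes> \<tau> [^] k) \<oplus> f \<otimes> \<tau>"
  have ex: "e \<otimes> ?x = e \<otimes> (a \<otimes> \<tau> [^] k)" and fx: "f \<otimes> ?x = f \<otimes> \<tau>"
    using idempotent_combination[OF ef(1-5)] c by simp_all
  have "e \<otimes> ?x [^] n = e \<otimes> (a \<otimes> \<tau> [^] k) [^] n" using ex ef c by (intro idem_cong_pow) auto
  also have "\<dots> = e \<otimes> T'" using c by (simp add: nat_pow_distrib nat_pow_pow mult.commute flip: eT)
  finally show "e \<otimes> ?x [^] n = e \<otimes> T'" .
  have "f \<otimes> ?x [^] n = f \<otimes> \<tau> [^] n" using fx ef c by (intro idem_cong_pow) auto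
  then show "f \<otimes> ?x [^] n = f \<otimes> T'" using fT by simp
qed (use ef c in auto)

lemma twisted_root_inverse:
  fixes n k k' m :: nat
  assumes ef: "e \<in> carrier R" "f \<in> carrier R" "e \<otimes> e = e" "f \<otimes> f = f" "e \<otimes> f = \<zero>" "e \<oplus> f = \<one>"
    and c: "a \<in> carrier R" "b \<in> carrier R" "\<tau> \<in> carrier R"
    and kk: "k * k' = 1 + n * m"
    and eab: "e \<otimes> (b \<otimes> a [^] k' \<otimes> (\<tau> [^] n) [^] m) = e"
    and x: "x = e \<otimes> (a \<otimes> \<tau> [^] k) \<oplus> f \<otimes> \<tau>"
  shows "e \<otimes> (b \<otimes> x [^] k') \<oplus> f \<otimes> x = \<tau>"
proof (rule eq_by_idempotents[OF ef(1,2,6)])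
  have xc: "x \<in> carrier R" using ef c x by simp
  have ex: "e \<otimes> x = e \<otimes> (a \<otimes> \<tau> [^] k)" and fx: "f \<otimes> x = f \<otimes> \<tau>"
    unfolding x using idempotent_combination[OF ef(1-5)] c by simp_all
  have comb: "e \<otimes> (e \<otimes> (b \<otimes> x [^] k') \<oplus> f \<otimes> x) = e \<otimes> (b \<otimes> x [^] k')"
    "f \<otimes> (e \<otimes> (b \<otimes> x [^] k') \<oplus> f \<otimes> x) = f \<otimes> x"
    using idempotent_combination[OF ef(1-5)] c xc by simp_all
  have "e \<otimes> x [^] k' = e \<otimes> (a \<otimes> \<tau> [^] k) [^] k'"
    using ex ef c xc by (intro idem_cong_pow) auto
  then have "e \<otimes> (b \<otimes> x [^] k') = e \<otimes> (b \<otimes> (a \<otimes> \<tau> [^] k) [^] k')"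
    using ef c xc by (intro idem_cong_mult) auto
  also have "(a \<otimes> \<tau> [^] k) [^] k' = a [^] k' \<otimes> (\<tau> [^] (n * m) \<otimes> \<tau>)"
  proof -
    have "(a \<otimes> \<tau> [^] k) [^] k' = a [^] k' \<otimes> \<tau> [^] (k * k')" using c by (simp add: nat_pow_distrib nat_pow_pow)
    also have "\<tau> [^] (k * k') = \<tau> [^] Suc (n * m)" by (simp only: kk plus_1_eq_Suc)
    finally show ?thesis by (simp only: nat_pow_Suc)
  qed
  also have "e \<otimes> (b \<otimes> (a [^] k' \<otimes> (\<tau> [^] (n * m) \<otimes> \<tau>))) = (e \<otimes> (b \<otimes> a [^] k' \<otimes> (\<tau> [^] n) [^] m)) \<otimes> \<tau>"
    using ef c by (simp add: nat_pow_pow m_assoc)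
  also have "\<dots> = e \<otimes> \<tau>" by (simp only: eab)
  finally show "e \<otimes> (e \<otimes> (b \<otimes> x [^] k') \<oplus> f \<otimes> x) = e \<otimes> \<tau>" using comb by simp
  show "f \<otimes> (e \<otimes> (b \<otimes> x [^] k') \<oplus> f \<otimes> x) = f \<otimes> \<tau>" using comb fx by simp
qed (use ef c x in auto)

lemma root_algebras_isomorphic_twist:
  fixes n k k' m :: nat
  assumes ef: "e \<in> carrier R" "f \<in> carrier R" "e \<otimes> e = e" "f \<otimes> f = f" "e \<otimes> f = \<zero>" "e \<oplus> f = \<one>"
    and c: "s \<in> carrier R" "s' \<in> carrier R" "r \<in> carrier R" "t \<in> carrier R" "t' \<in> carrier R"
    and kk: "k * k' = 1 + n * m"
    and es: "e \<otimes> (s \<otimes> s') = e" and er: "e \<otimes> (t \<otimes> r) [^] m = e"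
    and et: "e \<otimes> t' = e \<otimes> (s [^] n \<otimes> t [^] k)" and ft: "f \<otimes> t' = f \<otimes> t"
  shows "algebra_isomorphic R (root_algebra R n t') (root_algebra_map R n t')
    (root_algebra R n t) (root_algebra_map R n t)"
proof -
  define w where "w = s' [^] k' \<otimes> r [^] m"
  have w: "w \<in> carrier R" using c by (simp add: w_def)
  have ss: "e \<otimes> (s \<otimes> s') [^] (i::nat) = e" for i
    using idem_cong_pow[of e "s \<otimes> s'" \<one> i] ef c es by simp
  have trk: "e \<otimes> (t \<otimes> r) [^] (k * m) = e"
    using idem_cong_pow[of e "(t \<otimes> r) [^] m" \<one> k] ef c er by (simp add: nat_pow_pow mult.commute)
  have et_pow: "e \<otimes> t' [^] i = e \<otimes> (s [^] n \<otimes> t [^] k) [^] i" for i :: nat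
    using idem_cong_pow[of e t' "s [^] n \<otimes> t [^] k" i] ef c et by simp
  have eB: "e \<otimes> (w \<otimes> s [^] k' \<otimes> t [^] m) = e"
  proof -
    have "w \<otimes> s [^] k' \<otimes> t [^] m = (s \<otimes> s') [^] k' \<otimes> (t \<otimes> r) [^] m"
      using c by (simp add: w_def nat_pow_distrib m_ac)
    also have "e \<otimes> \<dots> = e \<otimes> (\<one> \<otimes> \<one>)"
      by (rule idem_cong_mult) (use ss er ef c in auto)
    finally show ?thesis using ef by simp
  qed
  have eC: "e \<otimes> (s \<otimes> w [^] k \<otimes> t' [^] m) = e"
  proof -
    have "e \<otimes> (s \<otimes> w [^] k \<otimes> t' [^] m) = e \<otimes> (s \<otimes> w [^] k \<otimes> (s [^] n \<otimes> t [^] k) [^] m)"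
      by (rule idem_cong_mult) (use et_pow ef c w in auto)
    also have "s \<otimes> w [^] k \<otimes> (s [^] n \<otimes> t [^] k) [^] m = (s \<otimes> s') [^] (k * k') \<otimes> (t \<otimes> r) [^] (k * m)"
    proof -
      have "s \<otimes> w [^] k \<otimes> (s [^] n \<otimes> t [^] k) [^] m =
          (s \<otimes> s [^] (n * m)) \<otimes> s' [^] (k' * k) \<otimes> (t [^] (k * m) \<otimes> r [^] (m * k))"
        using c by (simp add: w_def nat_pow_distrib nat_pow_pow m_ac)
      also have "s \<otimes> s [^] (n * m) = s [^] (k * k')"
        unfolding kk using c by (simp add: m_comm)
      finally show ?thesis using c by (simp add: nat_pow_distrib mult.commute m_ac)
    qed
    also have "e \<otimes> \<dots> = e \<otimes> (\<one> \<otimes> \<one>)"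
      by (rule idem_cong_mult) (use ss trk ef c in auto)
    finally show ?thesis using ef by simp
  qed
  have eA: "e \<otimes> (w [^] n \<otimes> t' [^] k') = e \<otimes> t"
  proof -
    have "e \<otimes> (w [^] n \<otimes> t' [^] k') = e \<otimes> (w [^] n \<otimes> (s [^] n \<otimes> t [^] k) [^] k')"
      by (rule idem_cong_mult) (use et_pow ef c w in auto)
    also have "w [^] n \<otimes> (s [^] n \<otimes> t [^] k) [^] k' = (w \<otimes> s [^] k' \<otimes> t [^] m) [^] n \<otimes> t"
    proof -
      have "t [^] (k * k') = t [^] (m * n) \<otimes> t" unfolding kk by (simp add: mult.commute)
      then show ?thesis using c w by (simp add: nat_pow_distrib nat_pow_pow mult.commute[of n] m_ac)
    qed
    also have "e \<otimes> \<dots> = e \<otimes> (\<one> \<otimes> t)"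
    proof (rule idem_cong_mult)
      show "e \<otimes> (w \<otimes> s [^] k' \<otimes> t [^] m) [^] n = e \<otimes> \<one>"
        using idem_cong_pow[of e "w \<otimes> s [^] k' \<otimes> t [^] m" \<one> n] eB ef c w by simp
    qed (use ef c w in auto)
    finally show ?thesis using c by simp
  qed
  interpret A: root_alg R n t by unfold_locales fact
  interpret A': root_alg R n t' by unfold_locales fact
  interpret j: ring_hom_cring R "root_algebra R n t" "root_algebra_map R n t"
    using A.root_algebra_map_hom by unfold_locales
  interpret j': ring_hom_cring R "root_algebra R n t'" "root_algebra_map R n t'"
    using A'.root_algebra_map_hom by unfold_locales
  let ?B = "root_algebra R n t" and ?B' = "root_algebra R n t'"
  let ?j = "root_algebra_map R n t" and ?j' = "root_algebra_map R n t'"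
  let ?\<tau> = "root_gen R n t" and ?\<tau>' = "root_gen R n t'"
  have idem: "?j e \<otimes>\<^bsub>?B\<^esub> ?j e = ?j e" "?j f \<otimes>\<^bsub>?B\<^esub> ?j f = ?j f" "?j e \<otimes>\<^bsub>?B\<^esub> ?j f = \<zero>\<^bsub>?B\<^esub>" "?j e \<oplus>\<^bsub>?B\<^esub> ?j f = \<one>\<^bsub>?B\<^esub>"
    using ef by (simp_all flip: j.hom_mult j.hom_add)
  have idem': "?j' e \<otimes>\<^bsub>?B'\<^esub> ?j' e = ?j' e" "?j' f \<otimes>\<^bsub>?B'\<^esub> ?j' f = ?j' f" "?j' e \<otimes>\<^bsub>?B'\<^esub> ?j' f = \<zero>\<^bsub>?B'\<^esub>" "?j' e \<oplus>\<^bsub>?B'\<^esub> ?j' f = \<one>\<^bsub>?B'\<^esub>"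
    using ef by (simp_all flip: j'.hom_mult j'.hom_add)
  define x where "x = ?j e \<otimes>\<^bsub>?B\<^esub> (?j s \<otimes>\<^bsub>?B\<^esub> ?\<tau> [^]\<^bsub>?B\<^esub> k) \<oplus>\<^bsub>?B\<^esub> ?j f \<otimes>\<^bsub>?B\<^esub> ?\<tau>"
  define y where "y = ?j' e \<otimes>\<^bsub>?B'\<^esub> (?j' w \<otimes>\<^bsub>?B'\<^esub> ?\<tau>' [^]\<^bsub>?B'\<^esub> k') \<oplus>\<^bsub>?B'\<^esub> ?j' f \<otimes>\<^bsub>?B'\<^esub> ?\<tau>'"
  have x: "x \<in> carrier ?B" using ef c by (simp add: x_def)
  have y: "y \<in> carrier ?B'" using ef w by (simp add: y_def)
  have xn: "x [^]\<^bsub>?B\<^esub> n = ?j t'"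
    unfolding x_def
  proof (rule A.B.twisted_root_pow)
    have "?j (e \<otimes> (s [^] n \<otimes> t [^] k)) = ?j (e \<otimes> t')" by (simp only: et)
    then show "?j e \<otimes>\<^bsub>?B\<^esub> (?j s [^]\<^bsub>?B\<^esub> n \<otimes>\<^bsub>?B\<^esub> (?\<tau> [^]\<^bsub>?B\<^esub> n) [^]\<^bsub>?B\<^esub> k) = ?j e \<otimes>\<^bsub>?B\<^esub> ?j t'"
      using ef c by (simp add: A.root_gen_pow)
    have "?j (f \<otimes> t) = ?j (f \<otimes> t')" by (simp only: ft)
    then show "?j f \<otimes>\<^bsub>?B\<^esub> ?\<tau> [^]\<^bsub>?B\<^esub> n = ?j f \<otimes>\<^bsub>?B\<^esub> ?j t'"
      using ef c by (simp add: A.root_gen_pow)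
  qed (use ef c idem in auto)
  have yn: "y [^]\<^bsub>?B'\<^esub> n = ?j' t"
    unfolding y_def
  proof (rule A'.B.twisted_root_pow)
    have "?j' (e \<otimes> (w [^] n \<otimes> t' [^] k')) = ?j' (e \<otimes> t)" by (simp only: eA)
    then show "?j' e \<otimes>\<^bsub>?B'\<^esub> (?j' w [^]\<^bsub>?B'\<^esub> n \<otimes>\<^bsub>?B'\<^esub> (?\<tau>' [^]\<^bsub>?B'\<^esub> n) [^]\<^bsub>?B'\<^esub> k') = ?j' e \<otimes>\<^bsub>?B'\<^esub> ?j' t"
      using ef c w by (simp add: A'.root_gen_pow)
    have "?j' (f \<otimes> t') = ?j' (f \<otimes> t)" by (simp only: ft)
    then show "?j' f \<otimes>\<^bsub>?B'\<^esub> ?\<tau>' [^]\<^bsub>?B'\<^esub> n = ?j' f \<otimes>\<^bsub>?B'\<^esub> ?j' t"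
      using ef c by (simp add: A'.root_gen_pow)
  qed (use ef c w idem' in auto)
  obtain \<Phi> where \<Phi>: "\<Phi> \<in> ring_hom ?B' ?B" "\<And>a. a \<in> carrier R \<Longrightarrow> \<Phi> (?j' a) = ?j a" "\<Phi> ?\<tau>' = x"
    using A'.root_algebra_universal[OF A.cring_root_algebra A.root_algebra_map_hom x xn] by metis
  obtain \<Psi> where \<Psi>: "\<Psi> \<in> ring_hom ?B ?B'" "\<And>a. a \<in> carrier R \<Longrightarrow> \<Psi> (?j a) = ?j' a" "\<Psi> ?\<tau> = y"
    using A.root_algebra_universal[OF A'.cring_root_algebra A'.root_algebra_map_hom y yn] by metis
  interpret \<Phi>: ring_hom_cring ?B' ?B \<Phi> using \<Phi> by unfold_locales
  interpret \<Psi>: ring_hom_cring ?B ?B' \<Psi> using \<Psi> by unfold_locales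
  show ?thesis
  proof (rule root_algebras_isomorphicI[OF is_cring c(5,4) \<Phi>(1,2) \<Psi>(1,2)])
    have "\<Phi> y = ?j e \<otimes>\<^bsub>?B\<^esub> (?j w \<otimes>\<^bsub>?B\<^esub> x [^]\<^bsub>?B\<^esub> k') \<oplus>\<^bsub>?B\<^esub> ?j f \<otimes>\<^bsub>?B\<^esub> x"
      unfolding y_def using ef w \<Phi> by simp
    also have "\<dots> = ?\<tau>"
    proof (rule A.B.twisted_root_inverse[OF _ _ idem _ _ _ kk _ x_def])
      have "?j (e \<otimes> (w \<otimes> s [^] k' \<otimes> t [^] m)) = ?j e" by (simp only: eB)
      then show "?j e \<otimes>\<^bsub>?B\<^esub> (?j w \<otimes>\<^bsub>?B\<^esub> ?j s [^]\<^bsub>?B\<^esub> k' \<otimes>\<^bsub>?B\<^esub> (?\<tau> [^]\<^bsub>?B\<^esub> n) [^]\<^bsub>?B\<^esub> m) = ?j e"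
        using ef c w by (simp add: A.root_gen_pow)
    qed (use ef c w in auto)
    finally show "\<Phi> (\<Psi> ?\<tau>) = ?\<tau>" using \<Psi> by simp
    have "\<Psi> x = ?j' e \<otimes>\<^bsub>?B'\<^esub> (?j' s \<otimes>\<^bsub>?B'\<^esub> y [^]\<^bsub>?B'\<^esub> k) \<oplus>\<^bsub>?B'\<^esub> ?j' f \<otimes>\<^bsub>?B'\<^esub> y"
      unfolding x_def using ef c \<Psi> by simp
    also have "\<dots> = ?\<tau>'"
    proof (rule A'.B.twisted_root_inverse[OF _ _ idem' _ _ _ _ _ y_def])
      show "k' * k = 1 + n * m" using kk by (simp add: mult.commute)
      have "?j' (e \<otimes> (s \<otimes> w [^] k \<otimes> t' [^] m)) = ?j' e" by (simp only: eC)
      then show "?j' e \<otimes>\<^bsub>?B'\<^esub> (?j' s \<otimes>\<^bsub>?B'\<^esub> ?j' w [^]\<^bsub>?B'\<^esub> k \<otimes>\<^bsub>?B'\<^esub> (?\<tau>' [^]\<^bsub>?B'\<^esub> n) [^]\<^bsub>?B'\<^esub> m) = ?j' e"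
        using ef c w by (simp add: A'.root_gen_pow)
    qed (use ef c w in auto)
    finally show "\<Psi> (\<Phi> ?\<tau>') = ?\<tau>'" using \<Phi> by simp
  qed
qed

lemma root_algebras_isomorphic_scale:
  assumes c: "s \<in> carrier R" "s' \<in> carrier R" "t \<in> carrier R" and s: "s \<otimes> s' = \<one>"
  shows "algebra_isomorphic R (root_algebra R n (s [^] n \<otimes> t)) (root_algebra_map R n (s [^] n \<otimes> t))
    (root_algebra R n t) (root_algebra_map R n t)"
  by (rule root_algebras_isomorphic_twist[where e = \<one> and s' = s' and f = \<zero> and r = \<zero> and k = 1 and k' = 1 and m = 0])
    (use c s in auto)

end

lemma coprime_multiplier_mod:
  fixes a b :: int and n :: nat
  assumes n: "n > 0" and gcd: "gcd (int n) a = gcd (int n) b"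
  obtains k k' m :: nat where "k * k' = 1 + n * m" "int n dvd b - int k * a"
proof -
  define d where "d = gcd (int n) a"
  have d: "d > 0" using n by (simp add: d_def)
  obtain n' where n': "int n = d * n'" using d_def by (meson dvdE gcd_dvd1)
  obtain a' where a': "a = d * a'" using d_def by (meson dvdE gcd_dvd2)
  obtain b' where b': "b = d * b'" using d_def gcd by (metis dvdE gcd_dvd2)
  have n'0: "n' > 0" using n' n d by (metis mult.commute of_nat_0_less_iff zero_less_mult_pos)
  have c1: "coprime a' n'" 
    using d gcd_mult_distrib_int[of d n' a'] unfolding n'[symmetric] a'[symmetric] d_def[symmetric]
    by (simp add: coprime_iff_gcd_eq_1 gcd.commute)
  have c2: "coprime b' n'"
    using d gcd_mult_distrib_int[of d n' b'] unfolding n'[symmetric] b'[symmetric] gcd[symmetric] d_def[symmetric]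
    by (simp add: coprime_iff_gcd_eq_1 gcd.commute)
  obtain i l where il: "i * a' + l * n' = 1" using bezout_int[of a' n'] c1 by (auto simp: coprime_iff_gcd_eq_1)
  define k0 where "k0 = nat ((i * b') mod n')"
  have k0: "n' dvd b' - int k0 * a'"
  proof -
    have "n' dvd i * b' - int k0" using n'0 by (simp add: k0_def)
    then have "n' dvd l * b' * n' + (i * b' - int k0) * a'" by (intro dvd_add[OF dvd_triv_right dvd_mult2])
    also have "l * b' * n' + (i * b' - int k0) * a' = (i * a' + l * n') * b' - int k0 * a'" by (simp add: algebra_simps)
    finally show ?thesis by (simp add: il)
  qed
  have c3: "coprime (int k0) n'"
  proof (rule coprimeI)
    fix c assume c: "c dvd int k0" "c dvd n'"
    then have "c dvd (b' - int k0 * a') + int k0 * a'" using k0 by (intro dvd_add dvd_mult2) (auto intro: dvd_trans)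
    then show "is_unit c" using c(2) coprime_common_divisor[OF c2, of c] by simp
  qed
  define N' where "N' = nat n'"
  have N': "n' = int N'" "coprime k0 N'" using n'0 c3 by (auto simp: N'_def simp flip: coprime_int_iff)
  define Q where "Q = {p \<in> prime_factors n. \<not> p dvd k0}"
  define k where "k = k0 + N' * \<Prod>Q"
  have "coprime k n"
  proof (rule ccontr)
    assume "\<not> coprime k n"
    then obtain p where p: "Factorial_Ring.prime p" "p dvd k" "p dvd n"
      by (metis coprime_iff_gcd_eq_1 gcd_dvd1 gcd_dvd2 dvd_trans prime_factor_nat)
    have pf: "p \<in> prime_factors n" using p n by (simp add: in_prime_factors_iff)
    have fin: "finite Q" unfolding Q_def by simp
    show False
    proof (cases "p dvd k0")
      case True
      then have "p dvd N' * \<Prod>Q" using p(2) unfolding k_def by (simp add: dvd_add_right_iff)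
      moreover have "\<not> p dvd N'" using True N'(2) p(1) by (meson coprime_common_divisor not_prime_unit)
      ultimately have "p dvd \<Prod>Q" using p(1) by (simp add: prime_dvd_mult_iff)
      then obtain q where "q \<in> Q" "p dvd q" using prime_dvd_prod_iff[OF fin p(1), of "\<lambda>x. x"] by auto
      then have "p = q" using p(1) unfolding Q_def by (auto simp: in_prime_factors_iff primes_dvd_imp_eq)
      then show False using \<open>q \<in> Q\<close> True unfolding Q_def by simp
    next
      case False
      then have "p \<in> Q" using pf unfolding Q_def by simp
      then have "p dvd \<Prod>Q" using fin dvd_prodI[of Q p "\<lambda>x. x"] by simp
      then have "p dvd k0" using p(2) unfolding k_def by (metis dvd_add_left_iff dvd_mult)
      then show False using False by simp
    qed
  qed
  have "k > 0"
  proof -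
    have "\<Prod>Q \<noteq> 0" unfolding Q_def by (auto simp: prime_gt_0_nat in_prime_factors_iff)
    then show ?thesis using n'0 N'(1) unfolding k_def by auto
  qed
  then obtain k' m where "k * k' = n * m + 1"
    using bezout_nat[of k n] \<open>coprime k n\<close> by (auto simp: coprime_iff_gcd_eq_1)
  moreover have "int n dvd b - int k * a"
  proof -
    have "n' dvd (b' - int k0 * a') - n' * int (\<Prod>Q) * a'" by (rule dvd_diff[OF k0]) simp
    also have "\<dots> = b' - int k * a'" unfolding k_def N'(1) by (simp add: algebra_simps)
    finally have "d * n' dvd d * (b' - int k * a')" by simp
    then show ?thesis unfolding n' a' b' by (simp add: algebra_simps)
  qed
  ultimately show thesis using that[of k k' m] by simp
qed

section \<open>Completion of a local ring with principal maximal ideal\<close>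

locale residue_dvr = "domain" R for R (structure) +
  fixes p :: 'a and \<kappa> :: "'k::alg_closed_field \<Rightarrow> 'a" and n :: nat
  assumes p_closed [simp]: "p \<in> carrier R"
    and p_nonzero: "p \<noteq> \<zero>"
    and max_ideal_p: "max_ideal R = PIdl p"
    and \<kappa>_closed [simp]: "\<kappa> c \<in> carrier R"
    and \<kappa>_add: "\<kappa> (c + d) = \<kappa> c \<oplus> \<kappa> d"
    and \<kappa>_mult: "\<kappa> (c * d) = \<kappa> c \<otimes> \<kappa> d"
    and \<kappa>_one: "\<kappa> 1 = \<one>"
    and residue: "z \<in> carrier R \<Longrightarrow> \<exists>c. z \<ominus> \<kappa> c \<in> PIdl p"
    and n_gt_1: "n > 1"
    and n_char: "of_nat n \<noteq> (0 :: 'k)"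
begin

definition Ip :: "nat \<Rightarrow> 'a set" where
  "Ip i = PIdl (p [^] i)"

lemma mem_Ip: "z \<in> Ip i \<longleftrightarrow> (\<exists>x\<in>carrier R. z = x \<otimes> p [^] i)"
  unfolding Ip_def mem_cgenideal ..

lemma Ip_1: "Ip 1 = PIdl p"
  by (simp add: Ip_def)

abbreviation "cls i a \<equiv> Ip i +> a"
abbreviation "Q i \<equiv> R Quot (Ip i)"

lemma ideal_Ip: "ideal (Ip i) R"
  unfolding Ip_def by (rule cgenideal_ideal) simp

lemma ideal_pow_max_ideal: "ideal_pow R (max_ideal R) i = Ip i"
  by (simp add: max_ideal_p ideal_pow_cgenideal Ip_def)

lemma cring_Q: "cring (Q i)"
  by (rule ideal.quotient_is_cring[OF ideal_Ip is_cring])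

lemma cls_hom: "(\<lambda>a. cls i a) \<in> ring_hom R (Q i)"
  by (rule ideal.rcos_ring_hom[OF ideal_Ip])

lemma cls_mult: "a \<in> carrier R \<Longrightarrow> b \<in> carrier R \<Longrightarrow> cls i a \<otimes>\<^bsub>Q i\<^esub> cls i b = cls i (a \<otimes> b)"
  using ring_hom_mult[OF cls_hom] by simp

lemma cls_add: "a \<in> carrier R \<Longrightarrow> b \<in> carrier R \<Longrightarrow> cls i a \<oplus>\<^bsub>Q i\<^esub> cls i b = cls i (a \<oplus> b)"
  using ring_hom_add[OF cls_hom] by simp

lemma cls_one: "\<one>\<^bsub>Q i\<^esub> = cls i \<one>"
  using ring_hom_one[OF cls_hom] by simp

lemma cls_zero: "\<zero>\<^bsub>Q i\<^esub> = cls i \<zero>"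
  using ring_hom_zero[OF cls_hom ring_axioms cring.axioms(1)[OF cring_Q]] by simp

lemma cls_eq_iff: "a \<in> carrier R \<Longrightarrow> b \<in> carrier R \<Longrightarrow> cls i a = cls i b \<longleftrightarrow> a \<ominus> b \<in> Ip i"
  using quotient_eq_iff_same_a_r_cos[OF ideal_Ip] by simp

lemma cls_zero_iff: "a \<in> carrier R \<Longrightarrow> cls i a = cls i \<zero> \<longleftrightarrow> a \<in> Ip i"
  by (simp add: cls_eq_iff minus_eq)

lemma cls_mult_cong:
  "\<lbrakk>a \<in> carrier R; a' \<in> carrier R; b \<in> carrier R; b' \<in> carrier R; cls i a = cls i a'; cls i b = cls i b'\<rbrakk>
    \<Longrightarrow> cls i (a \<otimes> b) = cls i (a' \<otimes> b')"
  by (simp flip: cls_mult)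

lemma cls_add_cong:
  "\<lbrakk>a \<in> carrier R; a' \<in> carrier R; b \<in> carrier R; b' \<in> carrier R; cls i a = cls i a'; cls i b = cls i b'\<rbrakk>
    \<Longrightarrow> cls i (a \<oplus> b) = cls i (a' \<oplus> b')"
  by (simp flip: cls_add)

lemma cls_minus_cong:
  assumes "a \<in> carrier R" "a' \<in> carrier R" "cls i a = cls i a'"
  shows "cls i (\<ominus> a) = cls i (\<ominus> a')"
  using cls_mult_cong[of "\<ominus> \<one>" "\<ominus> \<one>" a a' i] assms by (simp add: l_minus)

lemma Ip_mono: "i \<le> j \<Longrightarrow> Ip j \<subseteq> Ip i"
proof
  fix z assume "i \<le> j" "z \<in> Ip j"
  then obtain x where x: "x \<in> carrier R" "z = x \<otimes> p [^] j" by (auto simp: mem_Ip)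
  have "p [^] j = p [^] (j - i) \<otimes> p [^] i" using \<open>i \<le> j\<close> by (simp add: nat_pow_mult)
  then have "z = (x \<otimes> p [^] (j - i)) \<otimes> p [^] i" using x by (simp add: m_assoc)
  then show "z \<in> Ip i" using x by (auto simp: mem_Ip)
qed

lemma cls_mono: "\<lbrakk>i \<le> j; a \<in> carrier R; b \<in> carrier R; cls j a = cls j b\<rbrakk> \<Longrightarrow> cls i a = cls i b"
  using Ip_mono by (auto simp: cls_eq_iff)

lemma Ip_0: "Ip 0 = carrier R"
  using cgenideal_one by (simp add: Ip_def)

lemma cls_0: "a \<in> carrier R \<Longrightarrow> b \<in> carrier R \<Longrightarrow> cls 0 a = cls 0 b"
  using Ip_0 cls_eq_iff minus_closed by metis

lemma mem_Ip_Suc: "a \<in> carrier R \<Longrightarrow> p \<otimes> a \<in> Ip (Suc i) \<longleftrightarrow> a \<in> Ip i"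
proof
  assume a: "a \<in> carrier R" and "p \<otimes> a \<in> Ip (Suc i)"
  then obtain x where x: "x \<in> carrier R" "p \<otimes> a = x \<otimes> p [^] Suc i" by (auto simp: mem_Ip)
  then have "p \<otimes> a = p \<otimes> (x \<otimes> p [^] i)" by (simp add: m_ac)
  then show "a \<in> Ip i" using a x p_nonzero by (subst (asm) m_lcancel) (auto simp: mem_Ip)
next
  assume "a \<in> carrier R" "a \<in> Ip i"
  then obtain x where x: "x \<in> carrier R" "a = x \<otimes> p [^] i" by (auto simp: mem_Ip)
  then have "p \<otimes> a = x \<otimes> p [^] Suc i" by (simp add: m_ac)
  then show "p \<otimes> a \<in> Ip (Suc i)" using x unfolding mem_Ip by blast
qed

lemma cls_Suc_p_mult: "a \<in> carrier R \<Longrightarrow> b \<in> carrier R \<Longrightarrow> cls (Suc i) (p \<otimes> a) = cls (Suc i) (p \<otimes> b) \<longleftrightarrow> cls i a = cls i b"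
  using mem_Ip_Suc[of "a \<ominus> b" i] by (simp add: cls_eq_iff minus_eq r_distr r_minus)

lemma unit_iff: "a \<in> carrier R \<Longrightarrow> a \<in> Units R \<longleftrightarrow> a \<notin> Ip 1"
  using max_ideal_p unfolding max_ideal_def Ip_1 by auto

lemma p_in_Ip: "p \<in> Ip 1"
  unfolding Ip_1 by (simp add: cgenideal_self)

lemma one_notin: "\<one> \<notin> Ip 1"
  using unit_iff[of \<one>] by simp

lemma \<kappa>_zero: "\<kappa> 0 = \<zero>"
  using \<kappa>_add[of 0 0] by (metis \<kappa>_closed add.l_cancel_one' add_0)

lemma \<kappa>_unit: "c \<noteq> 0 \<Longrightarrow> \<kappa> c \<in> Units R"
  using \<kappa>_mult[of c "inverse c"] \<kappa>_mult[of "inverse c" c] \<kappa>_one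
  unfolding Units_def by (auto intro!: bexI[of _ "\<kappa> (inverse c)"])

lemma \<kappa>_minus: "\<kappa> (- c) = \<ominus> \<kappa> c"
  using \<kappa>_add[of "- c" c] \<kappa>_zero by (simp add: minus_equality)

lemma \<kappa>_pow: "\<kappa> (c ^ i) = \<kappa> c [^] i"
  by (induction i) (auto simp: \<kappa>_one \<kappa>_mult m_comm)

lemma \<kappa>_of_nat: "\<kappa> (of_nat i) = [i] \<cdot> \<one>"
  by (induction i) (auto simp: \<kappa>_zero \<kappa>_add \<kappa>_one add.nat_pow_Suc a_comm)

abbreviation "Ah \<equiv> completion R"

definition coherent :: "(nat \<Rightarrow> 'a) \<Rightarrow> bool" where
  "coherent r \<longleftrightarrow> (\<forall>i. r i \<in> carrier R \<and> cls i (r (Suc i)) = cls i (r i))"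

definition lim_of :: "(nat \<Rightarrow> 'a) \<Rightarrow> nat \<Rightarrow> 'a set" where
  "lim_of r = (\<lambda>i. cls i (r i))"

lemma coherentD [simp]: "coherent r \<Longrightarrow> r i \<in> carrier R"
  unfolding coherent_def by auto

lemma coherent_step: "coherent r \<Longrightarrow> cls i (r (Suc i)) = cls i (r i)"
  unfolding coherent_def by auto

lemma coherent_le: "coherent r \<Longrightarrow> i \<le> j \<Longrightarrow> cls i (r j) = cls i (r i)"
proof (induction j)
  case (Suc j)
  show ?case
  proof (cases "i = Suc j")
    case False
    then have "i \<le> j" using Suc by simp
    then show ?thesis using Suc cls_mono[of i j "r (Suc j)" "r j"] coherent_step[of r j] by simp
  qed simp
qed simp

lemma cls_subset_iff: "a \<in> carrier R \<Longrightarrow> b \<in> carrier R \<Longrightarrow> cls (Suc i) a \<subseteq> cls i b \<longleftrightarrow> cls i a = cls i b"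
proof
  assume ab: "a \<in> carrier R" "b \<in> carrier R"
  interpret ideal "Ip i" R by (rule ideal_Ip)
  interpret S: ideal "Ip (Suc i)" R by (rule ideal_Ip)
  {
    assume "cls (Suc i) a \<subseteq> cls i b"
    then have "a \<in> cls i b" using S.a_rcos_self ab by auto
    then show "cls i a = cls i b" using a_repr_independence' ab by auto
  next
    assume "cls i a = cls i b"
    moreover have "cls (Suc i) a \<subseteq> cls i a"
      using Ip_mono[of i "Suc i"] unfolding a_r_coset_def' by auto
    ultimately show "cls (Suc i) a \<subseteq> cls i b" by simp
  }
qed

lemma carrier_completion: "carrier Ah = {lim_of r | r. coherent r}"
proof (intro equalityI subsetI)
  fix a assume "a \<in> carrier Ah"
  then have a: "a i \<in> carrier (Q i)" "a (Suc i) \<subseteq> a i" for i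
    unfolding completion_def adic_completion_def by (auto simp: ideal_pow_max_ideal)
  then have "\<forall>i. \<exists>x\<in>carrier R. a i = cls i x"
    unfolding FactRing_def A_RCOSETS_def' by auto
  then obtain r where r: "\<And>i. r i \<in> carrier R" "\<And>i. a i = cls i (r i)" by metis
  then have "coherent r" using a(2) cls_subset_iff unfolding coherent_def by auto
  moreover have "a = lim_of r" using r unfolding lim_of_def by auto
  ultimately show "a \<in> {lim_of r | r. coherent r}" by auto
next
  fix a assume "a \<in> {lim_of r | r. coherent r}"
  then obtain r where r: "coherent r" "a = lim_of r" by auto
  have "cls i (r i) \<in> carrier (Q i)" for i
    using ring_hom_closed[OF cls_hom] r by auto
  then show "a \<in> carrier Ah"
    using r cls_subset_iff coherent_step unfolding completion_def adic_completion_def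
    by (auto simp: ideal_pow_max_ideal lim_of_def)
qed

lemma completionE:
  assumes "a \<in> carrier Ah" obtains r where "coherent r" "a = lim_of r"
  using assms carrier_completion by auto

lemma lim_of_closed: "coherent r \<Longrightarrow> lim_of r \<in> carrier Ah"
  using carrier_completion by auto

lemma coherent_mult: "coherent r \<Longrightarrow> coherent s \<Longrightarrow> coherent (\<lambda>i. r i \<otimes> s i)"
  unfolding coherent_def using cls_mult_cong by simp

lemma coherent_add: "coherent r \<Longrightarrow> coherent s \<Longrightarrow> coherent (\<lambda>i. r i \<oplus> s i)"
  unfolding coherent_def using cls_add_cong by simp

lemma coherent_minus: "coherent r \<Longrightarrow> coherent (\<lambda>i. \<ominus> r i)"
  unfolding coherent_def using cls_minus_cong by simp

lemma coherent_const: "a \<in> carrier R \<Longrightarrow> coherent (\<lambda>i. a)"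
  unfolding coherent_def by auto

lemma lim_mult: "coherent r \<Longrightarrow> coherent s \<Longrightarrow> lim_of r \<otimes>\<^bsub>Ah\<^esub> lim_of s = lim_of (\<lambda>i. r i \<otimes> s i)"
  unfolding completion_def adic_completion_def lim_of_def by (simp add: ideal_pow_max_ideal cls_mult)

lemma lim_add: "coherent r \<Longrightarrow> coherent s \<Longrightarrow> lim_of r \<oplus>\<^bsub>Ah\<^esub> lim_of s = lim_of (\<lambda>i. r i \<oplus> s i)"
  unfolding completion_def adic_completion_def lim_of_def by (simp add: ideal_pow_max_ideal cls_add)

lemma lim_one: "\<one>\<^bsub>Ah\<^esub> = lim_of (\<lambda>i. \<one>)"
  unfolding completion_def adic_completion_def lim_of_def by (simp add: ideal_pow_max_ideal cls_one)

lemma lim_zero: "\<zero>\<^bsub>Ah\<^esub> = lim_of (\<lambda>i. \<zero>)"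
  unfolding completion_def adic_completion_def lim_of_def by (simp add: ideal_pow_max_ideal cls_zero)

lemma lim_eq_iff: "lim_of r = lim_of s \<longleftrightarrow> (\<forall>i. cls i (r i) = cls i (s i))"
  unfolding lim_of_def by (auto simp: fun_eq_iff)

lemma cring_completion: "cring Ah"
proof (rule cringI)
  show "abelian_group Ah"
  proof (rule abelian_groupI)
    fix x y assume "x \<in> carrier Ah" "y \<in> carrier Ah"
    then obtain r s where c: "coherent r" "coherent s" and x: "x = lim_of r" "y = lim_of s" by (metis completionE)
    show "x \<oplus>\<^bsub>Ah\<^esub> y \<in> carrier Ah" using c x by (simp add: lim_add coherent_add lim_of_closed)
    show "x \<oplus>\<^bsub>Ah\<^esub> y = y \<oplus>\<^bsub>Ah\<^esub> x" using c x by (simp add: lim_add a_comm)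
  next
    fix x y z assume "x \<in> carrier Ah" "y \<in> carrier Ah" "z \<in> carrier Ah"
    then obtain r s u where c: "coherent r" "coherent s" "coherent u" and x: "x = lim_of r" "y = lim_of s" "z = lim_of u"
      by (metis completionE)
    show "x \<oplus>\<^bsub>Ah\<^esub> y \<oplus>\<^bsub>Ah\<^esub> z = x \<oplus>\<^bsub>Ah\<^esub> (y \<oplus>\<^bsub>Ah\<^esub> z)"
      using c x by (simp add: lim_add coherent_add a_assoc)
  next
    show "\<zero>\<^bsub>Ah\<^esub> \<in> carrier Ah" by (simp add: lim_zero lim_of_closed coherent_const)
  next
    fix x assume "x \<in> carrier Ah"
    then obtain r where c: "coherent r" and x: "x = lim_of r" by (metis completionE)
    show "\<zero>\<^bsub>Ah\<^esub> \<oplus>\<^bsub>Ah\<^esub> x = x" using c x by (simp add: lim_add lim_zero coherent_const)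
    have "lim_of (\<lambda>i. \<ominus> r i) \<oplus>\<^bsub>Ah\<^esub> x = \<zero>\<^bsub>Ah\<^esub>"
      using c x by (simp add: lim_add lim_zero coherent_minus l_neg)
    then show "\<exists>y\<in>carrier Ah. y \<oplus>\<^bsub>Ah\<^esub> x = \<zero>\<^bsub>Ah\<^esub>" using lim_of_closed[OF coherent_minus[OF c]] by auto
  qed
  show "comm_monoid Ah"
  proof (rule comm_monoidI)
    fix x y assume "x \<in> carrier Ah" "y \<in> carrier Ah"
    then obtain r s where c: "coherent r" "coherent s" and x: "x = lim_of r" "y = lim_of s" by (metis completionE)
    show "x \<otimes>\<^bsub>Ah\<^esub> y \<in> carrier Ah" using c x by (simp add: lim_mult coherent_mult lim_of_closed)
    show "x \<otimes>\<^bsub>Ah\<^esub> y = y \<otimes>\<^bsub>Ah\<^esub> x" using c x by (simp add: lim_mult m_comm)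
  next
    fix x y z assume "x \<in> carrier Ah" "y \<in> carrier Ah" "z \<in> carrier Ah"
    then obtain r s u where c: "coherent r" "coherent s" "coherent u" and x: "x = lim_of r" "y = lim_of s" "z = lim_of u"
      by (metis completionE)
    show "x \<otimes>\<^bsub>Ah\<^esub> y \<otimes>\<^bsub>Ah\<^esub> z = x \<otimes>\<^bsub>Ah\<^esub> (y \<otimes>\<^bsub>Ah\<^esub> z)"
      using c x by (simp add: lim_mult coherent_mult m_assoc)
  next
    show "\<one>\<^bsub>Ah\<^esub> \<in> carrier Ah" by (simp add: lim_one lim_of_closed coherent_const)
  next
    fix x assume "x \<in> carrier Ah"
    then obtain r where c: "coherent r" and x: "x = lim_of r" by (metis completionE)
    show "\<one>\<^bsub>Ah\<^esub> \<otimes>\<^bsub>Ah\<^esub> x = x" using c x by (simp add: lim_mult lim_one coherent_const)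
  qed
next
  fix x y z assume "x \<in> carrier Ah" "y \<in> carrier Ah" "z \<in> carrier Ah"
  then obtain r s u where c: "coherent r" "coherent s" "coherent u" and x: "x = lim_of r" "y = lim_of s" "z = lim_of u"
    by (metis completionE)
  show "(x \<oplus>\<^bsub>Ah\<^esub> y) \<otimes>\<^bsub>Ah\<^esub> z = x \<otimes>\<^bsub>Ah\<^esub> z \<oplus>\<^bsub>Ah\<^esub> y \<otimes>\<^bsub>Ah\<^esub> z"
    using c x by (simp add: lim_add lim_mult coherent_add coherent_mult l_distr)
qed

sublocale Ah: cring "completion R" by (rule cring_completion)

lemma coherent_pow: "coherent r \<Longrightarrow> coherent (\<lambda>i. r i [^] (k::nat))"
  by (induction k) (auto intro: coherent_const coherent_mult)

lemma lim_pow: "coherent r \<Longrightarrow> lim_of r [^]\<^bsub>Ah\<^esub> (k::nat) = lim_of (\<lambda>i. r i [^] k)"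
  by (induction k) (auto simp: lim_one lim_mult coherent_pow)

lemma lim_unit_iff:
  assumes r: "coherent r"
  shows "lim_of r \<in> Units Ah \<longleftrightarrow> r 1 \<notin> Ip 1"
proof
  assume "lim_of r \<in> Units Ah"
  then obtain b where "b \<in> carrier Ah" "lim_of r \<otimes>\<^bsub>Ah\<^esub> b = \<one>\<^bsub>Ah\<^esub>" using Ah.Units_r_inv_ex by auto
  moreover from this(1) obtain s where "coherent s" "b = lim_of s" by (rule completionE)
  ultimately have s: "coherent s" "lim_of (\<lambda>i. r i \<otimes> s i) = lim_of (\<lambda>i. \<one>)"
    using r by (simp_all add: lim_mult lim_one)
  then have eq: "cls 1 (r 1 \<otimes> s 1) = cls 1 \<one>" by (auto simp: lim_eq_iff)
  show "r 1 \<notin> Ip 1"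
  proof
    assume "r 1 \<in> Ip 1"
    then have "r 1 \<otimes> s 1 \<in> Ip 1" by (rule ideal.I_r_closed[OF ideal_Ip]) (rule coherentD[OF s(1)])
    then have "cls 1 \<one> = cls 1 \<zero>" using eq cls_zero_iff[of "r 1 \<otimes> s 1" 1] r s by simp
    then show False using one_notin cls_zero_iff[of \<one> 1] by simp
  qed
next
  assume r1: "r 1 \<notin> Ip 1"
  have unit: "r (Suc i) \<in> Units R" for i
    using coherent_le[OF r, of 1 "Suc i"] r1 r cls_zero_iff[of "r 1" 1] cls_zero_iff[of "r (Suc i)" 1]
    by (simp add: unit_iff)
  define s where "s i = (case i of 0 \<Rightarrow> \<one> | Suc j \<Rightarrow> inv r (Suc j))" for i
  have s_closed: "s i \<in> carrier R" for i unfolding s_def using unit by (auto split: nat.split)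
  have "cls i (s (Suc i)) = cls i (s i)" for i
  proof (cases i)
    case 0 then show ?thesis using cls_0 s_closed by simp
  next
    case (Suc j)
    let ?a = "r (Suc i)" and ?b = "r i"
    have u: "?a \<in> Units R" "?b \<in> Units R" using unit Suc by auto
    have "cls i (inv ?a \<otimes> (?b \<otimes> inv ?b)) = cls i (inv ?a \<otimes> (?a \<otimes> inv ?b))"
      by (intro cls_mult_cong coherent_step[OF r, symmetric] refl) (use u r in auto)
    also have "inv ?a \<otimes> (?a \<otimes> inv ?b) = inv ?b" using u r by (simp add: m_assoc[symmetric])
    finally have "cls i (inv ?a) = cls i (inv ?b)" using u by simp
    then show ?thesis unfolding s_def using Suc by simp
  qed
  then have s: "coherent s" using s_closed unfolding coherent_def by simp
  have "cls i (r i \<otimes> s i) = cls i \<one>" for i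
  proof (cases i)
    case 0 then show ?thesis using cls_0 s r by simp
  next
    case (Suc j) then show ?thesis using unit by (simp add: s_def)
  qed
  then have "lim_of r \<otimes>\<^bsub>Ah\<^esub> lim_of s = \<one>\<^bsub>Ah\<^esub>" using r s by (simp add: lim_mult lim_one lim_eq_iff)
  then show "lim_of r \<in> Units Ah"
    using lim_of_closed[OF r] lim_of_closed[OF s] Ah.m_comm unfolding Units_def by fastforce
qed

abbreviation "ph \<equiv> lim_of (\<lambda>i. p)"

lemma ph_closed: "ph \<in> carrier Ah"
  by (simp add: lim_of_closed coherent_const)

lemma lim_divide:
  assumes r: "coherent r" and r1: "r 1 \<in> Ip 1"
  obtains s where "coherent s" "lim_of r = ph \<otimes>\<^bsub>Ah\<^esub> lim_of s" "\<And>i. r (Suc i) = p \<otimes> s i"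
proof -
  have "r (Suc i) \<in> Ip 1" for i
    using coherent_le[OF r, of 1 "Suc i"] r1 r cls_zero_iff[of "r 1" 1] cls_zero_iff[of "r (Suc i)" 1] by simp
  then have "\<forall>i. \<exists>x\<in>carrier R. r (Suc i) = p \<otimes> x" by (simp add: mem_Ip) (metis m_comm p_closed)
  then obtain s where s: "\<And>i. s i \<in> carrier R" "\<And>i. r (Suc i) = p \<otimes> s i" by metis
  have "cls i (s (Suc i)) = cls i (s i)" for i
    using coherent_step[OF r, of "Suc i"] s by (simp add: cls_Suc_p_mult)
  then have c: "coherent s" using s unfolding coherent_def by simp
  have "lim_of r = ph \<otimes>\<^bsub>Ah\<^esub> lim_of s"
    using coherent_step[OF r] s c by (simp add: lim_mult coherent_const lim_eq_iff)
  then show thesis using that c s by blast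
qed

lemma lim_zero_iff: "coherent r \<Longrightarrow> lim_of r = \<zero>\<^bsub>Ah\<^esub> \<longleftrightarrow> (\<forall>i. r i \<in> Ip i)"
  by (auto simp: lim_zero lim_eq_iff cls_zero_iff)

lemma completion_factorization:
  assumes "coherent r" "r i \<notin> Ip i"
  shows "\<exists>u\<in>Units Ah. \<exists>k::nat. lim_of r = u \<otimes>\<^bsub>Ah\<^esub> ph [^]\<^bsub>Ah\<^esub> k"
  using assms
proof (induction i arbitrary: r)
  case 0
  then show ?case using Ip_0 by simp
next
  case (Suc i)
  show ?case
  proof (cases "r 1 \<in> Ip 1")
    case False
    then have "lim_of r \<in> Units Ah" using lim_unit_iff Suc by simp
    then show ?thesis by (intro bexI[of _ "lim_of r"] exI[of _ 0]) auto
  next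
    case True
    then obtain s where s: "coherent s" "lim_of r = ph \<otimes>\<^bsub>Ah\<^esub> lim_of s" "\<And>i. r (Suc i) = p \<otimes> s i"
      using lim_divide Suc by metis
    then have "s i \<notin> Ip i" using Suc(3) by (simp add: mem_Ip_Suc)
    then obtain u k where u: "u \<in> Units Ah" "lim_of s = u \<otimes>\<^bsub>Ah\<^esub> ph [^]\<^bsub>Ah\<^esub> (k::nat)"
      using Suc.IH s by blast
    then have "lim_of r = u \<otimes>\<^bsub>Ah\<^esub> ph [^]\<^bsub>Ah\<^esub> Suc k"
      using s ph_closed by (simp add: Ah.m_ac Ah.Units_closed)
    then show ?thesis using u by blast
  qed
qed

lemma ph_cancel:
  assumes b: "b \<in> carrier Ah" and eq: "ph \<otimes>\<^bsub>Ah\<^esub> b = \<zero>\<^bsub>Ah\<^esub>"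
  shows "b = \<zero>\<^bsub>Ah\<^esub>"
proof -
  obtain s where s: "coherent s" "b = lim_of s" using b by (rule completionE)
  have "p \<otimes> s (Suc i) \<in> Ip (Suc i)" for i
    using eq s lim_zero_iff[of "\<lambda>i. p \<otimes> s i"] by (simp add: lim_mult coherent_const coherent_mult)
  then have "s (Suc i) \<in> Ip i" for i using s by (simp add: mem_Ip_Suc)
  then have "s i \<in> Ip i" for i
    using coherent_step[OF s(1), of i] s cls_zero_iff[of "s i" i] cls_zero_iff[of "s (Suc i)" i] by simp
  then show ?thesis using s by (simp add: lim_zero_iff)
qed

lemma ph_pow_cancel:
  "b \<in> carrier Ah \<Longrightarrow> ph [^]\<^bsub>Ah\<^esub> (k::nat) \<otimes>\<^bsub>Ah\<^esub> b = \<zero>\<^bsub>Ah\<^esub> \<Longrightarrow> b = \<zero>\<^bsub>Ah\<^esub>"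
proof (induction k)
  case (Suc k)
  have "ph \<otimes>\<^bsub>Ah\<^esub> (ph [^]\<^bsub>Ah\<^esub> k \<otimes>\<^bsub>Ah\<^esub> b) = \<zero>\<^bsub>Ah\<^esub>"
    using Suc.prems(2) Ah.m_assoc[OF Ah.nat_pow_closed[OF ph_closed] ph_closed Suc.prems(1), of k]
      Ah.m_lcomm[OF Ah.nat_pow_closed[OF ph_closed] ph_closed Suc.prems(1), of k]
    unfolding Ah.nat_pow_Suc by metis
  then have "ph [^]\<^bsub>Ah\<^esub> k \<otimes>\<^bsub>Ah\<^esub> b = \<zero>\<^bsub>Ah\<^esub>"
    by (rule ph_cancel[rotated]) (use Suc.prems(1) ph_closed in simp)
  then show ?case using Suc.IH Suc.prems(1) by blast
qed simp

lemma one_neq_zero: "\<one>\<^bsub>Ah\<^esub> \<noteq> \<zero>\<^bsub>Ah\<^esub>"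
proof
  assume "\<one>\<^bsub>Ah\<^esub> = \<zero>\<^bsub>Ah\<^esub>"
  then have "\<forall>i. \<one> \<in> Ip i" using lim_zero_iff[of "\<lambda>i. \<one>"] by (simp add: lim_one coherent_const)
  then show False using one_notin by blast
qed

lemma factorization_Ah:
  assumes "a \<in> carrier Ah" "a \<noteq> \<zero>\<^bsub>Ah\<^esub>"
  shows "\<exists>u\<in>Units Ah. \<exists>k::nat. a = u \<otimes>\<^bsub>Ah\<^esub> ph [^]\<^bsub>Ah\<^esub> k"
  using assms completion_factorization lim_zero_iff by (metis completionE)

lemma domain_completion: "domain Ah"
proof (rule domainI[OF cring_completion one_neq_zero])
  fix a b assume eq: "a \<otimes>\<^bsub>Ah\<^esub> b = \<zero>\<^bsub>Ah\<^esub>" and ab: "a \<in> carrier Ah" "b \<in> carrier Ah"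
  show "a = \<zero>\<^bsub>Ah\<^esub> \<or> b = \<zero>\<^bsub>Ah\<^esub>"
  proof (rule disjCI)
    assume "b \<noteq> \<zero>\<^bsub>Ah\<^esub>"
    then obtain u k where u: "u \<in> Units Ah" "b = u \<otimes>\<^bsub>Ah\<^esub> ph [^]\<^bsub>Ah\<^esub> (k::nat)"
      using factorization_Ah ab by blast
    have "ph [^]\<^bsub>Ah\<^esub> k \<otimes>\<^bsub>Ah\<^esub> (a \<otimes>\<^bsub>Ah\<^esub> u) = \<zero>\<^bsub>Ah\<^esub>"
      using eq u ab ph_closed by (simp add: Ah.m_ac Ah.Units_closed)
    then have "a \<otimes>\<^bsub>Ah\<^esub> u = \<zero>\<^bsub>Ah\<^esub>" using ph_pow_cancel ab u by (simp add: Ah.Units_closed)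
    then have "a \<otimes>\<^bsub>Ah\<^esub> u \<otimes>\<^bsub>Ah\<^esub> inv\<^bsub>Ah\<^esub> u = \<zero>\<^bsub>Ah\<^esub>" using u by simp
    then show "a = \<zero>\<^bsub>Ah\<^esub>" using u ab by (simp add: Ah.m_assoc Ah.Units_closed)
  qed
qed

lemma dvr_completion: "dvr Ah ph"
proof -
  interpret D: "domain" Ah by (rule domain_completion)
  show ?thesis
  proof
    show "ph \<notin> Units Ah" using lim_unit_iff[of "\<lambda>i. p"] p_in_Ip by (simp add: coherent_const)
    show "ph \<noteq> \<zero>\<^bsub>Ah\<^esub>" using ph_cancel[of "\<one>\<^bsub>Ah\<^esub>"] ph_closed one_neq_zero by auto
  qed (use ph_closed factorization_Ah in auto)
qed

sublocale D: dvr "completion R" "lim_of (\<lambda>i. p)" by (rule dvr_completion)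

lemma pow_add_expansion:
  assumes x: "x \<in> carrier R" and y: "y \<in> carrier R"
  shows "\<exists>z\<in>carrier R. (x \<oplus> y) [^] Suc k = x [^] Suc k \<oplus> [Suc k] \<cdot> \<one> \<otimes> x [^] k \<otimes> y \<oplus> y \<otimes> y \<otimes> z"
proof (induction k)
  case 0
  show ?case using x y by (intro bexI[of _ \<zero>]) auto
next
  case (Suc k)
  then obtain z where z: "z \<in> carrier R"
    and eq: "(x \<oplus> y) [^] Suc k = x [^] Suc k \<oplus> [Suc k] \<cdot> \<one> \<otimes> x [^] k \<otimes> y \<oplus> y \<otimes> y \<otimes> z" by auto
  define a where "a = x [^] k"
  define m where "m = [Suc k] \<cdot> \<one>"
  have am: "a \<in> carrier R" "m \<in> carrier R" using x by (auto simp: a_def m_def)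
  have "(x \<oplus> y) [^] Suc (Suc k) = (a \<otimes> x \<oplus> m \<otimes> a \<otimes> y \<oplus> y \<otimes> y \<otimes> z) \<otimes> (x \<oplus> y)"
    unfolding nat_pow_Suc[of "x \<oplus> y" "Suc k"] eq by (simp add: a_def m_def)
  also have "\<dots> = a \<otimes> x \<otimes> x \<oplus> (m \<oplus> \<one>) \<otimes> (a \<otimes> x) \<otimes> y \<oplus> y \<otimes> y \<otimes> (m \<otimes> a \<oplus> z \<otimes> x \<oplus> z \<otimes> y)"
    using am x y z by algebra
  also have "\<dots> = x [^] Suc (Suc k) \<oplus> [Suc (Suc k)] \<cdot> \<one> \<otimes> x [^] Suc k \<otimes> y \<oplus> y \<otimes> y \<otimes> (m \<otimes> a \<oplus> z \<otimes> x \<oplus> z \<otimes> y)"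
    by (simp add: a_def m_def add.nat_pow_Suc)
  finally show ?case using am x y z by (intro bexI[of _ "m \<otimes> a \<oplus> z \<otimes> x \<oplus> z \<otimes> y"]) auto
qed

lemma n_unit_R: "[n] \<cdot> \<one> \<in> Units R"
  using \<kappa>_unit[OF n_char] by (simp add: \<kappa>_of_nat)

lemma newton_step:
  assumes x: "x \<in> carrier R" and u: "u \<in> carrier R" "u' \<in> carrier R" "u \<in> Units R"
    and i: "i \<ge> 1" and eq: "cls i (x [^] n) = cls i u" and uu: "cls i u' = cls i u"
  shows "\<exists>x'\<in>carrier R. cls i x' = cls i x \<and> cls (Suc i) (x' [^] n) = cls (Suc i) u'"
proof -
  obtain k where k: "n = Suc k" using n_gt_1 by (cases n) auto
  have xn: "x [^] n \<in> Units R"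
  proof -
    have "cls 1 (x [^] n) = cls 1 u" using cls_mono[OF i _ _ eq] x u by simp
    then show ?thesis using u x cls_zero_iff[of "x [^] n" 1] cls_zero_iff[of u 1] by (simp add: unit_iff)
  qed
  then have xk: "x [^] k \<in> Units R" using unit_factor[of "x [^] k" x] x unfolding k by simp
  define b where "b = [n] \<cdot> \<one> \<otimes> x [^] k"
  have b: "b \<in> Units R" using n_unit_R xk by (simp add: b_def)
  define \<delta> where "\<delta> = u' \<ominus> x [^] n"
  have \<delta>: "\<delta> \<in> carrier R" using x u by (simp add: \<delta>_def)
  have "cls i u' = cls i (x [^] n)" using eq uu by simp
  then have \<delta>_in: "\<delta> \<in> Ip i" using x u by (simp add: \<delta>_def cls_eq_iff)
  define y where "y = \<delta> \<otimes> inv b"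
  have y: "y \<in> carrier R" using \<delta> b by (simp add: y_def)
  have y_in: "y \<in> Ip i" using ideal.I_r_closed[OF ideal_Ip \<delta>_in] b by (simp add: y_def)
  obtain z where z: "z \<in> carrier R" "(x \<oplus> y) [^] n = x [^] n \<oplus> [n] \<cdot> \<one> \<otimes> x [^] k \<otimes> y \<oplus> y \<otimes> y \<otimes> z"
    using pow_add_expansion[OF x y, of k] k by auto
  have "b \<otimes> y = \<delta>" using b \<delta> by (simp add: y_def m_lcomm Units_closed)
  then have "x [^] n \<oplus> [n] \<cdot> \<one> \<otimes> x [^] k \<otimes> y = x [^] n \<oplus> \<delta>" by (simp add: b_def)
  also have "\<dots> = u'" using x u nat_pow_closed[OF x, of n] unfolding \<delta>_def by algebra
  finally have eq2: "(x \<oplus> y) [^] n = u' \<oplus> y \<otimes> y \<otimes> z" using z by simp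
  have "y \<otimes> y \<otimes> z \<in> Ip (Suc i)"
  proof -
    obtain w where w: "w \<in> carrier R" "y = w \<otimes> p [^] i" using y_in by (auto simp: mem_Ip)
    obtain j where j: "i = Suc j" using i by (cases i) auto
    have "y \<otimes> y \<otimes> z = (w \<otimes> w \<otimes> z \<otimes> p [^] j) \<otimes> p [^] Suc i"
      unfolding w(2) using w(1) z(1) by (simp add: j m_ac)
    then show ?thesis using w z by (auto simp: mem_Ip simp del: nat_pow_Suc)
  qed
  then have "cls (Suc i) ((x \<oplus> y) [^] n) = cls (Suc i) (u' \<oplus> \<zero>)"
    unfolding eq2 using u y z by (intro cls_add_cong) (auto simp: cls_zero_iff)
  moreover have "cls i (x \<oplus> y) = cls i (x \<oplus> \<zero>)"
    using x y y_in by (intro cls_add_cong) (auto simp: cls_zero_iff)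
  ultimately show ?thesis using x y u by (intro bexI[of _ "x \<oplus> y"]) auto
qed

lemma unit_root:
  assumes "a \<in> Units Ah"
  shows "\<exists>s\<in>carrier Ah. s [^]\<^bsub>Ah\<^esub> n = a"
proof -
  obtain r where r: "coherent r" "a = lim_of r" using assms completionE Ah.Units_closed by metis
  have r1: "r 1 \<notin> Ip 1" using assms r lim_unit_iff by simp
  have unit: "r (Suc i) \<in> Units R" for i
    using coherent_le[OF r(1), of 1 "Suc i"] r1 r cls_zero_iff[of "r 1" 1] cls_zero_iff[of "r (Suc i)" 1]
    by (simp add: unit_iff)
  obtain c where c: "r 1 \<ominus> \<kappa> c \<in> PIdl p" using residue r by (metis coherentD)
  obtain d where d: "d ^ n = c" using nth_root_exists[of n c] n_gt_1 by auto
  have start: "cls 1 (\<kappa> d [^] n) = cls 1 (r 1)"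
    using c r cls_eq_iff[of "r 1" "\<kappa> c" 1] unfolding Ip_1 \<kappa>_pow[symmetric] d by simp
  have "\<exists>Y. \<forall>i. (Y i \<in> carrier R \<and> cls (Suc i) (Y i [^] n) = cls (Suc i) (r (Suc i))) \<and> cls (Suc i) (Y (Suc i)) = cls (Suc i) (Y i)"
  proof (rule dependent_nat_choice)
    show "\<exists>x. x \<in> carrier R \<and> cls (Suc 0) (x [^] n) = cls (Suc 0) (r (Suc 0))"
      using start by (intro exI[of _ "\<kappa> d"]) simp
    fix x i assume "x \<in> carrier R \<and> cls (Suc i) (x [^] n) = cls (Suc i) (r (Suc i))"
    then show "\<exists>y. (y \<in> carrier R \<and> cls (Suc (Suc i)) (y [^] n) = cls (Suc (Suc i)) (r (Suc (Suc i)))) \<and> cls (Suc i) y = cls (Suc i) x"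
      using newton_step[of x "r (Suc i)" "r (Suc (Suc i))" "Suc i"] r unit coherent_step[OF r(1), of "Suc i"]
      by auto
  qed
  then obtain Y where Y: "\<And>i. Y i \<in> carrier R" "\<And>i. cls (Suc i) (Y i [^] n) = cls (Suc i) (r (Suc i))"
    "\<And>i. cls (Suc i) (Y (Suc i)) = cls (Suc i) (Y i)" by blast
  define s where "s i = (case i of 0 \<Rightarrow> \<one> | Suc j \<Rightarrow> Y j)" for i
  have sc: "s i \<in> carrier R" for i using Y by (auto simp: s_def split: nat.split)
  have "cls i (s (Suc i)) = cls i (s i)" for i
    using Y cls_0 by (cases i) (auto simp: s_def)
  then have s: "coherent s" using sc unfolding coherent_def by simp
  have "cls i (s i [^] n) = cls i (r i)" for i
    using Y cls_0 r by (cases i) (auto simp: s_def)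
  then have "lim_of s [^]\<^bsub>Ah\<^esub> n = a" using r s by (simp add: lim_pow lim_eq_iff)
  then show ?thesis using lim_of_closed[OF s] by auto
qed

lemma lim_of_nat:
  fixes k :: nat
  shows "[k] \<cdot>\<^bsub>Ah\<^esub> \<one>\<^bsub>Ah\<^esub> = lim_of (\<lambda>i. [k] \<cdot> \<one>)"
proof (induction k)
  case (Suc k)
  then show ?case by (simp add: lim_one lim_add coherent_const Ah.add.nat_pow_Suc add.nat_pow_Suc)
qed (simp add: lim_zero)

lemma n_unit_Ah: "[n] \<cdot>\<^bsub>Ah\<^esub> \<one>\<^bsub>Ah\<^esub> \<in> Units Ah"
  unfolding lim_of_nat using n_unit_R lim_unit_iff[of "\<lambda>i. [n] \<cdot> \<one>"] unit_iff[of "[n] \<cdot> \<one>"]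
  by (simp add: coherent_const)

lemma nontrivial_unity_root: "\<exists>z::'k. z \<noteq> 1 \<and> z ^ n = 1"
proof -
  obtain k where k: "n = Suc k" "k > 0" using n_gt_1 by (cases n) auto
  obtain z :: 'k where z: "(\<Sum>i\<le>k. 1 * z ^ i) = 0" using alg_closed[of k "\<lambda>_. 1"] k by auto
  then have s: "(\<Sum>i<n. z ^ i) = 0" using k by (simp add: lessThan_Suc_atMost)
  have "z \<noteq> 1" using s n_char by auto
  moreover have "z ^ n = 1" using s power_diff_1_eq[of z n] by simp
  ultimately show ?thesis by blast
qed

lemma unity_root_Ah: "\<exists>z\<in>carrier Ah. z \<noteq> \<one>\<^bsub>Ah\<^esub> \<and> z [^]\<^bsub>Ah\<^esub> n = \<one>\<^bsub>Ah\<^esub>"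
proof -
  obtain z :: 'k where z: "z \<noteq> 1" "z ^ n = 1" using nontrivial_unity_root by auto
  have "\<kappa> z \<ominus> \<one> = \<kappa> (z - 1)" using \<kappa>_add[of z "- 1"] by (simp add: \<kappa>_minus \<kappa>_one minus_eq)
  then have "\<kappa> z \<ominus> \<one> \<notin> Ip 1" using \<kappa>_unit[of "z - 1"] z unit_iff[of "\<kappa> z \<ominus> \<one>"] by simp
  then have "cls 1 (\<kappa> z) \<noteq> cls 1 \<one>" by (simp add: cls_eq_iff)
  then have "lim_of (\<lambda>i. \<kappa> z) \<noteq> \<one>\<^bsub>Ah\<^esub>" unfolding lim_one lim_eq_iff by blast
  moreover have "lim_of (\<lambda>i. \<kappa> z) [^]\<^bsub>Ah\<^esub> n = \<one>\<^bsub>Ah\<^esub>"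
    using z by (simp add: lim_pow coherent_const lim_one \<kappa>_pow[symmetric] \<kappa>_one)
  ultimately show ?thesis using lim_of_closed[OF coherent_const[of "\<kappa> z"]] by auto
qed

end

context dvr
begin

lemma frac_root:
  assumes n: "n > 0" and unit_root: "\<And>u. u \<in> Units A \<Longrightarrow> \<exists>s\<in>carrier A. s [^] (n::nat) = u"
    and z: "z \<in> carrier K" "z \<noteq> \<zero>\<^bsub>K\<^esub>" "int n dvd dvr_val A z"
  shows "\<exists>s\<in>carrier K. s [^]\<^bsub>K\<^esub> n = z"
proof -
  obtain a b where ab: "a \<in> carrier A" "b \<in> carrier A" "a \<noteq> \<zero>" "b \<noteq> \<zero>" "z = F.fr a b"
    and vz: "dvr_val A z = int (dvr_ord A a) - int (dvr_ord A b)"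
    using nonzero_fracE[OF z(1,2)] by metis
  obtain u i where u: "u \<in> Units A" "a = u \<otimes> \<pi> [^] (i::nat)" using factorization ab by blast
  obtain w j where w: "w \<in> Units A" "b = w \<otimes> \<pi> [^] (j::nat)" using factorization ab by blast
  obtain m where m: "int i - int j = int n * m" using z(3) vz u w by (auto simp: dvr_ord_eq)
  obtain k where "m = int k \<or> m = - int k" using int_cases2[of m] by metis
  then obtain x y :: nat where xy: "m = int x - int y" by (metis add_0 diff_0 diff_zero of_nat_0)
  have "int (n * x + j) = int (i + n * y)" using m xy by (simp add: algebra_simps)
  then have exps: "n * x + j = i + n * y" by (simp only: of_nat_eq_iff)
  have uw: "u \<otimes> inv w \<in> Units A" using u w by simp
  obtain s where s: "s \<in> carrier A" "s [^] n = u \<otimes> inv w" using unit_root[OF uw] by auto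
  have pair: "(s \<otimes> \<pi> [^] x, \<pi> [^] y) \<in> all_pairs A" using s pi_pow_nonzero by (simp add: mem_all_pairs)
  have pow: "F.fr c d [^]\<^bsub>K\<^esub> k = F.fr (c [^] k) (d [^] k)" "d [^] k \<noteq> \<zero>"
    if "c \<in> carrier A" "d \<in> carrier A" "d \<noteq> \<zero>" for c d and k :: nat
  proof -
    have nz: "d [^] k \<noteq> \<zero>" for k :: nat using that by (induction k) (auto simp: integral_iff)
    show "F.fr c d [^]\<^bsub>K\<^esub> k = F.fr (c [^] k) (d [^] k)"
    proof (induction k)
      case 0 show ?case by (simp add: frac_field_def F.one_fractions)
    next
      case (Suc k)
      have "F.fr (c [^] k) (d [^] k) \<otimes>\<^bsub>K\<^esub> F.fr c d = F.fr (c [^] k \<otimes> c) (d [^] k \<otimes> d)"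
        unfolding frac_field_def using that nz by (intro F.mult_fr) (auto simp: mem_all_pairs)
      then show ?case using Suc by simp
    qed
    show "d [^] k \<noteq> \<zero>" by (rule nz)
  qed
  let ?q = "F.fr (s \<otimes> \<pi> [^] x) (\<pi> [^] y)"
  have "?q [^]\<^bsub>K\<^esub> n = F.fr ((s \<otimes> \<pi> [^] x) [^] n) ((\<pi> [^] y) [^] n)"
    using s pi_nonzero by (intro pow) simp_all
  also have "\<dots> = F.fr a b"
  proof -
    have p: "(\<pi> [^] y) [^] n \<noteq> \<zero>" using pi_pow_nonzero by (simp add: nat_pow_pow)
    have "(s \<otimes> \<pi> [^] x) [^] n \<otimes> b = (s [^] n \<otimes> w) \<otimes> (\<pi> [^] (n * x) \<otimes> \<pi> [^] j)"
    proof -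
      have rearrange: "\<lbrakk>c \<in> carrier A; d \<in> carrier A; e \<in> carrier A; f \<in> carrier A\<rbrakk>
          \<Longrightarrow> (c \<otimes> d) \<otimes> (e \<otimes> f) = (c \<otimes> e) \<otimes> (d \<otimes> f)" for c d e f
        by (simp add: m_ac)
      have "(s \<otimes> \<pi> [^] x) [^] n = s [^] n \<otimes> \<pi> [^] (n * x)"
        using s(1) nat_pow_distrib[of s "\<pi> [^] x" n] nat_pow_pow[of \<pi> x n] by (simp only: mult.commute[of n] pi_closed nat_pow_closed)
      then show ?thesis
        unfolding w(2) using s(1) w(1) by (simp only:) (intro rearrange, auto)
    qed
    also have "s [^] n \<otimes> w = u" using s(2) u w by (simp add: m_assoc Units_closed)
    also have "\<pi> [^] (n * x) \<otimes> \<pi> [^] j = \<pi> [^] i \<otimes> \<pi> [^] (n * y)" by (simp add: nat_pow_mult exps)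
    also have "u \<otimes> (\<pi> [^] i \<otimes> \<pi> [^] (n * y)) = a \<otimes> (\<pi> [^] y) [^] n"
      unfolding u(2) using u(1) by (simp add: nat_pow_pow m_assoc Units_closed mult.commute)
    finally show ?thesis using s ab p by (simp add: F.fr_eq_iff mem_all_pairs)
  qed
  finally show ?thesis using ab F.fr_closed[OF pair] unfolding frac_field_def by auto
qed

lemma val_field_frac:
  assumes n: "n > 0" and unit_root: "\<And>u. u \<in> Units A \<Longrightarrow> \<exists>s\<in>carrier A. s [^] (n::nat) = u"
    and n_unit: "[n] \<cdot> \<one> \<in> Units A" and zeta: "\<exists>\<zeta>\<in>carrier A. \<zeta> \<noteq> \<one> \<and> \<zeta> [^] n = \<one>"
  shows "val_field K (dvr_val A) n"
proof
  interpret T: ring_hom_cring A K "to_frac A" using to_frac_hom by unfold_locales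
  show "\<exists>p\<in>carrier K. p \<noteq> \<zero>\<^bsub>K\<^esub> \<and> dvr_val A p = 1"
  proof (rule bexI[of _ "to_frac A \<pi>"])
    have "dvr_ord A \<pi> = 1" using dvr_ord_eq[of \<one> 1] by simp
    then show "to_frac A \<pi> \<noteq> \<zero>\<^bsub>K\<^esub> \<and> dvr_val A (to_frac A \<pi>) = 1"
      using pi_nonzero by (simp add: to_frac_zero_iff dvr_val_to_frac)
  qed simp
  have "[k] \<cdot>\<^bsub>K\<^esub> \<one>\<^bsub>K\<^esub> = to_frac A ([k] \<cdot> \<one>)" for k :: nat
    by (induction k) (auto simp: K.add.nat_pow_Suc add.nat_pow_Suc)
  then show "[n] \<cdot>\<^bsub>K\<^esub> \<one>\<^bsub>K\<^esub> \<noteq> \<zero>\<^bsub>K\<^esub>" "dvr_val A ([n] \<cdot>\<^bsub>K\<^esub> \<one>\<^bsub>K\<^esub>) = 0"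
    using n_unit Units_nonzero[OF n_unit] by (simp_all add: to_frac_zero_iff dvr_val_to_frac dvr_ord_unit)
  obtain z where z: "z \<in> carrier A" "z \<noteq> \<one>" "z [^] n = \<one>" using zeta by auto
  then show "\<exists>\<zeta>\<in>carrier K. \<zeta> \<noteq> \<one>\<^bsub>K\<^esub> \<and> \<zeta> [^]\<^bsub>K\<^esub> n = \<one>\<^bsub>K\<^esub>"
    using T.hom_pow[of z n] to_frac_inj[of z \<one>] by (intro bexI[of _ "to_frac A z"]) auto
qed (use n dvr_val_mult dvr_val_add frac_root[OF n unit_root] in auto)

end

context residue_dvr
begin

lemma val_field_completion: "val_field (frac_field Ah) (dvr_val Ah) n"
  using n_gt_1 unit_root n_unit_Ah unity_root_Ah by (intro D.val_field_frac) auto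

lemma integers_eq:
  "to_frac Ah ` carrier Ah = {z \<in> carrier (frac_field Ah). z = \<zero>\<^bsub>frac_field Ah\<^esub> \<or> 0 \<le> dvr_val Ah z}"
  by (rule D.to_frac_image)

end

section \<open>Forms and projective varieties\<close>

definition monom_eval :: "('v::finite \<Rightarrow>\<^sub>0 nat) \<Rightarrow> ('v \<Rightarrow> 'k::comm_ring_1) \<Rightarrow> 'k" where
  "monom_eval m w = (\<Prod>i\<in>UNIV. w i ^ Poly_Mapping.lookup m i)"

lemma monom_eval_add: "monom_eval (m + m') w = monom_eval m w * monom_eval m' w"
  by (simp add: monom_eval_def lookup_add power_add prod.distrib)

lemma mpol_eval_superset:
  assumes "finite A" "Poly_Mapping.keys f \<subseteq> A"
  shows "mpol_eval f w = (\<Sum>m\<in>A. Poly_Mapping.lookup f m * monom_eval m w)"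
  unfolding mpol_eval_def monom_eval_def[symmetric] using assms
  by (intro sum.mono_neutral_left) (auto simp: in_keys_iff)

lemma mpol_eval_add: "mpol_eval (f + g) w = mpol_eval f w + mpol_eval g w"
proof -
  let ?A = "Poly_Mapping.keys f \<union> Poly_Mapping.keys g"
  have "mpol_eval (f + g) w = (\<Sum>m\<in>?A. Poly_Mapping.lookup (f + g) m * monom_eval m w)"
    using keys_add[of f g] by (intro mpol_eval_superset) auto
  then show ?thesis
    by (simp add: lookup_add distrib_right sum.distrib mpol_eval_superset[of ?A f] mpol_eval_superset[of ?A g])
qed

lemma mpol_eval_zero [simp]: "mpol_eval 0 w = 0"
  by (simp add: mpol_eval_def)

lemma mpol_eval_single: "mpol_eval (Poly_Mapping.single m a) w = a * monom_eval m w"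
  using mpol_eval_superset[of "{m}" "Poly_Mapping.single m a" w] by simp

lemma mpol_eval_one [simp]: "mpol_eval 1 w = 1"
  using mpol_eval_single[of 0 1 w] by (simp add: monom_eval_def)

lemma mpol_eval_minus: "mpol_eval (- f) w = - mpol_eval f w"
  using mpol_eval_add[of "- f" f w] by (simp add: eq_neg_iff_add_eq_0)

lemma mpol_eval_diff: "mpol_eval (f - g) w = mpol_eval f w - mpol_eval g w"
  using mpol_eval_add[of f "- g" w] by (simp add: mpol_eval_minus)

lemma mpol_eval_sum: "mpol_eval (sum f A) w = (\<Sum>i\<in>A. mpol_eval (f i) w)"
  by (induction A rule: infinite_finite_induct) (auto simp: mpol_eval_add)

lemma mpol_monomials:
  fixes f :: "('v, 'k::comm_ring_1) mpol"
  shows "f = (\<Sum>m\<in>Poly_Mapping.keys f. Poly_Mapping.single m (Poly_Mapping.lookup f m))"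
proof (rule poly_mapping_eqI)
  fix k
  have "Poly_Mapping.lookup (\<Sum>m\<in>Poly_Mapping.keys f. Poly_Mapping.single m (Poly_Mapping.lookup f m)) k =
      (\<Sum>m\<in>Poly_Mapping.keys f. Poly_Mapping.lookup f m when m = k)"
    by (simp add: lookup_sum lookup_single)
  also have "\<dots> = (\<Sum>m\<in>Poly_Mapping.keys f. if m = k then Poly_Mapping.lookup f m else 0)"
    by (simp add: when_def)
  also have "\<dots> = Poly_Mapping.lookup f k" by (simp add: in_keys_iff)
  finally show "Poly_Mapping.lookup f k = Poly_Mapping.lookup (\<Sum>m\<in>Poly_Mapping.keys f. Poly_Mapping.single m (Poly_Mapping.lookup f m)) k" ..
qed

lemma mpol_eval_mult: "mpol_eval (f * g) w = mpol_eval f w * mpol_eval g w"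
proof -
  let ?s = "\<lambda>h m. Poly_Mapping.single m (Poly_Mapping.lookup h m)"
  have "mpol_eval (f * g) w = mpol_eval (sum (?s f) (Poly_Mapping.keys f) * sum (?s g) (Poly_Mapping.keys g)) w"
    using mpol_monomials[of f] mpol_monomials[of g] by simp
  also have "\<dots> = (\<Sum>m\<in>Poly_Mapping.keys f. \<Sum>m'\<in>Poly_Mapping.keys g. mpol_eval (?s f m) w * mpol_eval (?s g m') w)"
    by (simp add: sum_product mpol_eval_sum mult_single mpol_eval_single monom_eval_add ac_simps)
  also have "\<dots> = mpol_eval (sum (?s f) (Poly_Mapping.keys f)) w * mpol_eval (sum (?s g) (Poly_Mapping.keys g)) w"
    by (simp add: sum_product mpol_eval_sum)
  finally show ?thesis using mpol_monomials[of f] mpol_monomials[of g] by simp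
qed

definition mon_deg :: "('v::finite \<Rightarrow>\<^sub>0 nat) \<Rightarrow> nat" where
  "mon_deg m = (\<Sum>i\<in>UNIV. Poly_Mapping.lookup m i)"

lemma mon_deg_add: "mon_deg (m + m') = mon_deg m + mon_deg m'"
  by (simp add: mon_deg_def lookup_add sum.distrib)

lemma mon_deg_zero [simp]: "mon_deg 0 = 0"
  by (simp add: mon_deg_def)

lemma homogeneous_iff: "homogeneous d f \<longleftrightarrow> (\<forall>m\<in>Poly_Mapping.keys f. mon_deg m = d)"
  unfolding homogeneous_def mon_deg_def ..

lemma homogeneous_zero [simp]: "homogeneous d 0"
  by (simp add: homogeneous_iff)

lemma homogeneous_single: "mon_deg m = d \<Longrightarrow> homogeneous d (Poly_Mapping.single m a)"
  by (simp add: homogeneous_iff)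

lemma homogeneous_const: "homogeneous 0 (Poly_Mapping.single 0 a)"
  by (simp add: homogeneous_single)

lemma homogeneous_one: "homogeneous 0 (1 :: ('v::finite, 'k::comm_ring_1) mpol)"
  using homogeneous_const[of 1] by simp

lemma homogeneous_add: "homogeneous d f \<Longrightarrow> homogeneous d g \<Longrightarrow> homogeneous d (f + g)"
  unfolding homogeneous_iff using keys_add[of f g] by blast

lemma homogeneous_minus: "homogeneous d f \<Longrightarrow> homogeneous d (- f)"
  for f :: "('v::finite, 'k::comm_ring_1) mpol"
proof -
  assume "homogeneous d f"
  moreover have "Poly_Mapping.keys (- f) = Poly_Mapping.keys f"
    by (auto simp: in_keys_iff)
  ultimately show ?thesis unfolding homogeneous_iff by simp
qed

lemma homogeneous_diff: "homogeneous d f \<Longrightarrow> homogeneous d g \<Longrightarrow> homogeneous d (f - g)"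
  for f :: "('v::finite, 'k::comm_ring_1) mpol"
  using homogeneous_add[of d f "- g"] homogeneous_minus[of d g] by simp

lemma homogeneous_sum: "(\<And>i. i \<in> A \<Longrightarrow> homogeneous d (f i)) \<Longrightarrow> homogeneous d (sum f A)"
  by (induction A rule: infinite_finite_induct) (auto intro: homogeneous_add)

lemma homogeneous_mult: "homogeneous d f \<Longrightarrow> homogeneous e g \<Longrightarrow> homogeneous (d + e) (f * g)"
  unfolding homogeneous_iff using keys_mult[of f g] by (fastforce simp: mon_deg_add)

lemma monom_eval_scale: "monom_eval m (\<lambda>i. c * w i) = c ^ mon_deg m * monom_eval m w"
  by (simp add: monom_eval_def mon_deg_def power_mult_distrib prod.distrib power_sum)

lemma homogeneous_eval_scale:
  "homogeneous d f \<Longrightarrow> mpol_eval f (\<lambda>i. c * w i) = c ^ d * mpol_eval f w"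
  unfolding mpol_eval_superset[OF finite_keys order.refl] homogeneous_iff
  by (auto simp: monom_eval_scale sum_distrib_left ac_simps intro!: sum.cong)

definition ray :: "('v \<Rightarrow> 'k::field) \<Rightarrow> ('v, 'k) point" where
  "ray w = {(\<lambda>i. c * w i) | c. c \<noteq> 0}"

lemma proj_space_ray: "x \<in> proj_space \<longleftrightarrow> (\<exists>w. w \<noteq> (\<lambda>_. 0) \<and> x = ray w)"
  unfolding proj_space_def ray_def by auto

lemma mem_ray: "w \<in> ray w"
  unfolding ray_def by (intro CollectI exI[of _ 1]) auto

lemma vanishes_at_ray:
  assumes "homogeneous d f"
  shows "vanishes_at f (ray w) \<longleftrightarrow> mpol_eval f w = 0"
proof
  show "vanishes_at f (ray w) \<Longrightarrow> mpol_eval f w = 0" unfolding vanishes_at_def using mem_ray by auto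
  show "mpol_eval f w = 0 \<Longrightarrow> vanishes_at f (ray w)"
    unfolding vanishes_at_def ray_def using homogeneous_eval_scale[OF assms] by auto
qed

lemma vanishes_at_mult:
  assumes x: "x \<in> proj_space" and "homogeneous d f" "homogeneous e g"
  shows "vanishes_at (f * g) x \<longleftrightarrow> vanishes_at f x \<or> vanishes_at g x"
proof -
  obtain w where "x = ray w" using x proj_space_ray by auto
  then show ?thesis
    using assms vanishes_at_ray[OF homogeneous_mult[OF assms(2,3)], of w] by (simp add: vanishes_at_ray mpol_eval_mult)
qed

locale proj_variety =
  fixes C :: "('v::finite, 'k::field) point set"
  assumes closed: "proj_closed C" and irreducible: "proj_irreducible C"
begin

lemma subset_proj_space: "C \<subseteq> proj_space"
  using closed unfolding proj_closed_def by auto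

lemma vanishing_add: "f \<in> vanishing_ideal C \<Longrightarrow> g \<in> vanishing_ideal C \<Longrightarrow> f + g \<in> vanishing_ideal C"
  unfolding vanishing_ideal_def vanishes_at_def by (auto simp: mpol_eval_add)

lemma vanishing_mult: "f \<in> vanishing_ideal C \<Longrightarrow> g * f \<in> vanishing_ideal C"
  unfolding vanishing_ideal_def vanishes_at_def by (auto simp: mpol_eval_mult)

lemma vanishing_mult_right: "f \<in> vanishing_ideal C \<Longrightarrow> f * g \<in> vanishing_ideal C"
  using vanishing_mult[of f g] by (simp add: mult.commute)

lemma vanishing_prime:
  assumes f: "homogeneous d f" and g: "homogeneous e g" and fg: "f * g \<in> vanishing_ideal C"
  shows "f \<in> vanishing_ideal C \<or> g \<in> vanishing_ideal C"
proof -
  let ?V = "\<lambda>h. {x \<in> proj_space. \<forall>f\<in>{h}. vanishes_at f x}"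
  have "C \<subseteq> ?V f \<union> ?V g"
    using fg vanishes_at_mult[OF _ f g] subset_proj_space unfolding vanishing_ideal_def by auto
  moreover have "proj_closed (?V f)" "proj_closed (?V g)" unfolding proj_closed_def using f g by blast+
  ultimately have "C \<subseteq> ?V f \<or> C \<subseteq> ?V g" using irreducible unfolding proj_irreducible_def by blast
  then show ?thesis unfolding vanishing_ideal_def by auto
qed

abbreviation "S \<equiv> ring_of_type_algebra :: ('v, 'k) mpol ring"

lemma S_simps: "carrier S = UNIV" "a \<otimes>\<^bsub>S\<^esub> b = a * b" "a \<oplus>\<^bsub>S\<^esub> b = a + b" "\<one>\<^bsub>S\<^esub> = 1" "\<zero>\<^bsub>S\<^esub> = 0"
  by (simp_all add: ring_of_type_algebra_def)

lemma cring_S: "cring S"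
  by (rule cring_from_type_algebra)

lemma S_minus: "\<ominus>\<^bsub>S\<^esub> a = - a"
proof -
  interpret S: cring S by (rule cring_S)
  show ?thesis by (rule S.minus_equality) (simp_all add: S_simps)
qed

lemma ideal_vanishing: "ideal (vanishing_ideal C) S"
proof -
  interpret S: cring S by (rule cring_S)
  show ?thesis
  proof (rule idealI)
    show "ring S" by (rule S.ring_axioms)
    show "subgroup (vanishing_ideal C) (add_monoid S)"
    proof (rule S.add.subgroupI)
      have "0 \<in> vanishing_ideal C" unfolding vanishing_ideal_def vanishes_at_def by simp
      then show "vanishing_ideal C \<noteq> {}" by auto
      fix a assume "a \<in> vanishing_ideal C"
      then have "(- 1) * a \<in> vanishing_ideal C" by (rule vanishing_mult)
      then show "\<ominus>\<^bsub>S\<^esub> a \<in> vanishing_ideal C" by (simp add: S_minus)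
    qed (auto simp: S_simps vanishing_add)
  qed (auto simp: S_simps vanishing_mult vanishing_mult_right)
qed

abbreviation "R \<equiv> coord_ring C"
abbreviation "cl \<equiv> coord_class C"

lemma cring_R: "cring R"
  unfolding coord_ring_def by (rule ideal.quotient_is_cring[OF ideal_vanishing cring_S])

sublocale R: cring "coord_ring C" by (rule cring_R)

lemma cl_hom: "cl \<in> ring_hom S R"
proof -
  have "(\<lambda>f. vanishing_ideal C +>\<^bsub>S\<^esub> f) \<in> ring_hom S R"
    unfolding coord_ring_def by (rule ideal.rcos_ring_hom[OF ideal_vanishing])
  then show ?thesis unfolding coord_class_def[abs_def] .
qed

lemma cl_closed [simp]: "cl f \<in> carrier R"
  using ring_hom_closed[OF cl_hom] by (simp add: S_simps)

lemma cl_add: "cl f \<oplus>\<^bsub>R\<^esub> cl g = cl (f + g)"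
  using ring_hom_add[OF cl_hom, of f g] by (simp add: S_simps)

lemma cl_mult: "cl f \<otimes>\<^bsub>R\<^esub> cl g = cl (f * g)"
  using ring_hom_mult[OF cl_hom, of f g] by (simp add: S_simps)

lemma cl_one: "\<one>\<^bsub>R\<^esub> = cl 1"
  using ring_hom_one[OF cl_hom] by (simp add: S_simps)

lemma cl_eq_iff: "cl f = cl g \<longleftrightarrow> f - g \<in> vanishing_ideal C"
proof -
  interpret S: cring S by (rule cring_S)
  show ?thesis
    using S.quotient_eq_iff_same_a_r_cos[OF ideal_vanishing, of f g]
    by (simp add: S_simps S.minus_eq S_minus coord_class_def)
qed

lemma cl_zero: "\<zero>\<^bsub>R\<^esub> = cl 0"
  using ring_hom_zero[OF cl_hom] cring_S R.ring_axioms cring.axioms(1) by (metis S_simps(5))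

lemma cl_minus: "\<ominus>\<^bsub>R\<^esub> cl f = cl (- f)"
  by (rule R.minus_equality) (simp_all add: cl_add cl_zero)

lemma cl_zero_iff: "cl f = \<zero>\<^bsub>R\<^esub> \<longleftrightarrow> f \<in> vanishing_ideal C"
  by (simp add: cl_zero cl_eq_iff)

lemma form_pairsI:
  "\<lbrakk>homogeneous d f; homogeneous d g; g \<notin> vanishing_ideal C\<rbrakk> \<Longrightarrow> (cl f, cl g) \<in> form_pairs C"
  unfolding form_pairs_def by blast

lemma form_pairsE:
  assumes "(a, b) \<in> form_pairs C"
  obtains f g d where "homogeneous d f" "homogeneous d g" "g \<notin> vanishing_ideal C" "a = cl f" "b = cl g"
  using assms unfolding form_pairs_def by blast

lemma one_notin_vanishing: "1 \<notin> vanishing_ideal C"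
proof -
  obtain x where x: "x \<in> C" using irreducible unfolding proj_irreducible_def by auto
  then obtain w where "x = ray w" using subset_proj_space proj_space_ray[of x] by blast
  then have "w \<in> x" using mem_ray by simp
  then show ?thesis using x unfolding vanishing_ideal_def vanishes_at_def by auto
qed

sublocale F: fraction_pairs "coord_ring C" "form_pairs C"
proof
  fix a b c d e f assume ab: "(a, b) \<in> form_pairs C" and cd: "(c, d) \<in> form_pairs C"
  obtain f1 g1 d1 where 1: "homogeneous d1 f1" "homogeneous d1 g1" "g1 \<notin> vanishing_ideal C" "a = cl f1" "b = cl g1"
    using ab by (rule form_pairsE)
  obtain f2 g2 d2 where 2: "homogeneous d2 f2" "homogeneous d2 g2" "g2 \<notin> vanishing_ideal C" "c = cl f2" "d = cl g2"
    using cd by (rule form_pairsE)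
  have prime: "g1 * g2 \<notin> vanishing_ideal C" using 1 2 vanishing_prime by blast
  show "(a \<otimes>\<^bsub>R\<^esub> d \<oplus>\<^bsub>R\<^esub> c \<otimes>\<^bsub>R\<^esub> b, b \<otimes>\<^bsub>R\<^esub> d) \<in> form_pairs C"
    unfolding 1 2 cl_mult cl_add
    using 1 2 prime homogeneous_mult[of d1 f1 d2 g2] homogeneous_mult[of d2 f2 d1 g1] homogeneous_mult[of d1 g1 d2 g2]
    by (intro form_pairsI[of "d1 + d2"]) (auto intro: homogeneous_add simp: add.commute)
  show "(a \<otimes>\<^bsub>R\<^esub> c, b \<otimes>\<^bsub>R\<^esub> d) \<in> form_pairs C"
    unfolding 1 2 cl_mult
    using 1 2 prime homogeneous_mult by (intro form_pairsI[of "d1 + d2"]) auto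
  assume "(e, f) \<in> form_pairs C" and eq: "d \<otimes>\<^bsub>R\<^esub> (a \<otimes>\<^bsub>R\<^esub> f \<ominus>\<^bsub>R\<^esub> e \<otimes>\<^bsub>R\<^esub> b) = \<zero>\<^bsub>R\<^esub>"
  then obtain f3 g3 d3 where 3: "homogeneous d3 f3" "homogeneous d3 g3" "g3 \<notin> vanishing_ideal C" "e = cl f3" "f = cl g3"
    by (metis form_pairsE)
  have "g2 * (f1 * g3 - f3 * g1) \<in> vanishing_ideal C"
    using eq unfolding 1 2 3 by (simp add: cl_mult cl_add cl_minus R.minus_eq cl_zero_iff)
  moreover have "homogeneous (d1 + d3) (f1 * g3 - f3 * g1)"
    using homogeneous_mult[of d1 f1 d3 g3] homogeneous_mult[of d3 f3 d1 g1] 1 3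
    by (auto intro: homogeneous_diff simp: add.commute)
  ultimately have "f1 * g3 - f3 * g1 \<in> vanishing_ideal C" using vanishing_prime 2 by blast
  then show "a \<otimes>\<^bsub>R\<^esub> f = e \<otimes>\<^bsub>R\<^esub> b" unfolding 1 3 by (simp add: cl_mult cl_eq_iff)
next
  fix a b assume ab: "(a, b) \<in> form_pairs C"
  then obtain f g d where "homogeneous d f" "homogeneous d g" "g \<notin> vanishing_ideal C" "a = cl f" "b = cl g"
    by (rule form_pairsE)
  then show "a \<in> carrier R \<and> b \<in> carrier R" "(\<ominus>\<^bsub>R\<^esub> a, b) \<in> form_pairs C"
    by (auto simp: cl_minus intro: form_pairsI homogeneous_minus)
next
  show "(\<zero>\<^bsub>R\<^esub>, \<one>\<^bsub>R\<^esub>) \<in> form_pairs C" "(\<one>\<^bsub>R\<^esub>, \<one>\<^bsub>R\<^esub>) \<in> form_pairs C"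
    unfolding cl_zero cl_one using one_notin_vanishing
    by (auto intro!: form_pairsI[of 0] homogeneous_one)
qed

end

section \<open>The local ring at a point\<close>

text \<open>One generator of the maximal ideal is eliminated at a time, since \<open>1 - b\<close> is a unit for
  every \<open>b\<close> in the maximal ideal.\<close>

lemma (in cring) nakayama_principal:
  assumes M: "ideal M R" and units: "M = carrier R - Units R"
    and p: "p \<in> M" and cot: "\<And>f. f \<in> M \<Longrightarrow> \<exists>c\<in>carrier R. f \<ominus> c \<otimes> p \<in> ideal_prod R M (ideal_prod R M (carrier R))"
    and fin: "finite G" and GM: "G \<subseteq> M" and gen: "\<And>J. ideal J R \<Longrightarrow> p \<in> J \<Longrightarrow> G \<subseteq> J \<Longrightarrow> M \<subseteq> J"
  shows "M = PIdl p"
proof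
  interpret M: ideal M R by fact
  have pc [simp]: "p \<in> carrier R" using p M.Icarr by auto
  show "PIdl p \<subseteq> M" by (rule cgenideal_minimal[OF M p])
  show "M \<subseteq> PIdl p"
    using fin GM gen
  proof (induction G rule: finite_induct)
    case empty
    then show ?case using cgenideal_ideal cgenideal_self by simp
  next
    case (insert g G)
    have g: "g \<in> M" and gc [simp]: "g \<in> carrier R" using insert.prems M.Icarr by auto
    have "M \<subseteq> J" if J: "ideal J R" "p \<in> J" "G \<subseteq> J" for J
    proof -
      interpret J: ideal J R by fact
      define J' where "J' = set_add R J (PIdl g)"
      have J': "ideal J' R" unfolding J'_def using J(1) cgenideal_ideal[OF gc] by (rule add_ideals)
      have J'_mem: "z \<in> J' \<longleftrightarrow> (\<exists>j\<in>J. \<exists>r\<in>carrier R. z = j \<oplus> r \<otimes> g)" for z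
        unfolding J'_def set_add_def' cgenideal_def by auto
      have "j \<in> J'" if "j \<in> J" for j
        unfolding J'_mem using that J.Icarr by (intro bexI[of _ j] bexI[of _ \<zero>]) auto
      moreover have "g \<in> J'"
        unfolding J'_mem using J.zero_closed by (intro bexI[of _ \<zero>] bexI[of _ \<one>]) auto
      ultimately have MJ': "M \<subseteq> J'" using insert.prems(2)[OF J'] J by auto
      define N where "N = {j \<oplus> b \<otimes> g | j b. j \<in> J \<and> b \<in> M}"
      have N_add: "y \<oplus> z \<in> N" if yz: "y \<in> N" "z \<in> N" for y z
      proof -
        obtain j b j' b' where 1: "j \<in> J" "b \<in> M" "j' \<in> J" "b' \<in> M" "y = j \<oplus> b \<otimes> g" "z = j' \<oplus> b' \<otimes> g"
          using yz unfolding N_def by auto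
        note c = J.Icarr[OF 1(1)] M.Icarr[OF 1(2)] J.Icarr[OF 1(3)] M.Icarr[OF 1(4)] gc
        have "y \<oplus> z = (j \<oplus> j') \<oplus> (b \<oplus> b') \<otimes> g"
          unfolding 1(5,6) using c by algebra
        then show ?thesis unfolding N_def using 1 by blast
      qed
      have "z \<in> N" if "z \<in> ideal_prod R M (ideal_prod R M (carrier R))" for z
        using that
      proof induction
        case (prod m y)
        have "ideal_prod R M (carrier R) \<subseteq> M"
          using ideal_prod_inter[OF M oneideal] by auto
        then have y: "y \<in> M" using prod by auto
        obtain j r where jr: "j \<in> J" "r \<in> carrier R" "m = j \<oplus> r \<otimes> g" using prod(1) MJ' J'_mem[of m] by blast
        note c = J.Icarr[OF jr(1)] jr(2) M.Icarr[OF y] gc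
        have "m \<otimes> y = j \<otimes> y \<oplus> (r \<otimes> y) \<otimes> g" unfolding jr(3) using c by algebra
        moreover have "j \<otimes> y \<in> J" using J.I_r_closed jr c by auto
        moreover have "r \<otimes> y \<in> M" using M.I_l_closed y jr by auto
        ultimately show ?case unfolding N_def by blast
      next
        case (sum y z)
        then show ?case using N_add by blast
      qed
      then obtain c j b where cjb: "c \<in> carrier R" "j \<in> J" "b \<in> M" "g \<ominus> c \<otimes> p = j \<oplus> b \<otimes> g"
        using cot[OF g] unfolding N_def by blast
      note cc = cjb(1) J.Icarr[OF cjb(2)] M.Icarr[OF cjb(3)] gc pc
      have unit: "\<one> \<ominus> b \<in> Units R"
      proof (rule ccontr)
        assume "\<one> \<ominus> b \<notin> Units R"
        then have "\<one> \<ominus> b \<in> M" using units cc by auto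
        then have "(\<one> \<ominus> b) \<oplus> b \<in> M" using cjb by auto
        moreover have "(\<one> \<ominus> b) \<oplus> b = \<one>" using cc by algebra
        ultimately show False using units by auto
      qed
      have "(\<one> \<ominus> b) \<otimes> g = (g \<ominus> c \<otimes> p) \<ominus> b \<otimes> g \<oplus> c \<otimes> p" using cc by algebra
      also have "\<dots> = j \<oplus> c \<otimes> p" unfolding cjb(4) using cc by algebra
      also have "\<dots> \<in> J" using cjb J.I_l_closed J(2) by auto
      finally have "inv (\<one> \<ominus> b) \<otimes> ((\<one> \<ominus> b) \<otimes> g) \<in> J"
        by (rule J.I_l_closed[OF _ Units_inv_closed[OF unit]])
      moreover have "inv (\<one> \<ominus> b) \<otimes> ((\<one> \<ominus> b) \<otimes> g) = g"
        using unit cc m_assoc[of "inv (\<one> \<ominus> b)" "\<one> \<ominus> b" g] by simp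
      ultimately have "insert g G \<subseteq> J" using J by auto
      then show ?thesis using insert.prems(2) J by blast
    qed
    then show ?case using insert by blast
  qed
qed

locale variety_point = proj_variety C for C :: "('v::finite, 'k::field) point set" +
  fixes x :: "('v, 'k) point" and w :: "'v \<Rightarrow> 'k"
  assumes x_in: "x \<in> C" and x_eq: "x = ray w" and w_nonzero: "w \<noteq> (\<lambda>_. 0)"
begin

definition adm :: "('v, 'k) mpol \<Rightarrow> ('v, 'k) mpol \<Rightarrow> bool" where
  "adm f g \<longleftrightarrow> (\<exists>d. homogeneous d f \<and> homogeneous d g) \<and> mpol_eval g w \<noteq> 0"

definition q :: "('v, 'k) mpol \<Rightarrow> ('v, 'k) mpol \<Rightarrow> ('v, 'k) rat_fun" where
  "q f g = F.fr (cl f) (cl g)"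

abbreviation "FF \<equiv> function_field C"
abbreviation "L \<equiv> local_ring C x"

lemma eval_vanishing: "f \<in> vanishing_ideal C \<Longrightarrow> mpol_eval f w = 0"
  using x_in mem_ray[of w] unfolding vanishing_ideal_def vanishes_at_def x_eq by auto

lemma adm_pair: "adm f g \<Longrightarrow> (cl f, cl g) \<in> form_pairs C"
  unfolding adm_def using eval_vanishing form_pairsI by blast

lemma adm_mult: "adm f g \<Longrightarrow> adm f' g' \<Longrightarrow> adm (f * f') (g * g')"
  unfolding adm_def using homogeneous_mult by (fastforce simp: mpol_eval_mult)

lemma adm_add: "adm f g \<Longrightarrow> adm f' g' \<Longrightarrow> adm (f * g' + f' * g) (g * g')"
  unfolding adm_def
proof (elim conjE exE, intro conjI exI)
  fix d e assume "homogeneous d f" "homogeneous d g" "homogeneous e f'" "homogeneous e g'"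
    "mpol_eval g w \<noteq> 0" "mpol_eval g' w \<noteq> 0"
  then show "homogeneous (d + e) (f * g' + f' * g)" "homogeneous (d + e) (g * g')" "mpol_eval (g * g') w \<noteq> 0"
    using homogeneous_mult[of d f e g'] homogeneous_mult[of e f' d g] homogeneous_mult[of d g e g']
    by (auto intro: homogeneous_add simp: mpol_eval_mult add.commute)
qed

lemma adm_minus: "adm f g \<Longrightarrow> adm (- f) g"
  unfolding adm_def using homogeneous_minus by blast

lemma adm_const: "adm (Poly_Mapping.single 0 c) 1"
  unfolding adm_def using homogeneous_const homogeneous_one by fastforce

lemma function_field_eq: "FF = fractions R (form_pairs C)"
  unfolding function_field_def ..

lemma cring_FF: "cring FF"
  unfolding function_field_eq by (rule F.cring_fractions)

sublocale FF: cring "function_field C" by (rule cring_FF)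

lemma domain_FF: "domain FF"
proof (rule domainI[OF cring_FF])
  show "\<one>\<^bsub>FF\<^esub> \<noteq> \<zero>\<^bsub>FF\<^esub>"
    using F.fr_zero_iff[OF F.one_pair] one_notin_vanishing
    by (simp add: function_field_eq F.one_fractions cl_one cl_zero_iff)
  fix a b assume ab: "a \<otimes>\<^bsub>FF\<^esub> b = \<zero>\<^bsub>FF\<^esub>" "a \<in> carrier FF" "b \<in> carrier FF"
  obtain a1 a2 where a: "(a1, a2) \<in> form_pairs C" "a = F.fr a1 a2"
    using ab unfolding function_field_eq by (metis F.fractionsE)
  obtain b1 b2 where b: "(b1, b2) \<in> form_pairs C" "b = F.fr b1 b2"
    using ab unfolding function_field_eq by (metis F.fractionsE)
  obtain f g d where f: "homogeneous d f" "a1 = cl f" using a(1) by (metis form_pairsE)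
  obtain f' g' d' where f': "homogeneous d' f'" "b1 = cl f'" using b(1) by (metis form_pairsE)
  have "a1 \<otimes>\<^bsub>R\<^esub> b1 = \<zero>\<^bsub>R\<^esub>"
    using ab(1) a b F.fr_zero_iff[OF F.mult_pair[OF a(1) b(1)]] by (simp add: function_field_eq F.mult_fr)
  then have "f * f' \<in> vanishing_ideal C" by (simp add: f f' cl_mult cl_zero_iff)
  then have "f \<in> vanishing_ideal C \<or> f' \<in> vanishing_ideal C" using vanishing_prime f f' by blast
  then show "a = \<zero>\<^bsub>FF\<^esub> \<or> b = \<zero>\<^bsub>FF\<^esub>"
    using F.fr_zero_iff[OF a(1)] F.fr_zero_iff[OF b(1)] a b f f' by (auto simp: function_field_eq cl_zero_iff)
qed

lemma q_eq_iff: "adm f g \<Longrightarrow> adm f' g' \<Longrightarrow> q f g = q f' g' \<longleftrightarrow> f * g' - f' * g \<in> vanishing_ideal C"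
  unfolding q_def by (simp add: F.fr_eq_iff adm_pair cl_mult cl_eq_iff)

lemma q_eqI: "adm f g \<Longrightarrow> adm f' g' \<Longrightarrow> f * g' = f' * g \<Longrightarrow> q f g = q f' g'"
  using q_eq_iff[of f g f' g'] by (simp add: cl_zero_iff[symmetric] cl_zero)

lemma q_mult: "adm f g \<Longrightarrow> adm f' g' \<Longrightarrow> q f g \<otimes>\<^bsub>FF\<^esub> q f' g' = q (f * f') (g * g')"
  unfolding q_def function_field_eq by (simp add: F.mult_fr adm_pair cl_mult)

lemma q_add: "adm f g \<Longrightarrow> adm f' g' \<Longrightarrow> q f g \<oplus>\<^bsub>FF\<^esub> q f' g' = q (f * g' + f' * g) (g * g')"
  unfolding q_def function_field_eq by (simp add: F.add_fr adm_pair cl_mult cl_add)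

lemma q_one: "\<one>\<^bsub>FF\<^esub> = q 1 1"
  unfolding q_def function_field_eq by (simp add: F.one_fractions cl_one)

lemma q_zero: "\<zero>\<^bsub>FF\<^esub> = q 0 1"
  unfolding q_def function_field_eq by (simp add: F.zero_fractions cl_one cl_zero)

lemma adm_one: "adm 1 1"
  using adm_const[of 1] by simp

lemma adm_zero: "adm 0 1"
  using adm_const[of 0] by simp

lemma q_closed: "adm f g \<Longrightarrow> q f g \<in> carrier FF"
  unfolding q_def function_field_eq by (intro F.fr_closed adm_pair)

lemma q_minus: assumes "adm f g" shows "\<ominus>\<^bsub>FF\<^esub> q f g = q (- f) g"
proof (rule FF.minus_equality)
  have "q (- f) g \<oplus>\<^bsub>FF\<^esub> q f g = q (- f * g + f * g) (g * g)"
    using assms by (intro q_add adm_minus)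
  also have "\<dots> = q 0 1"
    using adm_add[OF adm_minus[OF assms] assms] adm_zero by (intro q_eqI) auto
  finally show "q (- f) g \<oplus>\<^bsub>FF\<^esub> q f g = \<zero>\<^bsub>FF\<^esub>" by (simp add: q_zero)
qed (use assms in \<open>auto intro: q_closed adm_minus\<close>)

lemma carrier_L: "carrier L = {q f g | f g. adm f g}"
proof (intro equalityI subsetI)
  fix z assume "z \<in> carrier L"
  then obtain f g d where z: "z \<in> carrier FF" "homogeneous d f" "homogeneous d g" "\<not> vanishes_at g x" "(cl f, cl g) \<in> z"
    unfolding local_ring_def by auto
  obtain a b where ab: "(a, b) \<in> form_pairs C" "z = F.fr a b" using z(1) unfolding function_field_eq by (metis F.fractionsE)
  have "z = q f g" using F.fr_eqI[of "cl f" "cl g" a b] z ab unfolding q_def by simp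
  moreover have "adm f g" using z vanishes_at_ray unfolding adm_def x_eq by blast
  ultimately show "z \<in> {q f g | f g. adm f g}" by blast
next
  fix z assume "z \<in> {q f g | f g. adm f g}"
  then obtain f g where z: "z = q f g" "adm f g" by auto
  obtain d where d: "homogeneous d f" "homogeneous d g" "mpol_eval g w \<noteq> 0" using z unfolding adm_def by auto
  then have "\<not> vanishes_at g x" unfolding x_eq by (simp add: vanishes_at_ray)
  moreover have "(cl f, cl g) \<in> z" using F.fr_self[OF adm_pair[OF z(2)]] z by (simp add: q_def)
  ultimately show "z \<in> carrier L" unfolding local_ring_def using q_closed[OF z(2)] z d by auto
qed

lemma LE:
  assumes "z \<in> carrier L" obtains f g where "adm f g" "z = q f g"
  using assms carrier_L by auto

lemma L_simps: "a \<otimes>\<^bsub>L\<^esub> b = a \<otimes>\<^bsub>FF\<^esub> b" "a \<oplus>\<^bsub>L\<^esub> b = a \<oplus>\<^bsub>FF\<^esub> b" "\<one>\<^bsub>L\<^esub> = \<one>\<^bsub>FF\<^esub>" "\<zero>\<^bsub>L\<^esub> = \<zero>\<^bsub>FF\<^esub>"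
  unfolding local_ring_def by simp_all

lemma q_in_L: "adm f g \<Longrightarrow> q f g \<in> carrier L"
  using carrier_L by auto

lemma subring_L: "subring (carrier L) FF"
proof (rule FF.subringI)
  show "carrier L \<subseteq> carrier FF" unfolding local_ring_def by auto
  show "\<one>\<^bsub>FF\<^esub> \<in> carrier L" using q_in_L[OF adm_one] by (simp add: q_one)
  fix h assume "h \<in> carrier L"
  then show "\<ominus>\<^bsub>FF\<^esub> h \<in> carrier L" by (elim LE) (simp add: q_minus q_in_L adm_minus)
next
  fix h h' assume "h \<in> carrier L" "h' \<in> carrier L"
  then obtain f g f' g' where "adm f g" "h = q f g" "adm f' g'" "h' = q f' g'" by (metis LE)
  then show "h \<otimes>\<^bsub>FF\<^esub> h' \<in> carrier L" "h \<oplus>\<^bsub>FF\<^esub> h' \<in> carrier L"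
    by (auto simp: q_mult q_add intro: q_in_L adm_mult adm_add)
qed

lemma domain_L: "domain L"
  using domain.subring_is_domain[OF domain_FF subring_L] unfolding local_ring_def by simp

sublocale L: "domain" "local_ring C x" by (rule domain_L)

lemma eval_well_defined:
  assumes "adm f g" "adm f' g'" "q f g = q f' g'"
  shows "mpol_eval f w / mpol_eval g w = mpol_eval f' w / mpol_eval g' w"
proof -
  have "mpol_eval (f * g' - f' * g) w = 0" using assms q_eq_iff eval_vanishing by blast
  then show ?thesis using assms unfolding adm_def by (simp add: mpol_eval_diff mpol_eval_mult frac_eq_eq)
qed

lemma adm_swap: "adm f g \<Longrightarrow> mpol_eval f w \<noteq> 0 \<Longrightarrow> adm g f"
  unfolding adm_def by blast

lemma q_unit_iff:
  assumes fg: "adm f g"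
  shows "q f g \<in> Units L \<longleftrightarrow> mpol_eval f w \<noteq> 0"
proof
  assume "q f g \<in> Units L"
  then obtain z where "z \<in> carrier L" "q f g \<otimes>\<^bsub>L\<^esub> z = \<one>\<^bsub>L\<^esub>" using L.Units_r_inv_ex by auto
  then obtain f' g' where 1: "adm f' g'" "q f g \<otimes>\<^bsub>FF\<^esub> q f' g' = \<one>\<^bsub>FF\<^esub>" by (metis LE L_simps(1,3))
  then have "q (f * f') (g * g') = q 1 1" using fg by (simp add: q_mult q_one)
  then have "mpol_eval (f * f') w / mpol_eval (g * g') w = 1"
    using eval_well_defined[OF adm_mult[OF fg 1(1)] adm_one] by simp
  then show "mpol_eval f w \<noteq> 0" by (auto simp: mpol_eval_mult)
next
  assume nz: "mpol_eval f w \<noteq> 0"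
  have "q f g \<otimes>\<^bsub>FF\<^esub> q g f = \<one>\<^bsub>FF\<^esub>"
    using fg adm_swap[OF fg nz] adm_mult[OF fg adm_swap[OF fg nz]] adm_one
    by (simp add: q_mult q_one) (intro q_eqI, auto)
  then have "q f g \<otimes>\<^bsub>L\<^esub> q g f = \<one>\<^bsub>L\<^esub>" by (simp add: L_simps)
  moreover have "q f g \<in> carrier L" "q g f \<in> carrier L" using q_in_L fg adm_swap[OF fg nz] by auto
  ultimately show "q f g \<in> Units L" using L.m_comm unfolding Units_def by fastforce
qed

lemma max_ideal_L: "max_ideal L = {q f g | f g. adm f g \<and> mpol_eval f w = 0}"
proof (intro equalityI subsetI)
  fix z assume "z \<in> max_ideal L"
  then have z: "z \<in> carrier L" "z \<notin> Units L" unfolding max_ideal_def by auto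
  from z(1) obtain f g where "adm f g" "z = q f g" by (rule LE)
  then show "z \<in> {q f g | f g. adm f g \<and> mpol_eval f w = 0}" using z(2) q_unit_iff by blast
next
  fix z assume "z \<in> {q f g | f g. adm f g \<and> mpol_eval f w = 0}"
  then show "z \<in> max_ideal L" unfolding max_ideal_def using q_unit_iff q_in_L by auto
qed

lemma L_minus: "adm f g \<Longrightarrow> \<ominus>\<^bsub>L\<^esub> q f g = q (- f) g"
proof (rule L.minus_equality)
  assume fg: "adm f g"
  have "\<ominus>\<^bsub>FF\<^esub> q f g \<oplus>\<^bsub>FF\<^esub> q f g = \<zero>\<^bsub>FF\<^esub>" using q_closed[OF fg] by (simp add: FF.l_neg)
  then show "q (- f) g \<oplus>\<^bsub>L\<^esub> q f g = \<zero>\<^bsub>L\<^esub>" using fg by (simp add: q_minus L_simps)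
qed (auto intro: q_in_L adm_minus)

lemma ideal_max_ideal: "ideal (max_ideal L) L"
proof (rule idealI)
  show "ring L" by (rule L.ring_axioms)
  show "subgroup (max_ideal L) (add_monoid L)"
  proof (rule L.add.subgroupI)
    show "max_ideal L \<subseteq> carrier L" unfolding max_ideal_def by auto
    have "q 0 1 \<in> max_ideal L" unfolding max_ideal_L using adm_zero by force
    then show "max_ideal L \<noteq> {}" by auto
    fix a assume "a \<in> max_ideal L"
    then obtain f g where a: "adm f g" "mpol_eval f w = 0" "a = q f g" unfolding max_ideal_L by auto
    then have "adm (- f) g" "mpol_eval (- f) w = 0" by (auto simp: mpol_eval_minus adm_minus)
    then show "\<ominus>\<^bsub>L\<^esub> a \<in> max_ideal L" using a unfolding max_ideal_L by (auto simp: L_minus)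
    fix b assume "b \<in> max_ideal L"
    then obtain f' g' where b: "adm f' g'" "mpol_eval f' w = 0" "b = q f' g'" unfolding max_ideal_L by auto
    have "mpol_eval (f * g' + f' * g) w = 0" using a b by (simp add: mpol_eval_add mpol_eval_mult)
    then show "a \<oplus>\<^bsub>L\<^esub> b \<in> max_ideal L"
      using a b adm_add[OF a(1) b(1)] unfolding max_ideal_L by (auto simp: L_simps q_add)
  qed
  fix a z assume "a \<in> max_ideal L" "z \<in> carrier L"
  then obtain f g f' g' where a: "adm f g" "mpol_eval f w = 0" "a = q f g" and z: "adm f' g'" "z = q f' g'"
    unfolding max_ideal_L carrier_L by auto
  have "mpol_eval (f' * f) w = 0" using a by (simp add: mpol_eval_mult)
  then show za: "z \<otimes>\<^bsub>L\<^esub> a \<in> max_ideal L"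
    using a z adm_mult[OF z(1) a(1)] unfolding max_ideal_L by (auto simp: L_simps q_mult)
  have "a \<otimes>\<^bsub>L\<^esub> z = z \<otimes>\<^bsub>L\<^esub> a" using a z q_in_L by (intro L.m_comm) auto
  then show "a \<otimes>\<^bsub>L\<^esub> z \<in> max_ideal L" using za by simp
qed

lemma const_fun_eq: "const_fun C c = q (Poly_Mapping.single 0 c) 1"
  unfolding const_fun_def q_def F.fr_def ..

lemma const_fun_closed: "const_fun C c \<in> carrier L"
  unfolding const_fun_eq by (intro q_in_L adm_const)

lemma const_fun_add: "const_fun C (c + d) = const_fun C c \<oplus>\<^bsub>L\<^esub> const_fun C d"
  unfolding const_fun_eq using adm_const by (simp add: L_simps q_add single_add)

lemma const_fun_mult: "const_fun C (c * d) = const_fun C c \<otimes>\<^bsub>L\<^esub> const_fun C d"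
  unfolding const_fun_eq using adm_const by (simp add: L_simps q_mult mult_single)

lemma const_fun_one: "const_fun C 1 = \<one>\<^bsub>L\<^esub>"
  unfolding const_fun_eq by (simp add: L_simps q_one)

lemma mpol_eval_const: "mpol_eval (Poly_Mapping.single 0 c) w = c"
  by (simp add: mpol_eval_single monom_eval_def)

lemma q_diff_const:
  assumes fg: "adm f g"
  shows "q f g \<ominus>\<^bsub>L\<^esub> const_fun C c = q (f - Poly_Mapping.single 0 c * g) g"
    and "adm (f - Poly_Mapping.single 0 c * g) g"
proof -
  let ?c = "Poly_Mapping.single 0 c"
  show adm: "adm (f - ?c * g) g"
    using fg homogeneous_mult[OF homogeneous_const, of _ g c] homogeneous_diff unfolding adm_def by fastforce
  have m: "adm (- ?c) 1" using adm_minus[OF adm_const] .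
  have "q f g \<ominus>\<^bsub>L\<^esub> const_fun C c = q f g \<oplus>\<^bsub>FF\<^esub> q (- ?c) 1"
    unfolding const_fun_eq L.minus_eq using adm_const by (simp add: L_minus L_simps)
  also have "\<dots> = q (f * 1 + - ?c * g) (g * 1)" using fg m by (rule q_add)
  finally show "q f g \<ominus>\<^bsub>L\<^esub> const_fun C c = q (f - ?c * g) g" by simp
qed

lemma diff_const_max_ideal:
  assumes fg: "adm f g"
  shows "q f g \<ominus>\<^bsub>L\<^esub> const_fun C (mpol_eval f w / mpol_eval g w) \<in> max_ideal L"
proof -
  let ?c = "mpol_eval f w / mpol_eval g w"
  have "mpol_eval (f - Poly_Mapping.single 0 ?c * g) w = 0"
    using fg unfolding adm_def by (simp add: mpol_eval_diff mpol_eval_mult mpol_eval_const)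
  then show ?thesis unfolding max_ideal_L using q_diff_const[OF fg, of ?c] by auto
qed

lemma residue_exists: "z \<in> carrier L \<Longrightarrow> \<exists>c. z \<ominus>\<^bsub>L\<^esub> const_fun C c \<in> max_ideal L"
  using diff_const_max_ideal by (metis LE)

definition var :: "'v \<Rightarrow> ('v, 'k) mpol" where
  "var i = Poly_Mapping.single (Poly_Mapping.single i 1) 1"

lemma mon_deg_single: "mon_deg (Poly_Mapping.single i a) = a"
  unfolding mon_deg_def by (simp add: lookup_single when_def)

lemma homogeneous_var: "homogeneous 1 (var i)"
  unfolding var_def by (intro homogeneous_single) (simp add: mon_deg_single)

lemma mpol_eval_var: "mpol_eval (var i) w = w i"
proof -
  have "(\<Prod>j\<in>UNIV. w j ^ (Poly_Mapping.lookup (Poly_Mapping.single i (1::nat)) j)) = (\<Prod>j\<in>UNIV. if j = i then w i else 1)"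
    by (intro prod.cong) (auto simp: lookup_single when_def)
  then show ?thesis unfolding var_def by (simp add: mpol_eval_single monom_eval_def)
qed

lemma homogeneous_power: "homogeneous d f \<Longrightarrow> homogeneous (k * d) (f ^ k)"
  by (induction k) (auto intro: homogeneous_one homogeneous_mult)

lemma mpol_eval_power: "mpol_eval (f ^ k) w = mpol_eval f w ^ k"
  by (induction k) (auto simp: mpol_eval_mult)

context
  fixes i0 :: 'v
  assumes i0: "w i0 \<noteq> 0"
begin

definition dehom :: "nat \<Rightarrow> ('v, 'k) mpol \<Rightarrow> ('v, 'k) rat_fun" where
  "dehom d f = q f (var i0 ^ d)"

lemma adm_dehom: "homogeneous d f \<Longrightarrow> adm f (var i0 ^ d)"
  unfolding adm_def using homogeneous_power[OF homogeneous_var, of d i0] i0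
  by (auto simp: mpol_eval_power mpol_eval_var)

definition gens :: "('v, 'k) rat_fun set" where
  "gens = range (\<lambda>i. dehom 1 (var i) \<ominus>\<^bsub>L\<^esub> const_fun C (w i / w i0))"

definition form_value :: "nat \<Rightarrow> ('v, 'k) mpol \<Rightarrow> 'k" where
  "form_value d f = mpol_eval f w / w i0 ^ d"

lemma dehom_closed: "homogeneous d f \<Longrightarrow> dehom d f \<in> carrier L"
  unfolding dehom_def by (intro q_in_L adm_dehom)

lemma dehom_add:
  assumes "homogeneous d f" "homogeneous d g"
  shows "dehom d (f + g) = dehom d f \<oplus>\<^bsub>L\<^esub> dehom d g"
proof -
  let ?X = "var i0 ^ d"
  note a = adm_dehom[OF assms(1)] adm_dehom[OF assms(2)]
  have "dehom d f \<oplus>\<^bsub>L\<^esub> dehom d g = q (f * ?X + g * ?X) (?X * ?X)"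
    unfolding dehom_def L_simps using a by (rule q_add)
  also have "\<dots> = q (f + g) ?X"
    using adm_add[OF a] adm_dehom[OF homogeneous_add[OF assms]] by (intro q_eqI) (auto simp: algebra_simps)
  finally show ?thesis unfolding dehom_def by simp
qed

lemma dehom_mult:
  assumes "homogeneous d f" "homogeneous e g"
  shows "dehom (d + e) (f * g) = dehom d f \<otimes>\<^bsub>L\<^esub> dehom e g"
  unfolding dehom_def L_simps using adm_dehom[OF assms(1)] adm_dehom[OF assms(2)] by (simp add: q_mult power_add)

lemma form_value_add: "form_value d (f + g) = form_value d f + form_value d g"
  by (simp add: form_value_def mpol_eval_add add_divide_distrib)

lemma form_value_mult: "form_value (d + e) (f * g) = form_value d f * form_value e g"
  by (simp add: form_value_def mpol_eval_mult power_add)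

text \<open>It suffices to treat the variables, for which this is the definition of \<open>gens\<close>.\<close>

lemma dehom_value_ideal:
  assumes J: "ideal J L" and gens: "gens \<subseteq> J" and f: "homogeneous d f"
  shows "dehom d f \<ominus>\<^bsub>L\<^esub> const_fun C (form_value d f) \<in> J"
proof -
  interpret J: ideal J L by fact
  define P where "P d f \<longleftrightarrow> dehom d f \<ominus>\<^bsub>L\<^esub> const_fun C (form_value d f) \<in> J" for d f
  have P_add: "P d (f + g)" if "homogeneous d f" "homogeneous d g" "P d f" "P d g" for d f g
  proof -
    note c = dehom_closed[OF that(1)] dehom_closed[OF that(2)] const_fun_closed[of "form_value d f"] const_fun_closed[of "form_value d g"]
    have "dehom d (f + g) \<ominus>\<^bsub>L\<^esub> const_fun C (form_value d (f + g)) =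
        (dehom d f \<ominus>\<^bsub>L\<^esub> const_fun C (form_value d f)) \<oplus>\<^bsub>L\<^esub> (dehom d g \<ominus>\<^bsub>L\<^esub> const_fun C (form_value d g))"
      unfolding dehom_add[OF that(1,2)] form_value_add const_fun_add using c by algebra
    then show ?thesis using that(3,4) unfolding P_def by simp
  qed
  have P_mult: "P (d + e) (f * g)" if "homogeneous d f" "homogeneous e g" "P d f" "P e g" for d e f g
  proof -
    note c = dehom_closed[OF that(1)] dehom_closed[OF that(2)] const_fun_closed[of "form_value d f"] const_fun_closed[of "form_value e g"]
    have "dehom (d + e) (f * g) \<ominus>\<^bsub>L\<^esub> const_fun C (form_value (d + e) (f * g)) =
        (dehom d f \<ominus>\<^bsub>L\<^esub> const_fun C (form_value d f)) \<otimes>\<^bsub>L\<^esub> dehom e g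
        \<oplus>\<^bsub>L\<^esub> const_fun C (form_value d f) \<otimes>\<^bsub>L\<^esub> (dehom e g \<ominus>\<^bsub>L\<^esub> const_fun C (form_value e g))"
      unfolding dehom_mult[OF that(1,2)] form_value_mult const_fun_mult using c by algebra
    then show ?thesis using that(3,4) c unfolding P_def by (simp add: J.I_r_closed J.I_l_closed)
  qed
  have P_const: "P 0 (Poly_Mapping.single 0 c)" for c
    unfolding P_def dehom_def form_value_def
    using L.r_neg[OF const_fun_closed[of c]] J.zero_closed by (simp add: mpol_eval_const L.minus_eq const_fun_eq)
  have P_var: "P 1 (var i)" for i
    using gens unfolding P_def gens_def form_value_def by (auto simp: mpol_eval_var)
  have P_zero: "P d 0" for d
  proof -
    have "dehom d 0 = \<zero>\<^bsub>L\<^esub>"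
      unfolding dehom_def L_simps q_zero using adm_dehom[of d 0] adm_zero by (intro q_eqI) auto
    moreover have "const_fun C 0 = \<zero>\<^bsub>L\<^esub>" unfolding const_fun_eq L_simps q_zero by simp
    ultimately show ?thesis unfolding P_def form_value_def using J.zero_closed by (simp add: L.minus_eq)
  qed
  have P_monom: "P (mon_deg m) (Poly_Mapping.single m c)" for m c
  proof (induction "mon_deg m" arbitrary: m)
    case 0
    then have "m = 0" unfolding mon_deg_def by (intro poly_mapping_eqI) simp
    then show ?case using P_const by simp
  next
    case (Suc k)
    then obtain i where i: "Poly_Mapping.lookup m i > 0" unfolding mon_deg_def by (metis neq0_conv sum.neutral nat.distinct(1))
    define m' where "m' = m - Poly_Mapping.single i 1"
    have m: "m = m' + Poly_Mapping.single i 1"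
    proof (rule poly_mapping_eqI)
      fix j show "Poly_Mapping.lookup m j = Poly_Mapping.lookup (m' + Poly_Mapping.single i 1) j"
        using i by (auto simp: m'_def lookup_add lookup_minus lookup_single when_def)
    qed
    have deg: "mon_deg m = mon_deg m' + 1" unfolding m by (simp add: mon_deg_add mon_deg_single)
    have "Poly_Mapping.single m c = Poly_Mapping.single m' c * var i"
      unfolding m var_def by (simp add: mult_single)
    moreover have "P (mon_deg m') (Poly_Mapping.single m' c)" using Suc deg by simp
    ultimately show ?case
      using P_mult[OF homogeneous_single[OF refl] homogeneous_var _ P_var, of m' c i] deg by simp
  qed
  have "P d (\<Sum>m\<in>A. Poly_Mapping.single m (Poly_Mapping.lookup f m))"
    if "finite A" "A \<subseteq> Poly_Mapping.keys f" for A
    using that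
  proof (induction A rule: finite_induct)
    case empty
    then show ?case using P_zero by simp
  next
    case (insert m A)
    have deg: "mon_deg m' = d" if "m' \<in> insert m A" for m' using f insert that unfolding homogeneous_iff by auto
    have "P d (Poly_Mapping.single m (Poly_Mapping.lookup f m))" using P_monom[of m] deg by simp
    then show ?case
      using insert deg by (simp) (intro P_add homogeneous_sum homogeneous_single, auto)
  qed
  from this[of "Poly_Mapping.keys f"] show ?thesis
    unfolding P_def using mpol_monomials[of f] by simp
qed

lemma gens_max_ideal: "gens \<subseteq> max_ideal L"
  unfolding gens_def dehom_def
  using diff_const_max_ideal[OF adm_dehom[OF homogeneous_var]] by (auto simp: mpol_eval_power mpol_eval_var)

lemma max_ideal_generated:
  assumes J: "ideal J L" and gens: "gens \<subseteq> J"
  shows "max_ideal L \<subseteq> J"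
proof
  interpret J: ideal J L by fact
  fix z assume "z \<in> max_ideal L"
  then obtain f g where z: "adm f g" "mpol_eval f w = 0" "z = q f g" unfolding max_ideal_L by auto
  obtain d where d: "homogeneous d f" "homogeneous d g" "mpol_eval g w \<noteq> 0" using z unfolding adm_def by auto
  have "const_fun C 0 = \<zero>\<^bsub>L\<^esub>" unfolding const_fun_eq L_simps q_zero by simp
  then have "dehom d f \<in> J"
    using dehom_value_ideal[OF J gens d(1)] z(2) dehom_closed[OF d(1)] by (simp add: form_value_def L.minus_eq)
  moreover have a: "adm (var i0 ^ d) g"
    unfolding adm_def using d homogeneous_power[OF homogeneous_var, of d i0] by auto
  ultimately have "q (var i0 ^ d) g \<otimes>\<^bsub>L\<^esub> dehom d f \<in> J" by (intro J.I_l_closed q_in_L)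
  moreover have "q (var i0 ^ d) g \<otimes>\<^bsub>L\<^esub> dehom d f = z"
    unfolding L_simps dehom_def using a adm_dehom[OF d(1)] adm_mult[OF a adm_dehom[OF d(1)]] z
    by (simp add: q_mult) (intro q_eqI, auto simp: ac_simps)
  ultimately show "z \<in> J" by simp
qed

end

lemma max_ideal_principal:
  assumes cot: "cotangent_dim_one L"
  obtains p where "p \<in> carrier L" "p \<noteq> \<zero>\<^bsub>L\<^esub>" "max_ideal L = PIdl\<^bsub>L\<^esub> p"
proof -
  obtain i0 where i0: "w i0 \<noteq> 0" using w_nonzero by auto
  interpret M: ideal "max_ideal L" L by (rule ideal_max_ideal)
  have two: "ideal_pow L (max_ideal L) 2 = ideal_prod L (max_ideal L) (ideal_prod L (max_ideal L) (carrier L))"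
    by (simp add: numeral_2_eq_2)
  obtain p where p: "p \<in> max_ideal L" "p \<notin> ideal_pow L (max_ideal L) 2"
    and span: "\<And>f. f \<in> max_ideal L \<Longrightarrow> \<exists>c\<in>carrier L. f \<ominus>\<^bsub>L\<^esub> c \<otimes>\<^bsub>L\<^esub> p \<in> ideal_pow L (max_ideal L) 2"
    using cot unfolding cotangent_dim_one_def by auto
  have "max_ideal L = PIdl\<^bsub>L\<^esub> p"
  proof (rule L.nakayama_principal[OF ideal_max_ideal _ p(1) span[unfolded two]])
    show "max_ideal L = carrier L - Units L" by (simp add: max_ideal_def)
    show "finite (gens i0)" unfolding gens_def[OF i0] by simp
    show "gens i0 \<subseteq> max_ideal L" by (rule gens_max_ideal[OF i0])
    show "max_ideal L \<subseteq> J" if "ideal J L" "gens i0 \<subseteq> J" for J by (rule max_ideal_generated[OF i0 that])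
  qed
  moreover have "p \<noteq> \<zero>\<^bsub>L\<^esub>"
  proof
    assume "p = \<zero>\<^bsub>L\<^esub>"
    moreover have "\<zero>\<^bsub>L\<^esub> \<otimes>\<^bsub>L\<^esub> (\<zero>\<^bsub>L\<^esub> \<otimes>\<^bsub>L\<^esub> \<zero>\<^bsub>L\<^esub>) \<in> ideal_pow L (max_ideal L) 2"
      unfolding two by (intro ideal_prod.prod M.zero_closed L.zero_closed)
    ultimately show False using p by simp
  qed
  ultimately show thesis using that p M.Icarr by blast
qed

end

section \<open>Adeles\<close>

locale adelic_curve =
  fixes C :: "('v::finite, 'k::alg_closed_field) point set" and n :: nat
  assumes curve: "nonsingular_proj_curve C" and n_gt_1: "n > 1"
    and char_coprime: "CHAR('k) = 0 \<or> coprime n CHAR('k)"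
begin

lemma of_nat_n_nonzero: "of_nat n \<noteq> (0 :: 'k)"
proof
  assume "of_nat n = (0 :: 'k)"
  then have dvd: "CHAR('k) dvd n" by (simp add: of_nat_eq_0_iff_char_dvd)
  show False
  proof (cases "CHAR('k) = 0")
    case True then show False using dvd n_gt_1 by simp
  next
    case False
    then have "CHAR('k) = 1" using dvd char_coprime by (metis coprime_absorb_left coprime_commute nat_dvd_1_iff_1)
    then have "of_nat 1 = (0 :: 'k)" by (metis of_nat_CHAR)
    then show False by simp
  qed
qed

lemma completed_point:
  assumes "x \<in> C"
  obtains p where "residue_dvr (local_ring C x) p (const_fun C) n"
proof -
  have C: "proj_closed C" "proj_irreducible C" "cotangent_dim_one (local_ring C x)"
    using curve assms unfolding nonsingular_proj_curve_def by auto
  interpret V: proj_variety C by unfold_locales fact+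
  obtain w where "w \<noteq> (\<lambda>_. 0)" "x = ray w" using V.subset_proj_space assms proj_space_ray[of x] by blast
  then interpret P: variety_point C x w using assms by unfold_locales
  obtain p where p: "p \<in> carrier (local_ring C x)" "p \<noteq> \<zero>\<^bsub>local_ring C x\<^esub>" "max_ideal (local_ring C x) = PIdl\<^bsub>local_ring C x\<^esub> p"
    using P.max_ideal_principal[OF C(3)] by auto
  have "residue_dvr (local_ring C x) p (const_fun C) n"
    using p P.const_fun_closed P.const_fun_add P.const_fun_mult P.const_fun_one P.residue_exists n_gt_1 of_nat_n_nonzero
    by unfold_locales auto
  then show thesis by (rule that)
qed

abbreviation "K \<equiv> local_field C"
abbreviation "v \<equiv> point_val C"
abbreviation "Int_ring \<equiv> local_integers C"
abbreviation "A \<equiv> adele_ring C"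

lemma val_field_K: "x \<in> C \<Longrightarrow> val_field (K x) (v x) n"
  unfolding local_field_def point_val_def complete_local_ring_def
  by (elim completed_point residue_dvr.val_field_completion)

lemma Int_ring_eq: "x \<in> C \<Longrightarrow> Int_ring x = {z \<in> carrier (K x). z = \<zero>\<^bsub>K x\<^esub> \<or> 0 \<le> v x z}"
  unfolding local_field_def point_val_def local_integers_def complete_local_ring_def
  by (elim completed_point residue_dvr.integers_eq)

lemma Int_ring_val_ge: "x \<in> C \<Longrightarrow> Int_ring x = val_field.val_ge (K x) (v x) 0"
  using Int_ring_eq val_field.val_ge_def[OF val_field_K] by simp

lemma cring_K: "x \<in> C \<Longrightarrow> cring (K x)"
  using val_field.axioms(1)[OF val_field_K] fieldE(1) by blast

lemma carrier_A: "a \<in> carrier A \<longleftrightarrow> a \<in> (\<Pi>\<^sub>E x\<in>C. carrier (K x)) \<and> finite {x \<in> C. a x \<notin> Int_ring x}"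
  unfolding adele_ring_def by simp

lemma carrier_A_component: "a \<in> carrier A \<Longrightarrow> x \<in> C \<Longrightarrow> a x \<in> carrier (K x)"
  unfolding carrier_A by auto

lemma A_memI:
  assumes "\<And>x. x \<in> C \<Longrightarrow> f x \<in> carrier (K x)" "finite F" "\<And>x. x \<in> C \<Longrightarrow> x \<notin> F \<Longrightarrow> f x \<in> Int_ring x"
  shows "(\<lambda>x\<in>C. f x) \<in> carrier A"
proof -
  have "{x \<in> C. (\<lambda>x\<in>C. f x) x \<notin> Int_ring x} \<subseteq> F" using assms(3) by auto
  then have "finite {x \<in> C. (\<lambda>x\<in>C. f x) x \<notin> Int_ring x}" using assms(2) by (rule finite_subset)
  moreover have "(\<lambda>x\<in>C. f x) \<in> (\<Pi>\<^sub>E x\<in>C. carrier (K x))" using assms(1) by (rule restrict_PiE_iff[THEN iffD2, rule_format])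
  ultimately show ?thesis unfolding carrier_A by blast
qed

lemma A_eqI:
  assumes "a \<in> carrier A" "b \<in> carrier A" "\<And>x. x \<in> C \<Longrightarrow> a x = b x"
  shows "a = b"
  using assms unfolding carrier_A by (auto intro: PiE_ext)

lemma A_mult: "x \<in> C \<Longrightarrow> (a \<otimes>\<^bsub>A\<^esub> b) x = a x \<otimes>\<^bsub>K x\<^esub> b x"
  and A_add: "x \<in> C \<Longrightarrow> (a \<oplus>\<^bsub>A\<^esub> b) x = a x \<oplus>\<^bsub>K x\<^esub> b x"
  and A_one: "x \<in> C \<Longrightarrow> \<one>\<^bsub>A\<^esub> x = \<one>\<^bsub>K x\<^esub>"
  and A_zero: "x \<in> C \<Longrightarrow> \<zero>\<^bsub>A\<^esub> x = \<zero>\<^bsub>K x\<^esub>"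
  unfolding adele_ring_def by simp_all

lemma Int_ring_closed:
  assumes "x \<in> C"
  shows "\<zero>\<^bsub>K x\<^esub> \<in> Int_ring x" "\<one>\<^bsub>K x\<^esub> \<in> Int_ring x"
    "a \<in> Int_ring x \<Longrightarrow> b \<in> Int_ring x \<Longrightarrow> a \<oplus>\<^bsub>K x\<^esub> b \<in> Int_ring x"
    "a \<in> Int_ring x \<Longrightarrow> b \<in> Int_ring x \<Longrightarrow> a \<otimes>\<^bsub>K x\<^esub> b \<in> Int_ring x"
    "a \<in> Int_ring x \<Longrightarrow> \<ominus>\<^bsub>K x\<^esub> a \<in> Int_ring x"
proof -
  interpret V: val_field "K x" "v x" n by (rule val_field_K[OF assms])
  note Int_ring_val_ge[OF assms, simp]
  show "\<zero>\<^bsub>K x\<^esub> \<in> Int_ring x" "\<one>\<^bsub>K x\<^esub> \<in> Int_ring x"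
    "a \<in> Int_ring x \<Longrightarrow> b \<in> Int_ring x \<Longrightarrow> a \<oplus>\<^bsub>K x\<^esub> b \<in> Int_ring x"
    "a \<in> Int_ring x \<Longrightarrow> b \<in> Int_ring x \<Longrightarrow> a \<otimes>\<^bsub>K x\<^esub> b \<in> Int_ring x"
    "a \<in> Int_ring x \<Longrightarrow> \<ominus>\<^bsub>K x\<^esub> a \<in> Int_ring x"
    using V.val_ge_add V.val_ge_mult[of a 0 b 0] V.val_ge_minus by auto
qed

lemma A_closed:
  shows A_one_closed: "\<one>\<^bsub>A\<^esub> \<in> carrier A" and A_zero_closed: "\<zero>\<^bsub>A\<^esub> \<in> carrier A"
    and A_add_closed: "a \<in> carrier A \<Longrightarrow> b \<in> carrier A \<Longrightarrow> a \<oplus>\<^bsub>A\<^esub> b \<in> carrier A"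
    and A_mult_closed: "a \<in> carrier A \<Longrightarrow> b \<in> carrier A \<Longrightarrow> a \<otimes>\<^bsub>A\<^esub> b \<in> carrier A"
    and A_minus_closed: "a \<in> carrier A \<Longrightarrow> (\<lambda>x\<in>C. \<ominus>\<^bsub>K x\<^esub> a x) \<in> carrier A"
proof -
  have ring: "x \<in> C \<Longrightarrow> ring (K x)" for x using cring_K cring.axioms(1) by blast
  have "(\<lambda>x\<in>C. \<one>\<^bsub>K x\<^esub>) \<in> carrier A" "(\<lambda>x\<in>C. \<zero>\<^bsub>K x\<^esub>) \<in> carrier A"
    using Int_ring_closed Int_ring_eq by (auto intro!: A_memI[of _ "{}"])
  then show "\<one>\<^bsub>A\<^esub> \<in> carrier A" "\<zero>\<^bsub>A\<^esub> \<in> carrier A" by (simp_all add: adele_ring_def)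
  assume a: "a \<in> carrier A"
  show "(\<lambda>x\<in>C. \<ominus>\<^bsub>K x\<^esub> a x) \<in> carrier A"
    using a Int_ring_closed carrier_A_component[OF a] ring
    by (intro A_memI[of _ "{x \<in> C. a x \<notin> Int_ring x}"]) (auto simp: carrier_A cring.cring_simprules(3)[OF cring_K])
  assume b: "b \<in> carrier A"
  have fin: "finite ({x \<in> C. a x \<notin> Int_ring x} \<union> {x \<in> C. b x \<notin> Int_ring x})" using a b by (simp add: carrier_A)
  have "(\<lambda>x\<in>C. a x \<oplus>\<^bsub>K x\<^esub> b x) \<in> carrier A" "(\<lambda>x\<in>C. a x \<otimes>\<^bsub>K x\<^esub> b x) \<in> carrier A"
    using Int_ring_closed carrier_A_component[OF a] carrier_A_component[OF b] ring
    by (auto intro!: A_memI[OF _ fin] ring.ring_simprules)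
  then show "a \<oplus>\<^bsub>A\<^esub> b \<in> carrier A" "a \<otimes>\<^bsub>A\<^esub> b \<in> carrier A" by (simp_all add: adele_ring_def)
qed

lemma cring_A: "cring A"
proof (rule cringI)
  note comp = carrier_A_component
  note ops = A_mult A_add A_one A_zero
  note rules = cring.cring_simprules[OF cring_K]
  show "abelian_group A"
  proof (rule abelian_groupI)
    fix a b c assume abc: "a \<in> carrier A" "b \<in> carrier A" "c \<in> carrier A"
    show "a \<oplus>\<^bsub>A\<^esub> b \<oplus>\<^bsub>A\<^esub> c = a \<oplus>\<^bsub>A\<^esub> (b \<oplus>\<^bsub>A\<^esub> c)"
      using abc comp by (intro A_eqI A_closed) (auto simp: ops rules(7))
  next
    fix a b assume ab: "a \<in> carrier A" "b \<in> carrier A"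
    show "a \<oplus>\<^bsub>A\<^esub> b \<in> carrier A" using ab by (rule A_add_closed)
    show "a \<oplus>\<^bsub>A\<^esub> b = b \<oplus>\<^bsub>A\<^esub> a"
      using ab comp by (intro A_eqI A_closed) (auto simp: ops rules(10))
  next
    fix a assume a: "a \<in> carrier A"
    show "\<zero>\<^bsub>A\<^esub> \<oplus>\<^bsub>A\<^esub> a = a"
      using a comp by (intro A_eqI A_closed) (auto simp: ops rules(8,9,12))
    have "(\<lambda>x\<in>C. \<ominus>\<^bsub>K x\<^esub> a x) \<oplus>\<^bsub>A\<^esub> a = \<zero>\<^bsub>A\<^esub>"
      using a comp by (intro A_eqI A_closed) (auto simp: ops rules(8,9,12))
    then show "\<exists>b\<in>carrier A. b \<oplus>\<^bsub>A\<^esub> a = \<zero>\<^bsub>A\<^esub>" using A_minus_closed[OF a] by blast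
  qed (rule A_zero_closed)
  show "comm_monoid A"
  proof (rule comm_monoidI)
    fix a b c assume abc: "a \<in> carrier A" "b \<in> carrier A" "c \<in> carrier A"
    show "a \<otimes>\<^bsub>A\<^esub> b \<otimes>\<^bsub>A\<^esub> c = a \<otimes>\<^bsub>A\<^esub> (b \<otimes>\<^bsub>A\<^esub> c)"
      using abc comp by (intro A_eqI A_closed) (auto simp: ops rules(11))
  next
    fix a b assume ab: "a \<in> carrier A" "b \<in> carrier A"
    show "a \<otimes>\<^bsub>A\<^esub> b \<in> carrier A" using ab by (rule A_mult_closed)
    show "a \<otimes>\<^bsub>A\<^esub> b = b \<otimes>\<^bsub>A\<^esub> a"
      using ab comp by (intro A_eqI A_closed) (auto simp: ops rules(14))
  next
    fix a assume a: "a \<in> carrier A"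
    show "\<one>\<^bsub>A\<^esub> \<otimes>\<^bsub>A\<^esub> a = a"
      using a comp by (intro A_eqI A_closed) (auto simp: ops rules(8,9,12))
  qed (rule A_one_closed)
  fix a b c assume abc: "a \<in> carrier A" "b \<in> carrier A" "c \<in> carrier A"
  show "(a \<oplus>\<^bsub>A\<^esub> b) \<otimes>\<^bsub>A\<^esub> c = a \<otimes>\<^bsub>A\<^esub> c \<oplus>\<^bsub>A\<^esub> b \<otimes>\<^bsub>A\<^esub> c"
    using abc comp by (intro A_eqI A_closed) (auto simp: ops rules(13))
qed

sublocale A: cring "adele_ring C" by (rule cring_A)

lemma component_hom: "x \<in> C \<Longrightarrow> (\<lambda>a. a x) \<in> ring_hom A (K x)"
  by (rule ring_hom_memI) (auto simp: A_mult A_add A_one carrier_A_component)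

lemma A_pow:
  assumes x: "x \<in> C" and a: "a \<in> carrier A"
  shows "(a [^]\<^bsub>A\<^esub> (k::nat)) x = a x [^]\<^bsub>K x\<^esub> k"
proof -
  interpret h: ring_hom_cring A "K x" "\<lambda>a. a x"
    using cring_A cring_K[OF x] component_hom[OF x] by (rule ring_hom_cringI)
  show ?thesis using h.hom_pow[OF a] .
qed

lemma unit_A_iff:
  "u \<in> Units A \<longleftrightarrow> u \<in> carrier A \<and> (\<forall>x\<in>C. u x \<noteq> \<zero>\<^bsub>K x\<^esub>) \<and> finite {x \<in> C. v x (u x) \<noteq> 0}"
proof
  assume u: "u \<in> Units A"
  then have uc: "u \<in> carrier A" by auto
  obtain y where y: "y \<in> carrier A" "u \<otimes>\<^bsub>A\<^esub> y = \<one>\<^bsub>A\<^esub>" using A.Units_r_inv_ex[OF u] by auto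
  have uy: "u x \<otimes>\<^bsub>K x\<^esub> y x = \<one>\<^bsub>K x\<^esub>" if "x \<in> C" for x
    using fun_cong[OF y(2), of x] that by (simp add: A_mult A_one)
  have nz: "u x \<noteq> \<zero>\<^bsub>K x\<^esub>" "y x \<noteq> \<zero>\<^bsub>K x\<^esub>" "v x (u x) + v x (y x) = 0" if x: "x \<in> C" for x
  proof -
    interpret V: val_field "K x" "v x" n by (rule val_field_K[OF x])
    show 1: "u x \<noteq> \<zero>\<^bsub>K x\<^esub>" "y x \<noteq> \<zero>\<^bsub>K x\<^esub>"
      using uy[OF x] carrier_A_component[OF uc x] carrier_A_component[OF y(1) x] by auto
    show "v x (u x) + v x (y x) = 0"
      using V.v_mult[OF carrier_A_component[OF uc x] 1(1) carrier_A_component[OF y(1) x] 1(2)] uy[OF x] by simp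
  qed
  have "{x \<in> C. v x (u x) \<noteq> 0} \<subseteq> {x \<in> C. u x \<notin> Int_ring x} \<union> {x \<in> C. y x \<notin> Int_ring x}"
    using nz Int_ring_eq by fastforce
  then have "finite {x \<in> C. v x (u x) \<noteq> 0}"
    by (rule finite_subset) (use uc y in \<open>simp add: carrier_A\<close>)
  then show "u \<in> carrier A \<and> (\<forall>x\<in>C. u x \<noteq> \<zero>\<^bsub>K x\<^esub>) \<and> finite {x \<in> C. v x (u x) \<noteq> 0}"
    using uc nz by blast
next
  assume u: "u \<in> carrier A \<and> (\<forall>x\<in>C. u x \<noteq> \<zero>\<^bsub>K x\<^esub>) \<and> finite {x \<in> C. v x (u x) \<noteq> 0}"
  define y where "y = (\<lambda>x\<in>C. inv\<^bsub>K x\<^esub> (u x))"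
  have inv: "inv\<^bsub>K x\<^esub> (u x) \<in> carrier (K x)" "u x \<otimes>\<^bsub>K x\<^esub> inv\<^bsub>K x\<^esub> (u x) = \<one>\<^bsub>K x\<^esub>"
    "v x (inv\<^bsub>K x\<^esub> (u x)) = - v x (u x)" if x: "x \<in> C" for x
  proof -
    interpret V: val_field "K x" "v x" n by (rule val_field_K[OF x])
    have ux: "u x \<in> carrier (K x)" "u x \<noteq> \<zero>\<^bsub>K x\<^esub>" using u carrier_A_component x by auto
    then have "u x \<in> Units (K x)" using V.field_Units by auto
    then show "inv\<^bsub>K x\<^esub> (u x) \<in> carrier (K x)" "u x \<otimes>\<^bsub>K x\<^esub> inv\<^bsub>K x\<^esub> (u x) = \<one>\<^bsub>K x\<^esub>" by auto
    show "v x (inv\<^bsub>K x\<^esub> (u x)) = - v x (u x)" using V.v_inv ux by simp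
  qed
  have y: "y \<in> carrier A"
    unfolding y_def using u inv Int_ring_eq by (intro A_memI[of _ "{x \<in> C. v x (u x) \<noteq> 0}"]) auto
  have "u \<otimes>\<^bsub>A\<^esub> y = \<one>\<^bsub>A\<^esub>"
    using u y inv by (intro A_eqI A_closed) (auto simp: A_mult A_one y_def)
  then show "u \<in> Units A" using u y A.m_comm[of u y] unfolding Units_def by auto
qed

abbreviation isom :: "('v, 'k) adele \<Rightarrow> ('v, 'k) adele \<Rightarrow> bool" where
  "isom \<equiv> adelic_root_algebras_iso C n"

lemma isom_trans: "isom a b \<Longrightarrow> isom b c \<Longrightarrow> isom a c"
  unfolding adelic_root_algebras_iso_def by (rule algebra_isomorphic_trans)

lemma isom_sym: "a \<in> carrier A \<Longrightarrow> isom a b \<Longrightarrow> isom b a"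
proof -
  assume a: "a \<in> carrier A" and iso: "isom a b"
  interpret RA: root_alg A n a by unfold_locales fact
  show "isom b a"
    using iso unfolding adelic_root_algebras_iso_def
    by (rule algebra_isomorphic_sym) (rule RA.B.ring_axioms, rule RA.root_algebra_map_hom)
qed

lemma isom_gcd_dvd:
  assumes t: "t1 \<in> carrier A" "t2 \<in> carrier A" and iso: "isom t1 t2"
    and x: "x \<in> C" "t1 x \<noteq> \<zero>\<^bsub>K x\<^esub>" "t2 x \<noteq> \<zero>\<^bsub>K x\<^esub>"
  shows "gcd (int n) (v x (t2 x)) dvd v x (t1 x)"
proof -
  obtain h where h: "h \<in> ring_iso (root_algebra A n t1) (root_algebra A n t2)"
    "\<forall>a\<in>carrier A. h (root_algebra_map A n t1 a) = root_algebra_map A n t2 a"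
    using iso unfolding adelic_root_algebras_iso_def algebra_isomorphic_def by auto
  then show ?thesis
    using val_field.gcd_val_dvd_of_hom[OF val_field_K[OF x(1)] cring_A component_hom[OF x(1)], OF t(1) x(2) t(2) x(3)]
    unfolding ring_iso_def by auto
qed

lemma isom_val_le:
  assumes t1: "parameter_vector C n t1" and t2: "parameter_vector C n t2" and iso: "isom t1 t2"
  shows "\<exists>F. finite F \<and> (\<forall>x\<in>C - F. v x (t2 x) \<le> v x (t1 x))"
proof -
  have c: "t1 \<in> carrier A" "t2 \<in> carrier A" using t1 t2 unfolding parameter_vector_def by auto
  interpret A1: root_alg A n t1 by unfold_locales fact
  interpret A2: root_alg A n t2 by unfold_locales fact
  obtain h where h: "h \<in> ring_iso (root_algebra A n t1) (root_algebra A n t2)"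
    "\<And>a. a \<in> carrier A \<Longrightarrow> h (root_algebra_map A n t1 a) = root_algebra_map A n t2 a"
    using iso unfolding adelic_root_algebras_iso_def algebra_isomorphic_def by auto
  have "h (root_gen A n t1) \<in> carrier (root_algebra A n t2)"
    using ring_iso_memE(1)[OF h(1)] by simp
  then obtain p where p: "p \<in> carrier (UP A)" "h (root_gen A n t1) = PIdl\<^bsub>UP A\<^esub> (root_poly A n t2) +>\<^bsub>UP A\<^esub> p"
    by (rule A2.root_algebraE)
  let ?c = "up_ring.coeff (UP A) p"
  define F where "F = (\<Union>i\<in>{..deg A p}. {x \<in> C. ?c i x \<notin> Int_ring x}) \<union> Ram C n t2 \<union> {x \<in> C. t2 x \<notin> Int_ring x}"
  have pc: "?c i \<in> carrier A" for i using p(1) by simp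
  have "finite F" unfolding F_def using pc c t2 by (auto simp: carrier_A parameter_vector_def)
  moreover have "v x (t2 x) \<le> v x (t1 x)" if x: "x \<in> C - F" for x
  proof -
    have xC: "x \<in> C" using x by simp
    interpret V: val_field "K x" "v x" n by (rule val_field_K[OF xC])
    have nz: "t1 x \<noteq> \<zero>\<^bsub>K x\<^esub>" "t2 x \<noteq> \<zero>\<^bsub>K x\<^esub>" using t1 t2 xC unfolding parameter_vector_def by auto
    show ?thesis
    proof (rule V.v_le_of_iso[OF cring_A component_hom[OF xC], OF c(1) nz(1) c(2) nz(2) _ _ h p])
      show "int n dvd v x (t2 x)" using x unfolding F_def Ram_def by auto
      have "t2 x \<in> Int_ring x" using x unfolding F_def by auto
      then show "0 \<le> v x (t2 x)" using Int_ring_eq[OF xC] nz by auto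
      fix i show "?c i x \<in> V.val_ge 0"
      proof (cases "i \<le> deg A p")
        case True
        then show ?thesis using x Int_ring_val_ge[OF xC] unfolding F_def by auto
      next
        case False
        then have "?c i = \<zero>\<^bsub>A\<^esub>" using p(1) by (intro A1.U.deg_aboveD) auto
        then show ?thesis using A_zero[OF xC] by simp
      qed
    qed
  qed
  ultimately show ?thesis by blast
qed

lemma isom_change_point:
  assumes t: "t \<in> carrier A" and t': "t' \<in> carrier A" and y: "y \<in> C"
    and nz: "t y \<noteq> \<zero>\<^bsub>K y\<^esub>" "t' y \<noteq> \<zero>\<^bsub>K y\<^esub>"
    and gcd: "gcd (int n) (v y (t y)) = gcd (int n) (v y (t' y))"
    and agree: "\<And>x. x \<in> C \<Longrightarrow> x \<noteq> y \<Longrightarrow> t' x = t x"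
  shows "isom t' t"
proof -
  interpret V: val_field "K y" "v y" n by (rule val_field_K[OF y])
  obtain k k' m :: nat where kk: "k * k' = 1 + n * m" and dvd: "int n dvd v y (t' y) - int k * v y (t y)"
    using coprime_multiplier_mod[OF _ gcd] n_gt_1 by auto
  have ty: "t y \<in> carrier (K y)" "t' y \<in> carrier (K y)" using t t' y carrier_A_component by auto
  have inv_ex: "\<exists>b\<in>carrier (K y). a \<otimes>\<^bsub>K y\<^esub> b = \<one>\<^bsub>K y\<^esub> \<and> b \<noteq> \<zero>\<^bsub>K y\<^esub> \<and> v y b = - v y a"
    if "a \<in> carrier (K y)" "a \<noteq> \<zero>\<^bsub>K y\<^esub>" for a
  proof -
    have "a \<in> Units (K y)" using that V.field_Units by auto
    then show ?thesis using V.v_inv[OF that] V.Units_inv_Units V.field_Units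
      by (intro bexI[of _ "inv\<^bsub>K y\<^esub> a"]) auto
  qed
  obtain r0 where r0: "r0 \<in> carrier (K y)" "t y \<otimes>\<^bsub>K y\<^esub> r0 = \<one>\<^bsub>K y\<^esub>" using inv_ex[OF ty(1) nz(1)] by auto
  have tk: "t y [^]\<^bsub>K y\<^esub> k \<in> carrier (K y)" "t y [^]\<^bsub>K y\<^esub> k \<noteq> \<zero>\<^bsub>K y\<^esub>" using ty nz V.pow_nonzero by auto
  obtain b where b: "b \<in> carrier (K y)" "t y [^]\<^bsub>K y\<^esub> k \<otimes>\<^bsub>K y\<^esub> b = \<one>\<^bsub>K y\<^esub>" "b \<noteq> \<zero>\<^bsub>K y\<^esub>" "v y b = - (int k * v y (t y))"
    using inv_ex[OF tk] V.v_pow[OF ty(1) nz(1)] by auto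
  have z: "t' y \<otimes>\<^bsub>K y\<^esub> b \<in> carrier (K y)" "t' y \<otimes>\<^bsub>K y\<^esub> b \<noteq> \<zero>\<^bsub>K y\<^esub>" "int n dvd v y (t' y \<otimes>\<^bsub>K y\<^esub> b)"
    using ty nz b dvd V.v_mult[of "t' y" b] by (auto simp: V.integral_iff)
  obtain s0 where s0: "s0 \<in> carrier (K y)" "s0 [^]\<^bsub>K y\<^esub> n = t' y \<otimes>\<^bsub>K y\<^esub> b" using V.root_ex[OF z] by auto
  have s0_nz: "s0 \<noteq> \<zero>\<^bsub>K y\<^esub>" using s0 z V.nat_pow_zero[of n] n_gt_1 by auto
  obtain s1 where s1: "s1 \<in> carrier (K y)" "s0 \<otimes>\<^bsub>K y\<^esub> s1 = \<one>\<^bsub>K y\<^esub>" using inv_ex[OF s0(1) s0_nz] by auto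
  have s0_pow: "t' y = s0 [^]\<^bsub>K y\<^esub> n \<otimes>\<^bsub>K y\<^esub> t y [^]\<^bsub>K y\<^esub> k"
    unfolding s0(2) using b tk ty by (simp add: V.m_assoc V.m_comm[of b])
  define pt where "pt z = (\<lambda>x\<in>C. if x = y then z else \<zero>\<^bsub>K x\<^esub>)" for z
  have pt_closed: "pt z \<in> carrier A" if "z \<in> carrier (K y)" for z
    unfolding pt_def using that Int_ring_closed Int_ring_eq by (intro A_memI[of _ "{y}"]) auto
  have pt_y: "pt z y = z" for z using y by (simp add: pt_def)
  have pt_other: "x \<in> C \<Longrightarrow> x \<noteq> y \<Longrightarrow> pt z x = \<zero>\<^bsub>K x\<^esub>" for x z by (simp add: pt_def)
  define e where "e = pt \<one>\<^bsub>K y\<^esub>"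
  define f where "f = (\<lambda>x\<in>C. if x = y then \<zero>\<^bsub>K x\<^esub> else \<one>\<^bsub>K x\<^esub>)"
  have e: "e \<in> carrier A" unfolding e_def by (rule pt_closed) simp
  have f: "f \<in> carrier A" unfolding f_def using Int_ring_closed Int_ring_eq by (intro A_memI[of _ "{}"]) auto
  have pt_point: "e y = \<one>\<^bsub>K y\<^esub>" "f y = \<zero>\<^bsub>K y\<^esub>" using y by (simp_all add: e_def f_def pt_y)
  have off_point: "e x = \<zero>\<^bsub>K x\<^esub>" "f x = \<one>\<^bsub>K x\<^esub>" if "x \<in> C" "x \<noteq> y" for x
    using that by (simp_all add: e_def f_def pt_other)
  have eqI: "a = b" if "a \<in> carrier A" "b \<in> carrier A" "a y = b y" "\<And>x. x \<in> C \<Longrightarrow> x \<noteq> y \<Longrightarrow> a x = b x" for a b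
    using that A_eqI by metis
  note rules = cring.cring_simprules[OF cring_K]
  have zero_mult: "\<zero>\<^bsub>K x\<^esub> \<otimes>\<^bsub>K x\<^esub> a x = \<zero>\<^bsub>K x\<^esub>" if "x \<in> C" "a \<in> carrier A" for x a
  proof -
    interpret W: cring "K x" by (rule cring_K[OF that(1)])
    show ?thesis using carrier_A_component[OF that(2,1)] by simp
  qed
  have e_mult: "e \<otimes>\<^bsub>A\<^esub> a = e \<otimes>\<^bsub>A\<^esub> b" if "a \<in> carrier A" "b \<in> carrier A" "a y = b y" for a b
    using that e zero_mult by (intro eqI) (auto simp: A_mult off_point y)
  have f_mult: "f \<otimes>\<^bsub>A\<^esub> a = f \<otimes>\<^bsub>A\<^esub> b"
    if "a \<in> carrier A" "b \<in> carrier A" "\<And>x. x \<in> C \<Longrightarrow> x \<noteq> y \<Longrightarrow> a x = b x" for a b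
    using that f zero_mult[OF y] by (intro eqI) (auto simp: A_mult pt_point y)
  show ?thesis
    unfolding adelic_root_algebras_iso_def
  proof (rule A.root_algebras_isomorphic_twist[OF e f _ _ _ _ _ _ _ t t' kk])
    show "pt s0 \<in> carrier A" "pt s1 \<in> carrier A" "pt r0 \<in> carrier A" using s0 s1 r0 pt_closed by auto
    note c = this
    have "e \<otimes>\<^bsub>A\<^esub> e = e \<otimes>\<^bsub>A\<^esub> \<one>\<^bsub>A\<^esub>" using e by (intro e_mult) (auto simp: pt_point A_one y)
    then show "e \<otimes>\<^bsub>A\<^esub> e = e" using e by simp
    have "f \<otimes>\<^bsub>A\<^esub> f = f \<otimes>\<^bsub>A\<^esub> \<one>\<^bsub>A\<^esub>" using f by (intro f_mult) (auto simp: off_point A_one)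
    then show "f \<otimes>\<^bsub>A\<^esub> f = f" using f by simp
    have "e \<otimes>\<^bsub>A\<^esub> f = e \<otimes>\<^bsub>A\<^esub> \<zero>\<^bsub>A\<^esub>" using f by (intro e_mult) (auto simp: pt_point A_zero y)
    then show "e \<otimes>\<^bsub>A\<^esub> f = \<zero>\<^bsub>A\<^esub>" using e by simp
    show "e \<oplus>\<^bsub>A\<^esub> f = \<one>\<^bsub>A\<^esub>"
      using e f y by (intro eqI) (auto simp: A_add A_one pt_point off_point rules)
    have "e \<otimes>\<^bsub>A\<^esub> (pt s0 \<otimes>\<^bsub>A\<^esub> pt s1) = e \<otimes>\<^bsub>A\<^esub> \<one>\<^bsub>A\<^esub>"
      using c s1 y by (intro e_mult) (auto simp: pt_y A_mult A_one)
    then show "e \<otimes>\<^bsub>A\<^esub> (pt s0 \<otimes>\<^bsub>A\<^esub> pt s1) = e" using e by simp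
    have "e \<otimes>\<^bsub>A\<^esub> (t \<otimes>\<^bsub>A\<^esub> pt r0) = e \<otimes>\<^bsub>A\<^esub> \<one>\<^bsub>A\<^esub>"
      using c t r0 y by (intro e_mult) (auto simp: pt_y A_mult A_one)
    then have "e \<otimes>\<^bsub>A\<^esub> (t \<otimes>\<^bsub>A\<^esub> pt r0) [^]\<^bsub>A\<^esub> m = e \<otimes>\<^bsub>A\<^esub> \<one>\<^bsub>A\<^esub> [^]\<^bsub>A\<^esub> m"
      using e c t by (intro A.idem_cong_pow) auto
    then show "e \<otimes>\<^bsub>A\<^esub> (t \<otimes>\<^bsub>A\<^esub> pt r0) [^]\<^bsub>A\<^esub> m = e" using e by simp
    show "e \<otimes>\<^bsub>A\<^esub> t' = e \<otimes>\<^bsub>A\<^esub> (pt s0 [^]\<^bsub>A\<^esub> n \<otimes>\<^bsub>A\<^esub> t [^]\<^bsub>A\<^esub> k)"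
    proof (rule e_mult)
      show "t' y = (pt s0 [^]\<^bsub>A\<^esub> n \<otimes>\<^bsub>A\<^esub> t [^]\<^bsub>A\<^esub> k) y"
        using s0_pow c t y by (simp add: A_mult A_pow pt_y)
    qed (use c t t' in auto)
    show "f \<otimes>\<^bsub>A\<^esub> t' = f \<otimes>\<^bsub>A\<^esub> t" using t t' agree by (intro f_mult) auto
  qed
qed

lemma isom_change_finite:
  assumes "finite F" "F \<subseteq> C" "t \<in> carrier A" "t' \<in> carrier A"
    and "\<And>x. x \<in> F \<Longrightarrow> t x \<noteq> \<zero>\<^bsub>K x\<^esub> \<and> t' x \<noteq> \<zero>\<^bsub>K x\<^esub> \<and> gcd (int n) (v x (t x)) = gcd (int n) (v x (t' x))"
    and "\<And>x. x \<in> C \<Longrightarrow> x \<notin> F \<Longrightarrow> t' x = t x"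
  shows "isom t' t"
  using assms
proof (induction F arbitrary: t rule: finite_induct)
  case empty
  then have "t' = t" using A_eqI by auto
  then show ?case unfolding adelic_root_algebras_iso_def by (simp add: algebra_isomorphic_refl)
next
  case (insert y F)
  define s where "s = (\<lambda>x\<in>C. if x = y then t' x else t x)"
  have s: "s \<in> carrier A"
    unfolding s_def using insert.prems carrier_A_component
    by (intro A_memI[of _ "{x \<in> C. t x \<notin> Int_ring x} \<union> {y}"]) (auto simp: carrier_A)
  have yC: "y \<in> C" and FC: "F \<subseteq> C" using insert.prems(1) by auto
  have s_x: "s x = (if x = y then t' x else t x)" if "x \<in> C" for x using that by (simp add: s_def)
  have "isom t' s"
  proof (rule insert.IH[OF FC s insert.prems(3)])
    fix x assume x: "x \<in> F"
    then have "x \<in> C" "x \<noteq> y" using FC insert.hyps(2) by auto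
    then have "s x = t x" using s_x[of x] by simp
    then show "s x \<noteq> \<zero>\<^bsub>K x\<^esub> \<and> t' x \<noteq> \<zero>\<^bsub>K x\<^esub> \<and> gcd (int n) (v x (s x)) = gcd (int n) (v x (t' x))"
      using insert.prems(4)[of x] x by simp
  next
    fix x assume "x \<in> C" "x \<notin> F"
    then show "t' x = s x" using s_x[of x] insert.prems(5)[of x] by simp
  qed
  moreover have "isom s t"
  proof (rule isom_change_point[OF insert.prems(2) s yC])
    show "t y \<noteq> \<zero>\<^bsub>K y\<^esub>" "s y \<noteq> \<zero>\<^bsub>K y\<^esub>" "gcd (int n) (v y (t y)) = gcd (int n) (v y (s y))"
      using insert.prems(4)[of y] s_x[OF yC] by simp_all
    show "s x = t x" if "x \<in> C" "x \<noteq> y" for x using s_x[OF that(1)] that(2) by simp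
  qed
  ultimately show ?case by (rule isom_trans)
qed

lemma ramification_profile_eq_iff:
  "ramification_profile C n t1 = ramification_profile C n t2 \<longleftrightarrow>
    (\<forall>x\<in>C. gcd (int n) (v x (t1 x)) = gcd (int n) (v x (t2 x)))"
proof -
  have "n div nat (gcd (int n) a) = n div nat (gcd (int n) b) \<longleftrightarrow> gcd (int n) a = gcd (int n) b" for a b
  proof
    assume eq: "n div nat (gcd (int n) a) = n div nat (gcd (int n) b)"
    have d: "nat (gcd (int n) c) dvd n" for c by (simp add: nat_dvd_iff)
    have "n div (n div nat (gcd (int n) c)) = nat (gcd (int n) c)" for c
      using div_div_eq_right[OF d[of c] dvd_refl] d[of c] n_gt_1 by auto
    then have "nat (gcd (int n) a) = nat (gcd (int n) b)" using eq by metis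
    then show "gcd (int n) a = gcd (int n) b" by (metis gcd_ge_0_int int_nat_eq)
  qed simp
  then show ?thesis unfolding ramification_profile_def by (auto simp: fun_eq_iff restrict_def)
qed

lemma isom_iff:
  assumes t1: "parameter_vector C n t1" and t2: "parameter_vector C n t2"
  shows "isom t1 t2 \<longleftrightarrow> ramification_profile C n t1 = ramification_profile C n t2 \<and>
    (\<exists>u\<in>idele_group C. t1 = u \<otimes>\<^bsub>A\<^esub> t2)"
proof
  have c: "t1 \<in> carrier A" "t2 \<in> carrier A" using t1 t2 unfolding parameter_vector_def by auto
  have nz: "t1 x \<noteq> \<zero>\<^bsub>K x\<^esub>" "t2 x \<noteq> \<zero>\<^bsub>K x\<^esub>" if "x \<in> C" for x
    using t1 t2 that unfolding parameter_vector_def by auto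
  {
    assume iso: "isom t1 t2"
    then have iso': "isom t2 t1" using isom_sym c by blast
    have "gcd (int n) (v x (t1 x)) = gcd (int n) (v x (t2 x))" if x: "x \<in> C" for x
    proof (rule zdvd_antisym_nonneg)
      show "gcd (int n) (v x (t1 x)) dvd gcd (int n) (v x (t2 x))"
        using isom_gcd_dvd[OF c(2,1) iso' x nz(2,1)[OF x]] by simp
      show "gcd (int n) (v x (t2 x)) dvd gcd (int n) (v x (t1 x))"
        using isom_gcd_dvd[OF c iso x nz[OF x]] by simp
    qed auto
    then have profile: "ramification_profile C n t1 = ramification_profile C n t2"
      unfolding ramification_profile_eq_iff by blast
    obtain F where F: "finite F" "\<And>x. x \<in> C - F \<Longrightarrow> v x (t2 x) \<le> v x (t1 x)"
      using isom_val_le[OF t1 t2 iso] by auto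
    obtain F' where F': "finite F'" "\<And>x. x \<in> C - F' \<Longrightarrow> v x (t1 x) \<le> v x (t2 x)"
      using isom_val_le[OF t2 t1 iso'] by auto
    have "\<exists>u. x \<in> C \<longrightarrow> u \<in> carrier (K x) \<and> t1 x = u \<otimes>\<^bsub>K x\<^esub> t2 x \<and> u \<noteq> \<zero>\<^bsub>K x\<^esub> \<and> v x u = v x (t1 x) - v x (t2 x)" for x
    proof (cases "x \<in> C")
      case x: True
      interpret V: val_field "K x" "v x" n by (rule val_field_K[OF x])
      have tx: "t1 x \<in> carrier (K x)" "t2 x \<in> carrier (K x)" using c x carrier_A_component by auto
      have "t2 x \<in> Units (K x)" using tx nz[OF x] V.field_Units by auto
      then have i: "inv\<^bsub>K x\<^esub> (t2 x) \<in> carrier (K x)" "inv\<^bsub>K x\<^esub> (t2 x) \<noteq> \<zero>\<^bsub>K x\<^esub>" "inv\<^bsub>K x\<^esub> (t2 x) \<otimes>\<^bsub>K x\<^esub> t2 x = \<one>\<^bsub>K x\<^esub>"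
        using V.Units_inv_Units V.field_Units by auto
      then show ?thesis
        using tx nz[OF x] V.v_mult[of "t1 x" "inv\<^bsub>K x\<^esub> (t2 x)"] V.v_inv[of "t2 x"]
        by (intro exI[of _ "t1 x \<otimes>\<^bsub>K x\<^esub> inv\<^bsub>K x\<^esub> (t2 x)"]) (auto simp: V.m_assoc V.integral_iff)
    qed simp
    then obtain u0 where u0: "\<And>x. x \<in> C \<Longrightarrow> u0 x \<in> carrier (K x) \<and> t1 x = u0 x \<otimes>\<^bsub>K x\<^esub> t2 x \<and> u0 x \<noteq> \<zero>\<^bsub>K x\<^esub> \<and> v x (u0 x) = v x (t1 x) - v x (t2 x)"
      by metis
    define u where "u = (\<lambda>x\<in>C. u0 x)"
    have fin: "finite (F \<union> F')" using F F' by simp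
    have v0: "v x (u0 x) = 0" if "x \<in> C" "x \<notin> F \<union> F'" for x
      using u0[OF that(1)] F(2)[of x] F'(2)[of x] that by force
    have u: "u \<in> carrier A"
      unfolding u_def using u0 v0 Int_ring_eq by (intro A_memI[OF _ fin]) auto
    have "{x \<in> C. v x (u x) \<noteq> 0} \<subseteq> F \<union> F'" using v0 unfolding u_def by auto
    then have "finite {x \<in> C. v x (u x) \<noteq> 0}" using fin finite_subset by blast
    then have "u \<in> Units A" using u u0 unfolding unit_A_iff by (auto simp: u_def)
    moreover have "t1 = u \<otimes>\<^bsub>A\<^esub> t2"
      using c u u0 by (intro A_eqI) (auto simp: A_mult u_def)
    ultimately show "ramification_profile C n t1 = ramification_profile C n t2 \<and> (\<exists>u\<in>idele_group C. t1 = u \<otimes>\<^bsub>A\<^esub> t2)"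
      using profile unfolding idele_group_def by blast
  next
    assume "ramification_profile C n t1 = ramification_profile C n t2 \<and> (\<exists>u\<in>idele_group C. t1 = u \<otimes>\<^bsub>A\<^esub> t2)"
    then obtain u where gcd: "\<And>x. x \<in> C \<Longrightarrow> gcd (int n) (v x (t1 x)) = gcd (int n) (v x (t2 x))"
      and u: "u \<in> Units A" and t1u: "t1 = u \<otimes>\<^bsub>A\<^esub> t2"
      unfolding ramification_profile_eq_iff idele_group_def by auto
    define F where "F = {x \<in> C. v x (u x) \<noteq> 0}"
    have F: "finite F" "F \<subseteq> C" and uc: "u \<in> carrier A" and unz: "\<And>x. x \<in> C \<Longrightarrow> u x \<noteq> \<zero>\<^bsub>K x\<^esub>"
      using u unfolding unit_A_iff F_def by auto
    have "\<exists>s. x \<in> C \<longrightarrow> s \<in> carrier (K x) \<and> s \<noteq> \<zero>\<^bsub>K x\<^esub> \<and> v x s = 0 \<and> s [^]\<^bsub>K x\<^esub> n = (if x \<in> F then \<one>\<^bsub>K x\<^esub> else u x)" for x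
    proof (cases "x \<in> C")
      case x: True
      interpret V: val_field "K x" "v x" n by (rule val_field_K[OF x])
      show ?thesis
      proof (cases "x \<in> F")
        case True
        then show ?thesis by (intro exI[of _ "\<one>\<^bsub>K x\<^esub>"]) simp
      next
        case False
        then have v0: "v x (u x) = 0" using x unfolding F_def by auto
        have ux: "u x \<in> carrier (K x)" using uc x carrier_A_component by auto
        obtain s where s: "s \<in> carrier (K x)" "s [^]\<^bsub>K x\<^esub> n = u x"
          using V.root_ex[OF ux unz[OF x]] v0 by auto
        have s0: "s \<noteq> \<zero>\<^bsub>K x\<^esub>" using s unz[OF x] V.nat_pow_zero[of n] n_gt_1 by auto
        have "v x s = 0" using V.v_pow[OF s(1) s0, of n] s(2) v0 n_gt_1 by simp
        then show ?thesis using s s0 False by auto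
      qed
    qed simp
    then obtain s0 where s0: "\<And>x. x \<in> C \<Longrightarrow> s0 x \<in> carrier (K x) \<and> s0 x \<noteq> \<zero>\<^bsub>K x\<^esub> \<and> v x (s0 x) = 0 \<and> s0 x [^]\<^bsub>K x\<^esub> n = (if x \<in> F then \<one>\<^bsub>K x\<^esub> else u x)"
      by metis
    define s where "s = (\<lambda>x\<in>C. s0 x)"
    have sc: "s \<in> carrier A"
      unfolding s_def using s0 Int_ring_eq by (intro A_memI[of _ "{}"]) auto
    have "{x \<in> C. v x (s x) \<noteq> 0} = {}" using s0 by (auto simp: s_def)
    then have sU: "s \<in> Units A" using sc s0 unfolding unit_A_iff by (simp add: s_def)
    have scale: "isom (s [^]\<^bsub>A\<^esub> n \<otimes>\<^bsub>A\<^esub> t2) t2"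
      unfolding adelic_root_algebras_iso_def
      by (rule A.root_algebras_isomorphic_scale[of s "inv\<^bsub>A\<^esub> s"]) (use sc sU c in auto)
    have comp: "(s [^]\<^bsub>A\<^esub> n \<otimes>\<^bsub>A\<^esub> t2) x = (if x \<in> F then t2 x else t1 x)" if x: "x \<in> C" for x
    proof -
      interpret W: cring "K x" by (rule cring_K[OF x])
      show ?thesis
        using s0[OF x] x sc carrier_A_component[OF c(2) x] fun_cong[OF t1u, of x]
        by (simp add: A_mult A_pow) (simp add: s_def)
    qed
    have "isom t1 (s [^]\<^bsub>A\<^esub> n \<otimes>\<^bsub>A\<^esub> t2)"
      by (rule isom_change_finite[OF F]) (use comp c sc F nz gcd in auto)
    then show "isom t1 t2" using scale by (rule isom_trans)
  }
qed

end

theorem theorem2p19: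
  fixes C :: "('v::finite, 'k::alg_closed_field) point set"
    and n :: nat
    and t1 t2 :: "('v, 'k) adele"
  assumes "nonsingular_proj_curve C"
    and "n > 1"
    and "CHAR('k) = 0 \<or> coprime n CHAR('k)"
    and "parameter_vector C n t1"
    and "parameter_vector C n t2"
  shows "(adelic_root_algebras_iso C n t1 t2 \<longleftrightarrow>
            ramification_profile C n t1 = ramification_profile C n t2 \<and>
            (\<exists>u \<in> idele_group C. t1 = u \<otimes>\<^bsub>adele_ring C\<^esub> t2)) \<and>
         (t1 \<in> idele_group C \<and> t2 \<in> idele_group C \<longrightarrow>
            (adelic_root_algebras_iso C n t1 t2 \<longleftrightarrow>
             ramification_profile C n t1 = ramification_profile C n t2))"
proof -
  interpret adelic_curve C n by unfold_locales fact+
  have "\<exists>u\<in>idele_group C. t1 = u \<otimes>\<^bsub>adele_ring C\<^esub> t2"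
    if t: "t1 \<in> idele_group C" "t2 \<in> idele_group C"
  proof (rule bexI[of _ "t1 \<otimes>\<^bsub>adele_ring C\<^esub> inv\<^bsub>adele_ring C\<^esub> t2"])
    show "t1 = t1 \<otimes>\<^bsub>adele_ring C\<^esub> inv\<^bsub>adele_ring C\<^esub> t2 \<otimes>\<^bsub>adele_ring C\<^esub> t2"
      using t unfolding idele_group_def by (simp add: A.m_assoc A.Units_closed)
    show "t1 \<otimes>\<^bsub>adele_ring C\<^esub> inv\<^bsub>adele_ring C\<^esub> t2 \<in> idele_group C"
      using t unfolding idele_group_def by simp
  qed
  then show ?thesis using isom_iff[OF assms(4,5)] by blast
qed

end
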